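(* Let $D\subset\mathbb{C}^n$ be an open invariant set, $f\in\mathcal{SR}(\Omega_D)$, and let $a=(a_1,\dots,a_n)\in\Omega_D$ and $r_1,\dots,r_n\ge0$ be such that $\overline{B_{r_1}(a_1)}\times\dots\times\overline{B_{r_n}(a_n)}\subset\Omega_D$. Let $m\in\{1,\dots,n\}$ and $x_1,\dots,x_m\in\mathbb{B}_\mathbb{H}$. Then $$f\Big(a+\sum_{i=1}^mr_ix_i\Big)=\sum_{K\in\mathcal{P}(m)}(-1)^{|K^c|}\,(\overline{a}+r\overline{x})_{K^c}\int_{(\mathbb{S}^3)^m}\mathcal{S}^{\llbracket m\rrbracket}_K(f)\Big(a+\sum_{i=1}^mr_i\xi_i\Big)\prod_{j=1}^mP(x_j,\xi_j)\,d\sigma^m(\xi),$$ where $K^c=\{1,\dots,m\}\setminus K$, $(\overline a+r\overline x)_{K^c}$ is the ordered product over $k\in K^c$ (increasing $k$) of $\overline{a_k}+r_k\overline{x_k}$, and $P(x,\xi)=\dfrac{1-|x|^2}{|x-\xi|^4}$.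
   Context: Sets and products. $\mathbb{H}\cong\mathbb{R}^4$ denotes the quaternions, $\mathbb{B}_\mathbb{H}$ its open unit ball, $\mathbb{S}_\mathbb{H}=\{J\in\mathbb{H}: J^2=-1\}$, $\mathcal{P}(m)$ is the power set of $\llbracket m\rrbracket:=\{1,\dots,m\}$. For $K=\{k_1<\dots<k_p\}$ and quaternions $q_k$, $q_K:=q_{k_1}\cdots q_{k_p}$ (increasing order), $q_\emptyset:=1$. For $z\in\mathbb{C}^n$ write $z_h=\alpha_h+i\beta_h$ with $\alpha_h,\beta_h\in\mathbb{R}$, and let $\overline z^h$ be $z$ with $z_h$ replaced by $\overline{z_h}$. Stem and slice functions. $D\subset\mathbb{C}^n$ is invariant if $z\in D\iff\overline z^h\in D$ for all $h$. Let $\{e_K\}_{K\in\mathcal{P}(n)}$ be a basis of $\mathbb{R}^{2^n}$, $e_\emptyset=1$, $e_h:=e_{\{h\}}$. A stem function on $D$ is a continuous $F=\sum_{K\in\mathcal{P}(n)}e_KF_K:D\to\mathbb{H}\otimes\mathbb{R}^{2^n}$ ($F_K$ $\mathbb{H}$-valued) with $F_K(\overline z^h)=(-1)^{|K\cap\{h\}|}F_K(z)$ for all $K,h$. The circularization of $D$ is $\Omega_D=\{(\alpha_1+J_1\beta_1,\dots,\alpha_n+J_n\beta_n): (\alpha_1+i\beta_1,\dots,\alpha_n+i\beta_n)\in D,\ J_1,\dots,J_n\in\mathbb{S}_\mathbb{H}\}$. $F$ induces the slice function $f=\mathcal{I}(F):\Omega_D\to\mathbb{H}$, $f(x)=\sum_{K}J_KF_K(z)$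 for $x=(\alpha_h+J_h\beta_h)_h$, $z=(\alpha_h+i\beta_h)_h$; the stem function $F$ is determined by $f$. $\mathcal{S}(\Omega_D)$ is the set of slice functions on $\Omega_D$. Product: $(F\otimes G)(z)=\sum_{H,K}(-1)^{|H\cap K|}e_{K\Delta H}F_K(z)G_H(z)$ ($\Delta$ = symmetric difference) and $\mathcal{I}(F)\odot\mathcal{I}(G):=\mathcal{I}(F\otimes G)$. The $j$-th coordinate function, also written $x_j$, is the slice function induced by $Z_j(z)=\alpha_j+e_j\beta_j$; $x_K$ is the ordered product of the $x_k$, $k\in K$. Regularity. $\mathcal{J}_h(q\otimes e_K)=(-1)^{|K\cap\{h\}|}q\otimes e_{K\Delta\{h\}}$ and $\overline\partial_h=\frac12(\partial/\partial\alpha_h+\mathcal{J}_h\,\partial/\partial\beta_h)$. A $C^1$ stem function $F$ is holomorphic if $\overline\partial_hF=0$ for every $h=1,\dots,n$; $f=\mathcal{I}(F)$ is slice regular if $F$ is holomorphic. $\mathcal{SR}(\Omega_D)$ is the set of slice regular functions. Spherical derivatives and components. For $H\in\mathcal{P}(n)$ let $H^c=\{1,\dots,n\}\setminus H$, $D_H=\{z\in D:\beta_h\ne0\ \forall h\in H\}$, $\Omega_{D_H}$ its circularization, and for $f=\mathcal{I}(F)\in\mathcal{S}(\Omega_D)$ let $f'_{s,H}=\mathcal{I}(F'_H)\in\mathcal{S}(\Omega_{D_H})$, where $F'_H(z)=\big(\prod_{h\in H}\beta_h\big)^{-1}\sum_{K\subset H^c}e_KF_{K\cup H}(z)$. For $K\subset\llbracket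 m\rrbracket$ define $\mathcal{S}^{\llbracket m\rrbracket}_K(f):=(x_K\odot f)'_{s,\llbracket m\rrbracket}$ on $\Omega_{D_{\llbracket m\rrbracket}}$. When $f$ is slice regular, $\mathcal{S}^{\llbracket m\rrbracket}_K(f)$ extends continuously (in a unique way) to $\Omega_D$ and the extension is denoted by the same symbol. Conventions. $\overline{B_r(q)}=\{x\in\mathbb{H}:|x-q|\le r\}$. $\mathbb{S}^3$ is the unit sphere of $\mathbb{H}\cong\mathbb{R}^4$, $\sigma$ its surface measure normalized by $\sigma(\mathbb{S}^3)=1$, $\sigma^l$ the $l$-fold product measure, in the variables $\xi=(\xi_1,\dots,\xi_l)$. For $a\in\mathbb{H}^n$ and quaternions $q_i$ ($i\in I\subset\{1,\dots,n\}$), $a+\sum_{i\in I}q_i$ denotes the point of $\mathbb{H}^n$ obtained from $a$ by replacing $a_i$ with $a_i+q_i$ for each $i\in I$. *)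

theory Defs
  imports "HOL-Analysis.Analysis"
begin

section \<open>Quaternions\<close>

datatype quat = Quat (qRe: real) (qI: real) (qJ: real) (qK: real)

lemma quat_eq_iff: "x = y \<longleftrightarrow> qRe x = qRe y \<and> qI x = qI y \<and> qJ x = qJ y \<and> qK x = qK y"
  by (cases x; cases y) auto

definition qcnj :: "quat \<Rightarrow> quat"
  where "qcnj x = Quat (qRe x) (- qI x) (- qJ x) (- qK x)"

instantiation quat :: ab_group_add
begin

definition "0 = Quat 0 0 0 0"
definition "x + y = Quat (qRe x + qRe y) (qI x + qI y) (qJ x + qJ y) (qK x + qK y)"
definition "- x = Quat (- qRe x) (- qI x) (- qJ x) (- qK x)"
definition "x - y = Quat (qRe x - qRe y) (qI x - qI y) (qJ x - qJ y) (qK x - qK y)"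

instance
  by standard
    (simp_all add: zero_quat_def plus_quat_def uminus_quat_def minus_quat_def quat_eq_iff)

end

lemma quat_add_simps [simp]:
  "qRe 0 = 0" "qI 0 = 0" "qJ 0 = 0" "qK 0 = 0"
  "qRe (x + y) = qRe x + qRe y" "qI (x + y) = qI x + qI y"
  "qJ (x + y) = qJ x + qJ y" "qK (x + y) = qK x + qK y"
  "qRe (- x) = - qRe x" "qI (- x) = - qI x" "qJ (- x) = - qJ x" "qK (- x) = - qK x"
  "qRe (x - y) = qRe x - qRe y" "qI (x - y) = qI x - qI y"
  "qJ (x - y) = qJ x - qJ y" "qK (x - y) = qK x - qK y"
  by (simp_all add: zero_quat_def plus_quat_def uminus_quat_def minus_quat_def)

instantiation quat :: ring_1
begin

definition "1 = Quat 1 0 0 0"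
definition "x * y = Quat
  (qRe x * qRe y - qI x * qI y - qJ x * qJ y - qK x * qK y)
  (qRe x * qI y + qI x * qRe y + qJ x * qK y - qK x * qJ y)
  (qRe x * qJ y - qI x * qK y + qJ x * qRe y + qK x * qI y)
  (qRe x * qK y + qI x * qJ y - qJ x * qI y + qK x * qRe y)"

instance
  by standard (simp_all add: one_quat_def times_quat_def quat_eq_iff algebra_simps)

end

lemma quat_mult_simps [simp]:
  "qRe 1 = 1" "qI 1 = 0" "qJ 1 = 0" "qK 1 = 0"
  "qRe (x * y) = qRe x * qRe y - qI x * qI y - qJ x * qJ y - qK x * qK y"
  "qI (x * y) = qRe x * qI y + qI x * qRe y + qJ x * qK y - qK x * qJ y"
  "qJ (x * y) = qRe x * qJ y - qI x * qK y + qJ x * qRe y + qK x * qI y"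
  "qK (x * y) = qRe x * qK y + qI x * qJ y - qJ x * qI y + qK x * qRe y"
  by (simp_all add: one_quat_def times_quat_def)

instantiation quat :: real_algebra_1
begin

definition "scaleR r x = Quat (r * qRe x) (r * qI x) (r * qJ x) (r * qK x)"

instance
  by standard (simp_all only: quat_eq_iff scaleR_quat_def quat.sel quat_add_simps
    quat_mult_simps, simp_all add: algebra_simps)

end

lemma quat_scaleR_simps [simp]:
  "qRe (r *\<^sub>R x) = r * qRe x" "qI (r *\<^sub>R x) = r * qI x"
  "qJ (r *\<^sub>R x) = r * qJ x" "qK (r *\<^sub>R x) = r * qK x"
  by (simp_all add: scaleR_quat_def)

instantiation quat :: real_inner
begin

definition "inner x y = qRe x * qRe y + qI x * qI y + qJ x * qJ y + qK x * qK y"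
definition "norm (x::quat) = sqrt (inner x x)"
definition "sgn (x::quat) = x /\<^sub>R norm x"
definition "dist (x::quat) y = norm (x - y)"
definition "(uniformity :: (quat \<times> quat) filter) = (INF e\<in>{0 <..}. principal {(x, y). dist x y < e})"
definition "open (U :: quat set) \<longleftrightarrow> (\<forall>x\<in>U. eventually (\<lambda>(x', y). x' = x \<longrightarrow> y \<in> U) uniformity)"

instance
proof
  fix x y z :: quat and r :: real
  show "inner x x = 0 \<longleftrightarrow> x = 0"
    by (auto simp: inner_quat_def quat_eq_iff add_nonneg_eq_0_iff)
qed (simp_all add: inner_quat_def norm_quat_def sgn_quat_def dist_quat_def
       uniformity_quat_def open_quat_def algebra_simps)

end

instantiation quat :: real_normed_div_algebra
begin

definition "inverse (x::quat) = qcnj x /\<^sub>R (norm x)\<^sup>2"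
definition "x div (y::quat) = x * inverse y"

instance
proof
  fix x y :: quat
  show "norm (x * y) = norm x * norm y"
    unfolding norm_quat_def real_sqrt_mult [symmetric]
    by (rule arg_cong [where f = sqrt])
      (simp only: inner_quat_def quat_mult_simps, simp add: algebra_simps)
  show "x div y = x * inverse y"
    by (rule divide_quat_def)
  assume "x \<noteq> 0"
  then have nz: "inner x x \<noteq> 0"
    by simp
  have "(norm x)\<^sup>2 = inner x x"
    by (simp add: norm_quat_def)
  moreover have "qcnj x * x = inner x x *\<^sub>R 1" "x * qcnj x = inner x x *\<^sub>R 1"
    by (simp_all only: qcnj_def quat_eq_iff inner_quat_def quat.sel quat_mult_simps
        quat_scaleR_simps, simp_all)
  ultimately show "inverse x * x = 1" "x * inverse x = 1"
    using nz by (simp_all add: inverse_quat_def)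
next
  show "inverse (0 :: quat) = 0"
    by (simp add: inverse_quat_def norm_quat_def)
qed

end

instantiation quat :: euclidean_space
begin

definition "Basis = {Quat 1 0 0 0, Quat 0 1 0 0, Quat 0 0 1 0, Quat 0 0 0 1}"

instance
proof
  fix x :: quat
  show "(\<forall>u\<in>Basis. inner x u = 0) \<longleftrightarrow> x = 0"
    by (simp add: Basis_quat_def inner_quat_def quat_eq_iff [of x])
qed (auto simp: Basis_quat_def inner_quat_def)

end

definition imag_units :: "quat set"
  where "imag_units = {J. J * J = - 1}"

lemma imag_unitsD:
  assumes "J \<in> imag_units"
  shows "qRe J = 0" "norm J = 1"
proof -
  have J: "J * J = - 1"
    using assms by (simp add: imag_units_def)
  have "norm J * norm J = 1"
    using arg_cong [OF J, of norm] by (simp add: norm_mult)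
  then show "norm J = 1"
    by (metis norm_ge_zero power2_eq_square power2_eq_1_iff zero_le_one neg_0_le_iff_le not_one_le_zero)
  show "qRe J = 0"
  proof (rule ccontr)
    assume ne: "qRe J \<noteq> 0"
    have "qI J = 0" "qJ J = 0" "qK J = 0"
      using ne arg_cong [OF J, of qI] arg_cong [OF J, of qJ] arg_cong [OF J, of qK] by simp_all
    then have "qRe J * qRe J = -1"
      using arg_cong [OF J, of qRe] by simp
    then show False
      by (metis not_one_le_zero zero_le_square neg_0_le_iff_le)
  qed
qed

lemma quat_of_real_simps [simp]: "qRe (of_real t) = t" "qI (of_real t) = 0" "qJ (of_real t) = 0"
  "qK (of_real t) = 0"
  by (simp_all add: of_real_def)

definition ord_prod :: "('n::linorder \<Rightarrow> quat) \<Rightarrow> 'n set \<Rightarrow> quat"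
  where "ord_prod q K = prod_list (map q (sorted_list_of_set K))"

section \<open>Stem functions and slice functions\<close>

text \<open>
  The index set \<open>{1, \<dots>, n}\<close> is an arbitrary finite linearly ordered type \<open>'n\<close>; for \<open>m :: 'n\<close>
  its initial segment \<open>{1, \<dots>, m}\<close> is \<open>{..m}\<close>.  In \<open>'n quat_tensor\<close>, the tensor product of the
  quaternions with a real space having a basis \<open>e\<^sub>K\<close> indexed by the subsets of \<open>'n\<close>,
  the element \<open>q \<otimes> e\<^sub>K\<close> is \<open>axis K q\<close>.

  Functions are total; a stem function only matters on its domain \<open>D\<close> and a slice function only
  on \<open>circ D\<close>, so these domains are passed along explicitly.
\<close>

type_synonym 'n cvec = "(complex, 'n) vec"
type_synonym 'n qvec = "(quat, 'n) vec"
type_synonym 'n quat_tensor = "(quat, 'n set) vec"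

definition conj_at :: "'n::finite \<Rightarrow> 'n cvec \<Rightarrow> 'n cvec"
  where "conj_at h z = (\<chi> i. if i = h then cnj (z $ i) else z $ i)"

definition invariant_set :: "('n::finite) cvec set \<Rightarrow> bool"
  where "invariant_set D \<longleftrightarrow> (\<forall>z h. z \<in> D \<longleftrightarrow> conj_at h z \<in> D)"

definition stem_function ::
  "('n::finite) cvec set \<Rightarrow> ('n cvec \<Rightarrow> 'n quat_tensor) \<Rightarrow> bool"
  where "stem_function D F \<longleftrightarrow> continuous_on D F \<and>
    (\<forall>z\<in>D. \<forall>K h. F (conj_at h z) $ K = (- 1) ^ card (K \<inter> {h}) * F z $ K)"

definition slice_point ::
  "('n::finite) cvec \<Rightarrow> ('n \<Rightarrow> quat) \<Rightarrow> 'n qvec"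
  where "slice_point z J = (\<chi> h. of_real (Re (z $ h)) + J h * of_real (Im (z $ h)))"

definition circ :: "('n::finite) cvec set \<Rightarrow> 'n qvec set"
  where "circ D = {slice_point z J | z J. z \<in> D \<and> (\<forall>h. J h \<in> imag_units)}"

text \<open>
  The value at \<open>x\<close> does not depend on the representation of \<open>x\<close>
  when \<open>F\<close> is a stem function on \<open>D\<close>; see \<open>induced_slice_point\<close> below.
\<close>

definition induced ::
  "('n::{finite,linorder}) cvec set \<Rightarrow> ('n cvec \<Rightarrow> 'n quat_tensor)
    \<Rightarrow> 'n qvec \<Rightarrow> quat"
  where "induced D F x = (THE y. \<exists>z\<in>D. \<exists>J. (\<forall>h. J h \<in> imag_units) \<and> x = slice_point z J \<and>
    y = (\<Sum>K\<in>UNIV. ord_prod J K * F z $ K))"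

lemma prod_list_flip:
  fixes J :: "'n \<Rightarrow> quat"
  assumes "distinct ks"
  shows "prod_list (map (J(h := - J h)) ks)
    = (- 1) ^ card (set ks \<inter> {h}) * prod_list (map J ks)"
  using assms
proof (induction ks)
  case (Cons k ks)
  have comm: "p * ((- 1) ^ c * q) = (- 1) ^ c * (p * q)" for c :: nat and p q :: quat
    by (cases "even c") simp_all
  show ?case
  proof (cases "k = h")
    case True
    then show ?thesis using Cons by (simp add: Int_insert_left)
  next
    case False
    have "prod_list (map (J(h := - J h)) (k # ks))
        = J k * ((- 1) ^ card (set ks \<inter> {h}) * prod_list (map J ks))"
      using Cons False by (simp del: fun_upd_apply add: fun_upd_other)
    also have "\<dots> = (- 1) ^ card (set (k # ks) \<inter> {h}) * prod_list (map J (k # ks))"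
      using False by (simp add: comm [of "J k"] Int_insert_left)
    finally show ?thesis .
  qed
qed simp

lemma ord_prod_flip:
  fixes K :: "'n::{finite,linorder} set"
  shows "ord_prod (J(h := - J h)) K = (- 1) ^ card (K \<inter> {h}) * ord_prod J K"
  using prod_list_flip [of "sorted_list_of_set K" J h] by (simp add: ord_prod_def)

lemma ord_prod_cong:
  fixes K :: "'n::{finite,linorder} set"
  shows "(\<And>k. k \<in> K \<Longrightarrow> J k = L k) \<Longrightarrow> ord_prod J K = ord_prod L K"
  unfolding ord_prod_def by (rule arg_cong [where f = prod_list]) simp

lemma induced_slice_point:
  assumes inv: "invariant_set D" and F: "stem_function D F"
    and z: "z \<in> D" and J: "\<And>h. J h \<in> imag_units"
  shows "induced D F (slice_point z J) = (\<Sum>K\<in>UNIV. ord_prod J K * F z $ K)"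
proof -
  define V where "V z J = (\<Sum>K\<in>UNIV. ord_prod J K * F z $ K)" for z J
  have conj_mem: "conj_at h w \<in> D" if "w \<in> D" for w h
    using inv that by (auto simp: invariant_set_def)
  have stem: "F (conj_at h w) $ K = (- 1) ^ card (K \<inter> {h}) * F w $ K" if "w \<in> D" for w h K
    using F that by (simp add: stem_function_def)
  have sgn_sq: "(-1) ^ c * p * ((-1) ^ c * q) = p * (q :: quat)" for c :: nat and p q
    by (cases "even c") auto
  have flip1: "V (conj_at h w) (L(h := - L h)) = V w L" if "w \<in> D" for w L h
    unfolding V_def ord_prod_flip stem [OF that] by (rule sum.cong) (auto simp: sgn_sq)
  have flip: "\<exists>w'\<in>D. (\<forall>h. w' $ h = (if h \<in> S then cnj (w $ h) else w $ h)) \<and>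
      V w' (\<lambda>h. if h \<in> S then - L h else L h) = V w L" if "w \<in> D" "finite S" for w L S
    using that(2,1)
  proof (induction S)
    case empty
    then show ?case by (intro bexI [of _ w]) auto
  next
    case (insert h S)
    then obtain w' where w': "w' \<in> D" "\<forall>h. w' $ h = (if h \<in> S then cnj (w $ h) else w $ h)"
      "V w' (\<lambda>h. if h \<in> S then - L h else L h) = V w L" by auto
    let ?L = "\<lambda>h. if h \<in> S then - L h else L h"
    have eq: "(?L(h := - ?L h)) = (\<lambda>k. if k \<in> insert h S then - L k else L k)"
      using insert.hyps by auto
    show ?case
      using w' flip1 [OF w'(1), of h ?L] conj_mem [OF w'(1), of h] insert.hyps unfolding eq
      by (intro bexI [of _ "conj_at h w'"]) (auto simp: conj_at_def)
  qed
  have same: "V z L = V z J"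
    if pt: "\<And>h. Im (z $ h) \<noteq> 0 \<Longrightarrow> L h = J h" for L
    unfolding V_def
  proof (rule sum.cong)
    fix K
    show "ord_prod L K * F z $ K = ord_prod J K * F z $ K"
    proof (cases "\<exists>h\<in>K. Im (z $ h) = 0")
      case True
      then obtain h where h: "h \<in> K" "Im (z $ h) = 0" by blast
      have "conj_at h z = z"
        using h by (auto simp: conj_at_def vec_eq_iff complex_eq_iff)
      then have "F z $ K = - (F z $ K)"
        using stem [OF z, of h K] h by simp
      then have "F z $ K + F z $ K = 0"
        by (metis add.right_inverse)
      then have "(2::real) *\<^sub>R (F z $ K) = 0"
        by (simp add: scaleR_2)
      then show ?thesis by simp
    next
      case False
      then show ?thesis using pt by (metis ord_prod_cong)
    qed
  qed simp
  have V_eq: "V w L = V z J"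
    if w: "w \<in> D" and L: "\<And>h. L h \<in> imag_units" and pt: "slice_point z J = slice_point w L" for w L
  proof -
    have pt': "of_real (Re (z $ h)) + J h * of_real (Im (z $ h))
        = of_real (Re (w $ h)) + L h * of_real (Im (w $ h))" for h
      using pt by (simp add: slice_point_def vec_eq_iff)
    have re: "Re (z $ h) = Re (w $ h)" for h
      using arg_cong [OF pt' [of h], of qRe] imag_unitsD(1) [OF J] imag_unitsD(1) [OF L] by simp
    have im: "J h * of_real (Im (z $ h)) = L h * of_real (Im (w $ h))" for h
      using pt' [of h] re [of h] by simp
    have abs: "\<bar>Im (z $ h)\<bar> = \<bar>Im (w $ h)\<bar>" for h
      using arg_cong [OF im [of h], of norm] imag_unitsD(2) [OF J] imag_unitsD(2) [OF L]
      by (simp add: norm_mult)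
    define S where "S = {h. Im (z $ h) \<noteq> Im (w $ h)}"
    obtain w' where w': "w' \<in> D" "\<forall>h. w' $ h = (if h \<in> S then cnj (w $ h) else w $ h)"
      "V w' (\<lambda>h. if h \<in> S then - L h else L h) = V w L"
      using flip [OF w, of S L] by auto
    have "w' = z"
      unfolding vec_eq_iff
    proof
      fix h
      show "w' $ h = z $ h"
      proof (cases "h \<in> S")
        case True
        then have "Im (w $ h) = - Im (z $ h)"
          using abs [of h] by (auto simp: S_def abs_eq_iff)
        then show ?thesis using w'(2) True re [of h] by (intro complex_eqI) simp_all
      next
        case False
        then show ?thesis using w'(2) re [of h] by (intro complex_eqI) (simp_all add: S_def)
      qed
    qed
    moreover
    have "(if h \<in> S then - L h else L h) = J h" if ne: "Im (z $ h) \<noteq> 0" for h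
    proof (cases "h \<in> S")
      case True
      then have "Im (w $ h) = - Im (z $ h)"
        using abs [of h] by (auto simp: S_def abs_eq_iff)
      then have "J h * of_real (Im (z $ h)) = (- L h) * of_real (Im (z $ h))"
        using im [of h] by simp
      then show ?thesis using True ne by (metis mult_cancel_right of_real_eq_0_iff)
    next
      case False
      then show ?thesis using im [of h] ne by (auto simp: S_def)
    qed
    then have "V z (\<lambda>h. if h \<in> S then - L h else L h) = V z J"
      by (rule same)
    ultimately show ?thesis
      using w'(3) by simp
  qed
  show ?thesis
    unfolding induced_def
  proof (rule the_equality)
    show "\<exists>z'\<in>D. \<exists>J'. (\<forall>h. J' h \<in> imag_units) \<and> slice_point z J = slice_point z' J' \<and>
      (\<Sum>K\<in>UNIV. ord_prod J K * F z $ K) = (\<Sum>K\<in>UNIV. ord_prod J' K * F z' $ K)"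
      using z J by blast
  next
    fix y
    assume "\<exists>w\<in>D. \<exists>L. (\<forall>h. L h \<in> imag_units) \<and> slice_point z J = slice_point w L \<and>
      y = (\<Sum>K\<in>UNIV. ord_prod L K * F w $ K)"
    then show "y = (\<Sum>K\<in>UNIV. ord_prod J K * F z $ K)"
      using V_eq unfolding V_def by blast
  qed
qed

definition induces ::
  "('n::{finite,linorder}) cvec set \<Rightarrow> ('n cvec \<Rightarrow> 'n quat_tensor)
    \<Rightarrow> ('n qvec \<Rightarrow> quat) \<Rightarrow> bool"
  where "induces D F f \<longleftrightarrow> (\<forall>x\<in>circ D. f x = induced D F x)"

text \<open>The stem function inducing \<open>f\<close>; it is unique on \<open>D\<close>.\<close>

definition stem_of ::
  "('n::{finite,linorder}) cvec set \<Rightarrow> ('n qvec \<Rightarrow> quat)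
    \<Rightarrow> 'n cvec \<Rightarrow> 'n quat_tensor"
  where "stem_of D f = (SOME F. stem_function D F \<and> induces D F f)"

definition stem_prod ::
  "(('n::finite) cvec \<Rightarrow> 'n quat_tensor) \<Rightarrow> ('n cvec \<Rightarrow> 'n quat_tensor)
    \<Rightarrow> 'n cvec \<Rightarrow> 'n quat_tensor"
  where "stem_prod F G z =
    (\<Sum>H\<in>UNIV. \<Sum>K\<in>UNIV. axis (sym_diff K H) ((- 1) ^ card (H \<inter> K) * (F z $ K * G z $ H)))"

definition slice_prod ::
  "('n::{finite,linorder}) cvec set \<Rightarrow> ('n qvec \<Rightarrow> quat)
    \<Rightarrow> ('n qvec \<Rightarrow> quat) \<Rightarrow> 'n qvec \<Rightarrow> quat"
  where "slice_prod D f g = induced D (stem_prod (stem_of D f) (stem_of D g))"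

definition coord_stem :: "'n::finite \<Rightarrow> 'n cvec \<Rightarrow> 'n quat_tensor"
  where "coord_stem j z = axis {} (of_real (Re (z $ j))) + axis {j} (of_real (Im (z $ j)))"

definition coord ::
  "('n::{finite,linorder}) cvec set \<Rightarrow> 'n \<Rightarrow> 'n qvec \<Rightarrow> quat"
  where "coord D j = induced D (coord_stem j)"

lemma coord_stem_function: "stem_function (D :: ('a::finite) cvec set) (coord_stem j)"
proof -
  have "continuous_on D (\<lambda>z. if P then g z else 0)" if "continuous_on D g"
    for P and g :: "'a cvec \<Rightarrow> quat"
    using that by (cases P) simp_all
  then have "continuous_on D (coord_stem j)"
    unfolding coord_stem_def [abs_def] axis_def
    by (intro continuous_on_add continuous_on_vec_lambda) (simp_all add: continuous_intros)
  moreover have "coord_stem j (conj_at h z) $ K = (- 1) ^ card (K \<inter> {h}) * coord_stem j z $ K" for z h K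
    by (auto simp: coord_stem_def conj_at_def axis_def)
  ultimately show ?thesis
    by (simp add: stem_function_def)
qed

lemma coord_eq:
  assumes "invariant_set D" "x \<in> circ D"
  shows "coord D j x = x $ j"
proof -
  obtain z J where x: "x = slice_point z J" "z \<in> D" "\<And>h. J h \<in> imag_units"
    using assms by (auto simp: circ_def)
  have "coord D j x = (\<Sum>K\<in>UNIV. ord_prod J K * coord_stem j z $ K)"
    unfolding coord_def x(1)
    by (rule induced_slice_point [OF assms(1) coord_stem_function x(2,3)])
  also have "\<dots> = (\<Sum>K\<in>{{},{j}}. ord_prod J K * coord_stem j z $ K)"
    by (rule sum.mono_neutral_right) (auto simp: coord_stem_def axis_def)
  also have "\<dots> = x $ j"
    by (simp add: coord_stem_def axis_def ord_prod_def x(1) slice_point_def)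
  finally show ?thesis .
qed

text \<open>
  Ordered products of quaternions along increasing indices, taken pointwise: because the order is
  increasing, this agrees with the ordered product with respect to \<open>slice_prod\<close>.
\<close>

definition coord_prod ::
  "('n::{finite,linorder}) cvec set \<Rightarrow> 'n set \<Rightarrow> 'n qvec \<Rightarrow> quat"
  where "coord_prod D K x = ord_prod (\<lambda>k. coord D k x) K"

section \<open>Slice regularity\<close>

definition J_op :: "'n::finite \<Rightarrow> 'n quat_tensor \<Rightarrow> 'n quat_tensor"
  where "J_op h u = (\<Sum>K\<in>UNIV. axis (sym_diff K {h}) ((- 1) ^ card (K \<inter> {h}) * u $ K))"

text \<open>The two vector derivatives are the partial derivatives in \<open>\<alpha>\<^sub>h\<close> and \<open>\<beta>\<^sub>h\<close>.\<close>

definition dbar ::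
  "'n::finite \<Rightarrow> ('n cvec \<Rightarrow> 'n quat_tensor) \<Rightarrow> 'n cvec \<Rightarrow> 'n quat_tensor"
  where "dbar h F z = (1 / 2) *\<^sub>R
    (vector_derivative (\<lambda>t. F (z + t *\<^sub>R axis h 1)) (at 0)
      + J_op h (vector_derivative (\<lambda>t. F (z + t *\<^sub>R axis h \<i>)) (at 0)))"

definition C1_on :: "'a::real_normed_vector set \<Rightarrow> ('a \<Rightarrow> 'b::real_normed_vector) \<Rightarrow> bool"
  where "C1_on D F \<longleftrightarrow>
    (\<exists>F'. (\<forall>z\<in>D. (F has_derivative blinfun_apply (F' z)) (at z)) \<and> continuous_on D F')"

definition holomorphic_stem ::
  "('n::finite) cvec set \<Rightarrow> ('n cvec \<Rightarrow> 'n quat_tensor) \<Rightarrow> bool"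
  where "holomorphic_stem D F \<longleftrightarrow>
    stem_function D F \<and> C1_on D F \<and> (\<forall>h. \<forall>z\<in>D. dbar h F z = 0)"

definition slice_regular ::
  "('n::{finite,linorder}) cvec set \<Rightarrow> ('n qvec \<Rightarrow> quat) \<Rightarrow> bool"
  where "slice_regular D f \<longleftrightarrow> (\<exists>F. holomorphic_stem D F \<and> induces D F f)"

section \<open>Spherical derivatives and the components of a slice function\<close>

definition off_real :: "('n::finite) cvec set \<Rightarrow> 'n set \<Rightarrow> 'n cvec set"
  where "off_real D H = {z \<in> D. \<forall>h\<in>H. Im (z $ h) \<noteq> 0}"

definition spherical_stem ::
  "('n::finite) set \<Rightarrow> ('n cvec \<Rightarrow> 'n quat_tensor) \<Rightarrow> 'n cvec \<Rightarrow> 'n quat_tensor"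
  where "spherical_stem H F z =
    inverse (\<Prod>h\<in>H. Im (z $ h)) *\<^sub>R (\<Sum>K\<in>Pow (- H). axis K (F z $ (K \<union> H)))"

definition spherical_derivative ::
  "('n::{finite,linorder}) cvec set \<Rightarrow> 'n set \<Rightarrow> ('n qvec \<Rightarrow> quat)
    \<Rightarrow> 'n qvec \<Rightarrow> quat"
  where "spherical_derivative D H f = induced (off_real D H) (spherical_stem H (stem_of D f))"

definition component_off_real ::
  "('n::{finite,linorder}) cvec set \<Rightarrow> 'n set \<Rightarrow> 'n set
    \<Rightarrow> ('n qvec \<Rightarrow> quat) \<Rightarrow> 'n qvec \<Rightarrow> quat"
  where "component_off_real D M K f =
    spherical_derivative D M (slice_prod D (coord_prod D K) f)"

text \<open>The continuous extension to \<open>circ D\<close>, unique there and arbitrary elsewhere.\<close>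

definition slice_component ::
  "('n::{finite,linorder}) cvec set \<Rightarrow> 'n set \<Rightarrow> 'n set
    \<Rightarrow> ('n qvec \<Rightarrow> quat) \<Rightarrow> 'n qvec \<Rightarrow> quat"
  where "slice_component D M K f = (SOME g. continuous_on (circ D) g \<and>
    (\<forall>x\<in>circ (off_real D M). g x = component_off_real D M K f x))"

section \<open>Sphere measure and Poisson kernel\<close>

text \<open>
  The normalized surface measure of the unit sphere gives a set \<open>A\<close> the relative volume of the cone
  \<open>{t\<xi> | 0 < t < 1, \<xi> \<in> A}\<close> in the unit ball (\<open>emeasure_sphere_measure\<close>).
  It is obtained by projecting the uniform distribution on the ball radially; the origin, where
  \<open>sgn\<close> is \<open>0\<close>, is discarded.
\<close>

definition sphere_measure :: "quat measure"
  where "sphere_measure =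
    restrict_space (distr (uniform_measure lborel (ball 0 1)) borel sgn) (sphere 0 1)"

lemma borel_measurable_sgn_quat: "sgn \<in> borel_measurable (borel :: quat measure)"
  unfolding sgn_quat_def [abs_def] by measurable

lemma space_sphere_measure: "space sphere_measure = sphere 0 1"
  by (simp add: sphere_measure_def space_restrict_space)

lemma sets_sphere_measure: "sets sphere_measure = sets (restrict_space borel (sphere 0 1))"
  by (simp add: sphere_measure_def sets_restrict_space)

lemma emeasure_sphere_measure:
  assumes "A \<in> sets sphere_measure"
  shows "emeasure sphere_measure A =
    emeasure lborel {t *\<^sub>R \<xi> | t \<xi>. 0 < t \<and> t < 1 \<and> \<xi> \<in> A} / emeasure lborel (ball (0::quat) 1)"
proof -
  have A: "A \<subseteq> sphere 0 1" "A \<in> sets borel"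
    using assms by (auto simp: sets_sphere_measure sets_restrict_space)
  have cone: "ball 0 1 \<inter> sgn -` A = {t *\<^sub>R \<xi> | t \<xi>. 0 < t \<and> t < 1 \<and> \<xi> \<in> A}" (is "?L = ?R")
  proof (intro set_eqI iffI)
    fix y assume y: "y \<in> ?L"
    then have "y \<noteq> 0" using A(1) by (auto simp: dist_norm)
    then show "y \<in> ?R"
      using y by (auto intro!: exI [of _ "norm y"] exI [of _ "sgn y"] simp: sgn_div_norm)
  next
    fix y assume "y \<in> ?R"
    then obtain t \<xi> where "y = t *\<^sub>R \<xi>" "0 < t" "t < 1" "\<xi> \<in> A" by blast
    moreover have "norm \<xi> = 1" using A(1) \<open>\<xi> \<in> A\<close> by (auto simp: dist_norm)
    ultimately show "y \<in> ?L" by (simp add: sgn_div_norm)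
  qed
  have meas: "sgn -` A \<in> sets (borel :: quat measure)"
    using measurable_sets [OF borel_measurable_sgn_quat A(2)] by simp
  have "emeasure sphere_measure A
      = emeasure (distr (uniform_measure lborel (ball 0 1)) borel sgn) A"
    unfolding sphere_measure_def by (rule emeasure_restrict_space) (use A in auto)
  also have "\<dots> = emeasure (uniform_measure lborel (ball 0 1)) (sgn -` A)"
    using A(2) borel_measurable_sgn_quat by (subst emeasure_distr) (auto simp: measurable_def)
  also have "\<dots> = emeasure lborel (ball 0 1 \<inter> sgn -` A) / emeasure lborel (ball (0::quat) 1)"
    using meas by (simp add: emeasure_uniform_measure)
  finally show ?thesis unfolding cone .
qed

lemma emeasure_space_sphere_measure: "emeasure sphere_measure (space sphere_measure) = 1"
proof -
  have eq: "{t *\<^sub>R \<xi> | t \<xi>. 0 < t \<and> t < 1 \<and> \<xi> \<in> sphere 0 1} = ball (0::quat) 1 - {0}" (is "?L = ?R")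
  proof (intro set_eqI iffI)
    fix y :: quat assume "y \<in> ?R"
    then show "y \<in> ?L"
      by (auto intro!: exI [of _ "norm y"] exI [of _ "sgn y"] simp: sgn_div_norm)
  qed (auto simp: dist_norm)
  have "emeasure lborel (ball (0::quat) 1 - {0}) = emeasure lborel (ball (0::quat) 1)"
    by (subst emeasure_Diff) auto
  moreover have "emeasure lborel (ball (0::quat) 1) \<noteq> 0"
    using unit_ball_vol_pos [of "DIM(quat)"] by (simp add: emeasure_ball del: unit_ball_vol_pos)
  moreover have "emeasure lborel (ball (0::quat) 1) \<noteq> \<infinity>"
    by (rule emeasure_bounded_finite [THEN less_imp_neq]) simp
  ultimately show ?thesis
    using emeasure_sphere_measure [of "sphere 0 1"] unfolding eq
    by (simp add: space_sphere_measure sets_sphere_measure sets_restrict_space_iff ennreal_divide_self top.not_eq_extremum)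
qed

definition poisson_kernel :: "quat \<Rightarrow> quat \<Rightarrow> real"
  where "poisson_kernel x \<xi> = (1 - (norm x)\<^sup>2) / norm (x - \<xi>) ^ 4"

text \<open>The point of \<open>\<bbbH>\<^sup>n\<close> obtained from \<open>a\<close> by adding \<open>q i\<close> to its coordinate \<open>a\<^sub>i\<close> for \<open>i \<in> I\<close>.\<close>

definition shift_on ::
  "('n::finite) set \<Rightarrow> 'n qvec \<Rightarrow> ('n \<Rightarrow> quat) \<Rightarrow> 'n qvec"
  where "shift_on I a q = (\<chi> i. if i \<in> I then a $ i + q i else a $ i)"

end

theory Submission
  imports Defs "HOL-Complex_Analysis.Cauchy_Integral_Formula"
begin

text \<open>
  Write a point of the circularization as \<open>x = \<alpha> + J \<beta>\<close> in every coordinate.  In one variable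
  a slice function is \<open>f = F\<^sub>0 + J F\<^sub>1\<close> with components \<open>S\<^sub>0 = F\<^sub>1 / \<beta>\<close> and \<open>S\<^sub>1 = F\<^sub>0 + \<alpha> F\<^sub>1 / \<beta>\<close>,
  and \<open>J \<beta> = \<alpha> - cnj x\<close> gives \<open>f = S\<^sub>1 - cnj x * S\<^sub>0\<close>.  In several variables the same computation,
  made in each coordinate \<open>k \<le> m\<close>, expands the ordered product of the \<open>J\<^sub>k \<beta>\<^sub>k = \<alpha>\<^sub>k - cnj x\<^sub>k\<close>
  and yields \<open>slice_component_expansion\<close>: the asserted formula without the integrals.  What
  remains is that each component is reproduced by the Poisson kernel in every \<open>x\<^sub>j\<close>, \<open>j \<le> m\<close>;
  Fubini's theorem then combines the variables (\<open>iterated_poisson_formula\<close>).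

  As a function of one variable \<open>x\<^sub>j = \<alpha> + J \<beta>\<close>, \<open>\<beta> > 0\<close>, a component has real coordinates of the
  form \<open>Im \<phi>(\<alpha> + \<i> \<beta>) / \<beta>\<close> with \<open>\<phi>\<close> holomorphic in one complex variable.  On functions of \<open>\<alpha>\<close> and
  \<open>\<beta>\<close> the Laplacian of the quaternions is \<open>\<partial>\<^sub>\<alpha>\<^sup>2 + \<partial>\<^sub>\<beta>\<^sup>2 + (2 / \<beta>) \<partial>\<^sub>\<beta>\<close>, and it sends \<open>v / \<beta>\<close> to
  \<open>(\<partial>\<^sub>\<alpha>\<^sup>2 v + \<partial>\<^sub>\<beta>\<^sup>2 v) / \<beta>\<close>.  So such a function is harmonic off the real axis
  (\<open>spherical_value_symmetric_laplacian\<close>).  The real axis has codimension three and is removable: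
  \<open>1 / \<beta>\<close> is harmonic off the axis and infinite on it, and a small multiple of it serves as a barrier in
  the maximum principle \<open>maximum_principle_off_axis\<close>.  For the Poisson formula
  \<open>poisson_formula_spherical\<close> it is therefore enough that a component be continuous across the
  axis.  The formula follows because a function and its Poisson integral are both harmonic and their
  difference tends to zero at the sphere; the integral of the kernel is \<open>1\<close> since it is a harmonic
  function that is constant on spheres around the origin.

  Continuity across the axis is a statement in several variables, since a component is obtained by
  dividing by \<open>\<beta>\<^sub>1 \<cdots> \<beta>\<^sub>m\<close>.  The divisions are made one at a time.  The Cauchy formula
  on a circle centred on the real axis represents \<open>(\<phi>(z) - \<phi>(cnj z)) / (z - cnj z) = Im \<phi>(z) / \<beta>\<close> by an
  integral that depends continuously on all variables, and what results is still holomorphic in the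
  variables not yet used (\<open>regular_in_divide\<close>).  By density of the points off the real axes the
  order of the divisions does not matter, so every variable may be taken last; this gives the
  holomorphic function \<open>\<phi>\<close> above for each variable \<open>x\<^sub>j\<close>, at all values of the other variables
  (\<open>divided_stem_regular_in_each\<close>).
\<close>

section \<open>A Laplacian from symmetric second differences\<close>

text \<open>
  This form of the Laplacian carries the whole maximum principle: at a local maximum every summand
  is nonpositive.  It also passes under an integral sign as soon as the quotients are
  bounded, without any discussion of derivatives of the integral.
\<close>

definition symmetric_laplacian :: "(quat \<Rightarrow> real) \<Rightarrow> quat \<Rightarrow> real \<Rightarrow> bool"
  where "symmetric_laplacian u p L \<longleftrightarrow>
    ((\<lambda>t. (\<Sum>e\<in>Basis. u (p + t *\<^sub>R e) + u (p - t *\<^sub>R e) - 2 * u p) / t\<^sup>2) \<longlongrightarrow> L) (at 0)"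

lemma sum_Basis_quat:
  "(\<Sum>e\<in>Basis. g e) = g (Quat 1 0 0 0) + g (Quat 0 1 0 0) + g (Quat 0 0 1 0) + (g (Quat 0 0 0 1) :: 'a::comm_monoid_add)"
  by (simp add: Basis_quat_def ac_simps)

lemma symmetric_laplacian_add:
  assumes "symmetric_laplacian u p L" "symmetric_laplacian v p L'"
  shows "symmetric_laplacian (\<lambda>q. u q + v q) p (L + L')"
  using tendsto_add[OF assms[unfolded symmetric_laplacian_def]]
  unfolding symmetric_laplacian_def
  by (simp add: add_divide_distrib[symmetric] sum.distrib[symmetric] algebra_simps)

lemma symmetric_laplacian_cmult:
  assumes "symmetric_laplacian u p L"
  shows "symmetric_laplacian (\<lambda>q. c * u q) p (c * L)"
  using tendsto_mult_left[OF assms[unfolded symmetric_laplacian_def], of c]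
  unfolding symmetric_laplacian_def
  by (simp add: sum_distrib_left algebra_simps)

lemma symmetric_laplacian_diff:
  assumes "symmetric_laplacian u p L" "symmetric_laplacian v p L'"
  shows "symmetric_laplacian (\<lambda>q. u q - v q) p (L - L')"
  using symmetric_laplacian_add[OF assms(1) symmetric_laplacian_cmult[OF assms(2), of "-1"]] by simp

lemma symmetric_laplacian_norm_sq: "symmetric_laplacian (\<lambda>q. (norm q)\<^sup>2) p 8"
proof -
  have "(norm (p + t *\<^sub>R e))\<^sup>2 + (norm (p - t *\<^sub>R e))\<^sup>2 - 2 * (norm p)\<^sup>2 = 2 * t\<^sup>2" if "e \<in> Basis" for e t
    using that by (simp only: power2_norm_eq_inner) (simp add: algebra_simps inner_commute power2_eq_square)
  then show ?thesis
    unfolding symmetric_laplacian_def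
    by (auto simp: sum_Basis_quat Basis_quat_def intro!: tendsto_eventually eventually_at_filter[THEN iffD2])
qed

lemma symmetric_laplacian_cong:
  assumes "symmetric_laplacian u p L" "open V" "p \<in> V" "\<And>q. q \<in> V \<Longrightarrow> u q = v q"
  shows "symmetric_laplacian v p L"
proof -
  have ev: "\<forall>\<^sub>F t in at 0. p + t *\<^sub>R e \<in> V \<and> p - t *\<^sub>R e \<in> V" for e
  proof (intro eventually_conj)
    have "((\<lambda>t. p + t *\<^sub>R e) \<longlongrightarrow> p + 0 *\<^sub>R e) (at 0)" "((\<lambda>t. p - t *\<^sub>R e) \<longlongrightarrow> p - 0 *\<^sub>R e) (at 0)"
      by (intro tendsto_intros)+
    then show "\<forall>\<^sub>F t in at 0. p + t *\<^sub>R e \<in> V" "\<forall>\<^sub>F t in at 0. p - t *\<^sub>R e \<in> V"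
      using assms(2,3) by (auto dest!: topological_tendstoD)
  qed
  have "\<forall>\<^sub>F t in at 0. \<forall>e\<in>Basis. p + t *\<^sub>R e \<in> V \<and> p - t *\<^sub>R e \<in> V"
    using ev by (simp add: eventually_ball_finite)
  then have "\<forall>\<^sub>F t in at 0. (\<Sum>e\<in>Basis. u (p + t *\<^sub>R e) + u (p - t *\<^sub>R e) - 2 * u p) / t\<^sup>2
     = (\<Sum>e\<in>Basis. v (p + t *\<^sub>R e) + v (p - t *\<^sub>R e) - 2 * v p) / t\<^sup>2"
    by eventually_elim (auto intro!: arg_cong2[where f="(/)"] sum.cong simp: assms(3,4))
  then show ?thesis
    using assms(1) unfolding symmetric_laplacian_def by (rule Lim_transform_eventually[rotated])
qed

lemma symmetric_laplacian_affine:
  assumes "symmetric_laplacian u (a + r *\<^sub>R p) L" "r > 0"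
  shows "symmetric_laplacian (\<lambda>q. u (a + r *\<^sub>R q)) p (r\<^sup>2 * L)"
proof -
  have "filterlim (\<lambda>t. r * t) (at 0) (at 0)"
    using assms(2) by (auto simp: filterlim_at eventually_at_filter intro!: tendsto_eq_intros)
  from filterlim_compose[OF assms(1)[unfolded symmetric_laplacian_def] this]
  have "((\<lambda>t. r\<^sup>2 * ((\<Sum>e\<in>Basis. u (a + r *\<^sub>R p + (r * t) *\<^sub>R e) + u (a + r *\<^sub>R p - (r * t) *\<^sub>R e) - 2 * u (a + r *\<^sub>R p)) / (r * t)\<^sup>2)) \<longlongrightarrow> r\<^sup>2 * L) (at 0)"
    by (rule tendsto_mult_left)
  then show ?thesis
    using assms(2) unfolding symmetric_laplacian_def
    by (simp add: algebra_simps power_mult_distrib)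
qed

text \<open>
  All second differences at a maximum are nonpositive; outside \<open>V\<close> the function is replaced by
  its value at \<open>p\<close>, so that this holds for every step and not only for small ones.
\<close>

lemma symmetric_laplacian_at_local_max:
  assumes "symmetric_laplacian u p L" "open V" "p \<in> V" "\<And>q. q \<in> V \<Longrightarrow> u q \<le> u p"
  shows "L \<le> 0"
proof -
  have L': "symmetric_laplacian (\<lambda>q. if q \<in> V then u q else u p) p L"
    using assms by (intro symmetric_laplacian_cong[OF assms(1,2,3)]) auto
  show ?thesis
  proof (rule tendsto_upperbound[OF L'[unfolded symmetric_laplacian_def]])
    have "(\<Sum>e\<in>Basis. (if p + t *\<^sub>R e \<in> V then u (p + t *\<^sub>R e) else u p) +
           (if p - t *\<^sub>R e \<in> V then u (p - t *\<^sub>R e) else u p) - 2 * (if p \<in> V then u p else u p)) \<le> (0::real)" for t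
      using assms(4) by (intro sum_nonpos) (smt (verit))
    then show "\<forall>\<^sub>F t in at 0. (\<Sum>e\<in>Basis. (if p + t *\<^sub>R e \<in> V then u (p + t *\<^sub>R e) else u p) +
           (if p - t *\<^sub>R e \<in> V then u (p - t *\<^sub>R e) else u p) - 2 * (if p \<in> V then u p else u p)) / t\<^sup>2 \<le> 0"
      by (intro always_eventually allI divide_nonpos_nonneg) auto
  qed simp
qed

text \<open>
  One application of l'Hospital's rule; the quotient of the derivatives is a mean of two difference
  quotients of \<open>h1\<close>, so that \<open>h1\<close> need be differentiable at \<open>0\<close> only.
\<close>

lemma symmetric_difference_quotient:
  fixes h h1 :: "real \<Rightarrow> real"
  assumes "\<forall>\<^sub>F t in nhds 0. (h has_real_derivative h1 t) (at t)"
    and "(h1 has_real_derivative d) (at 0)"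
  shows "((\<lambda>t. (h t + h (- t) - 2 * h 0) / t\<^sup>2) \<longlongrightarrow> d) (at 0)"
proof -
  have neg: "filterlim (\<lambda>t::real. - t) (nhds 0) (nhds 0)"
  proof -
    have "((\<lambda>t::real. - t) \<longlongrightarrow> - 0) (at 0)" by (intro tendsto_intros)
    then show ?thesis by (subst (asm) tendsto_at_iff_tendsto_nhds) simp
  qed
  have ev: "\<forall>\<^sub>F t in nhds 0. (h has_real_derivative h1 t) (at t) \<and> (h has_real_derivative h1 (-t)) (at (-t))"
    using assms(1) eventually_compose_filterlim[OF assms(1) neg] by eventually_elim simp
  have c: "isCont h 0" using eventually_nhds_x_imp_x[OF assms(1)] DERIV_isCont by blast
  have c2: "((\<lambda>t. h (- t)) \<longlongrightarrow> h 0) (at 0)"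
  proof -
    have "isCont (\<lambda>t. h (- t)) 0" by (rule isCont_o2[of _ uminus h]) (use c in auto)
    then show ?thesis by (simp add: isCont_def)
  qed
  have q: "((\<lambda>t. (h1 t - h1 0) / t) \<longlongrightarrow> d) (at 0)"
    using assms(2) by (simp add: DERIV_def)
  have "filterlim (\<lambda>t::real. - t) (at 0) (at 0)"
    by (auto simp: filterlim_at eventually_at_filter intro!: tendsto_eq_intros)
  from filterlim_compose[OF q this] have q2: "((\<lambda>t. (h1 (- t) - h1 0) / (- t)) \<longlongrightarrow> d) (at 0)" .
  have "((\<lambda>t. ((h1 t - h1 0) / t + (h1 (- t) - h1 0) / (- t)) / 2) \<longlongrightarrow> (d + d) / 2) (at 0)"
    by (intro tendsto_intros q q2) auto
  then have q3: "((\<lambda>t. (h1 t - h1 (- t)) / (2 * t)) \<longlongrightarrow> d) (at 0)"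
    by (rule Lim_transform_eventually[THEN tendsto_eq_rhs])
       (auto simp: eventually_at_filter field_simps)
  have dn: "\<forall>\<^sub>F t in at 0. ((\<lambda>t. h t + h (- t) - 2 * h 0) has_real_derivative (h1 t - h1 (- t))) (at t)"
    using ev unfolding eventually_at_filter
  proof eventually_elim
    case (elim t)
    have "((\<lambda>t. h (- t)) has_real_derivative h1 (- t) * - 1) (at t)"
      by (rule DERIV_chain2[of h _ uminus, OF conjunct2[OF elim]]) (auto intro!: derivative_eq_intros)
    from DERIV_diff[OF DERIV_add[OF conjunct1[OF elim] this] DERIV_const[of "2 * h 0"]]
    show ?case by simp
  qed
  have ln: "((\<lambda>t. h t + h (- t) - 2 * h 0) \<longlongrightarrow> 0) (at 0)"
  proof -
    have "((\<lambda>t. h t + h (- t) - 2 * h 0) \<longlongrightarrow> h 0 + h 0 - 2 * h 0) (at 0)"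
      using c by (intro tendsto_intros c2) (simp add: isCont_def)
    then show ?thesis by simp
  qed
  have lg: "((\<lambda>t::real. t\<^sup>2) \<longlongrightarrow> 0) (at 0)"
    by (auto intro!: tendsto_eq_intros)
  have dg: "\<forall>\<^sub>F t in at 0. ((\<lambda>t::real. t\<^sup>2) has_real_derivative 2 * t) (at t)"
    by (intro always_eventually allI) (auto intro!: derivative_eq_intros)
  have nz: "\<forall>\<^sub>F t in at (0::real). t\<^sup>2 \<noteq> 0" "\<forall>\<^sub>F t in at (0::real). 2 * t \<noteq> 0"
    by (auto simp: eventually_at_filter)
  show ?thesis
    by (rule lhopital[OF ln lg nz dn dg q3])
qed

lemma symmetric_laplacianI:
  fixes h1 :: "quat \<Rightarrow> real \<Rightarrow> real"
  assumes "\<And>e. e \<in> Basis \<Longrightarrow> \<forall>\<^sub>F t in nhds 0. ((\<lambda>t. u (p + t *\<^sub>R e)) has_real_derivative h1 e t) (at t)"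
    and "\<And>e. e \<in> Basis \<Longrightarrow> (h1 e has_real_derivative d e) (at 0)"
  shows "symmetric_laplacian u p (\<Sum>e\<in>Basis. d e)"
proof -
  have "((\<lambda>t. \<Sum>e\<in>Basis. (u (p + t *\<^sub>R e) + u (p + (- t) *\<^sub>R e) - 2 * u (p + 0 *\<^sub>R e)) / t\<^sup>2) \<longlongrightarrow> (\<Sum>e\<in>Basis. d e)) (at 0)"
    by (intro tendsto_sum symmetric_difference_quotient[OF assms])
  then show ?thesis
    unfolding symmetric_laplacian_def sum_divide_distrib scaleR_minus_left scaleR_zero_left
      add_0_right add_uminus_conv_diff .
qed

definition im_norm :: "quat \<Rightarrow> real"
  where "im_norm q = sqrt ((qI q)\<^sup>2 + (qJ q)\<^sup>2 + (qK q)\<^sup>2)"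

text \<open>
  The radius along a line in one of the imaginary directions is \<open>sqrt ((c + t)\<^sup>2 + d)\<close>, where \<open>c\<close> is the
  coordinate in that direction and \<open>d\<close> the sum of the squares of the other two.
\<close>

lemma second_derivative_radial:
  fixes g g1 :: "real \<Rightarrow> real"
  assumes g: "\<forall>\<^sub>F s in nhds \<rho>. (g has_real_derivative g1 s) (at s)"
    and g1: "(g1 has_real_derivative g2) (at \<rho>)"
    and \<rho>: "\<rho> > 0" "c\<^sup>2 + d = \<rho>\<^sup>2"
  shows "\<forall>\<^sub>F t in nhds 0. ((\<lambda>t. g (sqrt ((c + t)\<^sup>2 + d))) has_real_derivative
            g1 (sqrt ((c + t)\<^sup>2 + d)) * ((c + t) / sqrt ((c + t)\<^sup>2 + d))) (at t)"
    and "((\<lambda>t. g1 (sqrt ((c + t)\<^sup>2 + d)) * ((c + t) / sqrt ((c + t)\<^sup>2 + d))) has_real_derivative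
            g2 * (c / \<rho>)\<^sup>2 + g1 \<rho> * (1 / \<rho> - c\<^sup>2 / \<rho> ^ 3)) (at 0)"
proof -
  have at0: "sqrt ((c + 0)\<^sup>2 + d) = \<rho>" using \<rho> by simp
  have R: "((\<lambda>t. sqrt ((c + t)\<^sup>2 + d)) has_real_derivative (c + t) / sqrt ((c + t)\<^sup>2 + d)) (at t)"
    if "(c + t)\<^sup>2 + d > 0" for t
    using that by (auto intro!: derivative_eq_intros simp: field_simps)
  have lim: "((\<lambda>t. (c + t)\<^sup>2 + d) \<longlongrightarrow> \<rho>\<^sup>2) (nhds 0)"
    using \<rho>(2) tendsto_at_iff_tendsto_nhds[of "\<lambda>t. (c + t)\<^sup>2 + d" 0] by (auto intro!: tendsto_eq_intros)
  have pos: "\<forall>\<^sub>F t in nhds 0. (c + t)\<^sup>2 + d > 0"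
    using order_tendstoD(1)[OF lim] \<rho>(1) by simp
  have "((\<lambda>t. sqrt ((c + t)\<^sup>2 + d)) \<longlongrightarrow> sqrt (\<rho>\<^sup>2)) (nhds 0)"
    by (intro tendsto_intros lim)
  then have "filterlim (\<lambda>t. sqrt ((c + t)\<^sup>2 + d)) (nhds \<rho>) (nhds 0)" using \<rho>(1) by simp
  from eventually_compose_filterlim[OF g this] pos
  show "\<forall>\<^sub>F t in nhds 0. ((\<lambda>t. g (sqrt ((c + t)\<^sup>2 + d))) has_real_derivative
            g1 (sqrt ((c + t)\<^sup>2 + d)) * ((c + t) / sqrt ((c + t)\<^sup>2 + d))) (at t)"
    by eventually_elim (rule DERIV_chain2[OF _ R])
  have R0: "((\<lambda>t. sqrt ((c + t)\<^sup>2 + d)) has_real_derivative c / \<rho>) (at 0)"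
    using R[of 0] \<rho> by simp
  have G0: "((\<lambda>t. g1 (sqrt ((c + t)\<^sup>2 + d))) has_real_derivative g2 * (c / \<rho>)) (at 0)"
    by (rule DERIV_chain2[OF _ R0]) (use g1 \<rho> in simp)
  have "((\<lambda>t. (c + t) / sqrt ((c + t)\<^sup>2 + d)) has_real_derivative (1 * \<rho> - c * (c / \<rho>)) / (\<rho> * \<rho>)) (at 0)"
    by (rule DERIV_cong[OF DERIV_divide[OF _ R0]]) (use \<rho> in \<open>auto intro!: derivative_eq_intros\<close>)
  from DERIV_mult[OF G0 this]
  show "((\<lambda>t. g1 (sqrt ((c + t)\<^sup>2 + d)) * ((c + t) / sqrt ((c + t)\<^sup>2 + d))) has_real_derivative
            g2 * (c / \<rho>)\<^sup>2 + g1 \<rho> * (1 / \<rho> - c\<^sup>2 / \<rho> ^ 3)) (at 0)"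
    by (rule DERIV_cong) (use \<rho> in \<open>simp add: field_simps power2_eq_square power3_eq_cube\<close>)
qed

text \<open>
  The three imaginary directions contribute \<open>g'' + 2 g' / \<rho>\<close> to the Laplacian of a function \<open>g\<close> of the
  radius.  For \<open>g = v / \<rho>\<close> this is \<open>v'' / \<rho>\<close>, which cancels the contribution of the real direction
  because \<open>v = Im \<phi>\<close> is harmonic in the plane.
\<close>

lemma spherical_value_symmetric_laplacian:
  assumes hol: "\<phi> holomorphic_on U" and U: "open U"
    and p: "Complex (qRe p) (im_norm p) \<in> U" "im_norm p > 0"
  shows "symmetric_laplacian (\<lambda>q. Im (\<phi> (Complex (qRe q) (im_norm q))) / im_norm q) p 0"
proof -
  define \<alpha> \<rho> where "\<alpha> = qRe p" and "\<rho> = im_norm p"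
  define f1 f2 where "f1 = deriv \<phi>" and "f2 = deriv (deriv \<phi>)"
  have d1: "(\<phi> has_field_derivative f1 z) (at z)" if "z \<in> U" for z
    unfolding f1_def by (rule holomorphic_derivI[OF hol U that])
  have d2: "(f1 has_field_derivative f2 z) (at z)" if "z \<in> U" for z
    unfolding f1_def f2_def by (rule holomorphic_derivI[OF holomorphic_deriv[OF hol U] U that])
  have U0: "Complex \<alpha> \<rho> \<in> U" and \<rho>: "\<rho> > 0" using p by (auto simp: \<alpha>_def \<rho>_def)
  \<comment> \<open>Along the real direction the radius is constant, and \<open>\<phi>\<close> is differentiated twice.\<close>
  have line: "((\<lambda>t. w + of_real t * c) has_vector_derivative c) (at t)" for w c :: complex and t
    by (auto intro!: derivative_eq_intros)
  have comp: "((\<lambda>t. Im (F (w + of_real t * c))) has_real_derivative Im (c * F' (w + of_real t * c))) (at t)"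
    if "\<And>z. z \<in> U \<Longrightarrow> (F has_field_derivative F' z) (at z)" "w + of_real t * c \<in> U" for F F' w c t
  proof -
    have "((\<lambda>t. F (w + of_real t * c)) has_vector_derivative (c * F' (w + of_real t * c))) (at t)"
      using field_vector_diff_chain_at[OF line that(1)[OF that(2)]] by (simp add: o_def)
    then show ?thesis
      unfolding has_real_derivative_iff_has_vector_derivative
      by (rule bounded_linear.has_vector_derivative[OF bounded_linear_Im])
  qed
  have ev: "\<forall>\<^sub>F t in nhds 0. w + of_real t * c \<in> U" if "w \<in> U" for w c
  proof -
    have "((\<lambda>t. w + of_real t * c) \<longlongrightarrow> w + of_real 0 * c) (nhds 0)"
      by (subst tendsto_at_iff_tendsto_nhds[symmetric]) (intro tendsto_intros)
    then show ?thesis using topological_tendstoD[OF _ U, of _ "w + of_real 0 * c" "nhds 0"] that by simp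
  qed
  have re: "Complex (\<alpha> + t) \<rho> = Complex \<alpha> \<rho> + of_real t * 1" for t
    by (simp add: complex_eq_iff)
  have A1: "\<forall>\<^sub>F t in nhds 0. ((\<lambda>t. Im (\<phi> (Complex (\<alpha> + t) \<rho>)) / \<rho>) has_real_derivative Im (f1 (Complex (\<alpha> + t) \<rho>)) / \<rho>) (at t)"
    unfolding re using ev[OF U0, of 1]
    by eventually_elim (rule DERIV_cdivide, use comp[OF d1, where c=1] in simp)
  have A2: "((\<lambda>t. Im (f1 (Complex (\<alpha> + t) \<rho>)) / \<rho>) has_real_derivative Im (f2 (Complex \<alpha> \<rho>)) / \<rho>) (at 0)"
    unfolding re by (rule DERIV_cdivide) (use comp[OF d2, where c=1 and t=0] U0 in simp)
  \<comment> \<open>As a function of the radius alone: differentiating in \<open>\<rho>\<close> multiplies \<open>\<phi>'\<close> by \<open>\<i>\<close>.\<close>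
  define g g1 where "g = (\<lambda>s. Im (\<phi> (Complex \<alpha> s)) / s)"
    and "g1 = (\<lambda>s. Re (f1 (Complex \<alpha> s)) / s - Im (\<phi> (Complex \<alpha> s)) / s\<^sup>2)"
  define g2 where "g2 = - Im (f2 (Complex \<alpha> \<rho>)) / \<rho> - 2 * Re (f1 (Complex \<alpha> \<rho>)) / \<rho>\<^sup>2 + 2 * Im (\<phi> (Complex \<alpha> \<rho>)) / \<rho> ^ 3"
  have im: "Complex \<alpha> s = of_real \<alpha> + of_real s * \<i>" for s
    by (simp add: complex_eq_iff)
  have d2i: "((\<lambda>z. \<i> * f1 z) has_field_derivative \<i> * f2 z) (at z)" if "z \<in> U" for z
    using d2[OF that] by (auto intro!: derivative_eq_intros)
  have B1: "((\<lambda>s. Im (\<phi> (Complex \<alpha> s))) has_real_derivative Re (f1 (Complex \<alpha> s))) (at s)" if "Complex \<alpha> s \<in> U" for s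
    using comp[OF d1, where w="of_real \<alpha>" and c=\<i> and t=s] that unfolding im by simp
  have B2: "((\<lambda>s. Re (f1 (Complex \<alpha> s))) has_real_derivative - Im (f2 (Complex \<alpha> s))) (at s)" if "Complex \<alpha> s \<in> U" for s
    using comp[OF d2i, where w="of_real \<alpha>" and c=\<i> and t=s] that unfolding im by simp
  have "((\<lambda>s. Complex \<alpha> s) \<longlongrightarrow> Complex \<alpha> \<rho>) (nhds \<rho>)"
    by (subst tendsto_at_iff_tendsto_nhds[symmetric]) (intro tendsto_intros)
  then have evU: "\<forall>\<^sub>F s in nhds \<rho>. Complex \<alpha> s \<in> U"
    using topological_tendstoD[OF _ U] U0 by blast
  have evP: "\<forall>\<^sub>F s in nhds \<rho>. s > 0"
    using eventually_nhds_in_open[of "{0<..}" \<rho>] \<rho> by simp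
  have C1: "\<forall>\<^sub>F s in nhds \<rho>. (g has_real_derivative g1 s) (at s)"
    using evU evP unfolding g_def g1_def
    by eventually_elim (rule DERIV_cong[OF DERIV_divide[OF B1 DERIV_ident]], auto simp: field_simps power2_eq_square)
  have C2: "(g1 has_real_derivative g2) (at \<rho>)"
  proof -
    have "(g1 has_real_derivative (- Im (f2 (Complex \<alpha> \<rho>)) * \<rho> - Re (f1 (Complex \<alpha> \<rho>)) * 1) / (\<rho> * \<rho>)
        - (Re (f1 (Complex \<alpha> \<rho>)) * \<rho>\<^sup>2 - Im (\<phi> (Complex \<alpha> \<rho>)) * (2 * \<rho>)) / (\<rho>\<^sup>2 * \<rho>\<^sup>2)) (at \<rho>)"
      unfolding g1_def
      by (intro DERIV_diff DERIV_divide B1 B2 U0 DERIV_ident) (use \<rho> in \<open>auto intro!: derivative_eq_intros\<close>)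
    then show ?thesis
      by (rule DERIV_cong) (use \<rho> in \<open>simp add: g2_def field_simps power2_eq_square power3_eq_cube\<close>)
  qed
  have sq: "(im_norm p)\<^sup>2 = (qI p)\<^sup>2 + (qJ p)\<^sup>2 + (qK p)\<^sup>2"
    by (simp add: im_norm_def)
  define h where "h = (\<lambda>c d t. g1 (sqrt ((c + t)\<^sup>2 + d)) * ((c + t) / sqrt ((c + t)\<^sup>2 + d)))"
  define H where "H = (\<lambda>c. g2 * (c / \<rho>)\<^sup>2 + g1 \<rho> * (1 / \<rho> - c\<^sup>2 / \<rho> ^ 3))"
  have R1: "\<forall>\<^sub>F t in nhds 0. ((\<lambda>t. g (sqrt ((c + t)\<^sup>2 + d))) has_real_derivative h c d t) (at t)"
    and R2: "(h c d has_real_derivative H c) (at 0)" if "c\<^sup>2 + d = \<rho>\<^sup>2" for c d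
    using second_derivative_radial[OF C1 C2 \<rho> that] by (auto simp: h_def H_def)
  define h1 where "h1 = (\<lambda>e. if e = Quat 1 0 0 0 then (\<lambda>t. Im (f1 (Complex (\<alpha> + t) \<rho>)) / \<rho>)
     else if e = Quat 0 1 0 0 then h (qI p) ((qJ p)\<^sup>2 + (qK p)\<^sup>2)
     else if e = Quat 0 0 1 0 then h (qJ p) ((qI p)\<^sup>2 + (qK p)\<^sup>2)
     else h (qK p) ((qI p)\<^sup>2 + (qJ p)\<^sup>2))"
  define d where "d = (\<lambda>e. if e = Quat 1 0 0 0 then Im (f2 (Complex \<alpha> \<rho>)) / \<rho>
     else if e = Quat 0 1 0 0 then H (qI p)
     else if e = Quat 0 0 1 0 then H (qJ p)
     else H (qK p))"
  let ?u = "\<lambda>q. Im (\<phi> (Complex (qRe q) (im_norm q))) / im_norm q"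
  have e1: "(\<lambda>t. ?u (p + t *\<^sub>R Quat 1 0 0 0)) = (\<lambda>t. Im (\<phi> (Complex (\<alpha> + t) \<rho>)) / \<rho>)"
    by (simp add: im_norm_def \<alpha>_def \<rho>_def)
  have e2: "(\<lambda>t. ?u (p + t *\<^sub>R Quat 0 1 0 0)) = (\<lambda>t. g (sqrt ((qI p + t)\<^sup>2 + ((qJ p)\<^sup>2 + (qK p)\<^sup>2))))"
    by (simp add: im_norm_def \<alpha>_def \<rho>_def g_def add_ac)
  have e3: "(\<lambda>t. ?u (p + t *\<^sub>R Quat 0 0 1 0)) = (\<lambda>t. g (sqrt ((qJ p + t)\<^sup>2 + ((qI p)\<^sup>2 + (qK p)\<^sup>2))))"
    by (simp add: im_norm_def \<alpha>_def \<rho>_def g_def add_ac)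
  have e4: "(\<lambda>t. ?u (p + t *\<^sub>R Quat 0 0 0 1)) = (\<lambda>t. g (sqrt ((qK p + t)\<^sup>2 + ((qI p)\<^sup>2 + (qJ p)\<^sup>2))))"
    by (simp add: im_norm_def \<alpha>_def \<rho>_def g_def add_ac)
  have lap: "symmetric_laplacian ?u p (\<Sum>e\<in>Basis. d e)"
  proof (rule symmetric_laplacianI[where ?h1.0=h1])
    fix e :: quat assume "e \<in> Basis"
    then consider "e = Quat 1 0 0 0" | "e = Quat 0 1 0 0" | "e = Quat 0 0 1 0" | "e = Quat 0 0 0 1"
      by (auto simp: Basis_quat_def)
    then show "\<forall>\<^sub>F t in nhds 0. ((\<lambda>t. ?u (p + t *\<^sub>R e)) has_real_derivative h1 e t) (at t)"
    proof cases
      case 1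
      have "h1 e = (\<lambda>t. Im (f1 (Complex (\<alpha> + t) \<rho>)) / \<rho>)" by (simp add: h1_def 1)
      then show ?thesis using A1 by (simp only: e1 1)
    next
      case 2 then show ?thesis using R1[of "qI p"] sq by (simp add: e2 h1_def \<rho>_def del: quat_add_simps)
    next
      case 3 then show ?thesis using R1[of "qJ p"] sq by (simp add: e3 h1_def \<rho>_def del: quat_add_simps)
    next
      case 4 then show ?thesis using R1[of "qK p"] sq by (simp add: e4 h1_def \<rho>_def del: quat_add_simps)
    qed
    show "(h1 e has_real_derivative d e) (at 0)"
      using \<open>e \<in> Basis\<close> A2 R2 sq by (auto simp: Basis_quat_def h1_def d_def \<rho>_def)
  qed
  have "(\<Sum>e\<in>Basis. d e) = Im (f2 (Complex \<alpha> \<rho>)) / \<rho> + H (qI p) + H (qJ p) + H (qK p)"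
    by (simp add: sum_Basis_quat d_def)
  moreover have "H (qI p) + H (qJ p) + H (qK p) = g2 * (\<rho>\<^sup>2 / \<rho>\<^sup>2) + g1 \<rho> * (3 / \<rho> - \<rho>\<^sup>2 / \<rho> ^ 3)"
  proof -
    have "H a + H b + H c = g2 * ((a\<^sup>2 + b\<^sup>2 + c\<^sup>2) / \<rho>\<^sup>2) + g1 \<rho> * (3 / \<rho> - (a\<^sup>2 + b\<^sup>2 + c\<^sup>2) / \<rho> ^ 3)" for a b c
      unfolding H_def power_divide add_divide_distrib by (simp add: algebra_simps)
    from this[of "qI p" "qJ p" "qK p"] show ?thesis
      unfolding sq[symmetric] \<rho>_def .
  qed
  moreover have "\<dots> = g2 + 2 * g1 \<rho> / \<rho>"
    using \<rho> by (simp add: field_simps power2_eq_square power3_eq_cube)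
  moreover have "\<dots> = - Im (f2 (Complex \<alpha> \<rho>)) / \<rho>"
    using \<rho> by (simp add: g1_def g2_def field_simps power2_eq_square power3_eq_cube)
  ultimately have "(\<Sum>e\<in>Basis. d e) = 0" by simp
  then show ?thesis using lap by simp
qed

section \<open>Rotation invariance of the measure on the sphere\<close>

lemma finite_measure_sphere_measure: "finite_measure sphere_measure"
  by (rule finite_measureI) (simp add: emeasure_space_sphere_measure)

lemma borel_measurable_sphere_continuous:
  assumes "continuous_on (sphere 0 1) f"
  shows "f \<in> borel_measurable sphere_measure"
  using borel_measurable_continuous_on_restrict[OF assms]
  by (simp cong: measurable_cong_sets add: sets_sphere_measure)

lemma integrable_sphere_continuous:
  fixes f :: "quat \<Rightarrow> 'b::{banach,second_countable_topology}"
  assumes "continuous_on (sphere 0 1) f"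
  shows "integrable sphere_measure f"
proof -
  interpret finite_measure sphere_measure by (rule finite_measure_sphere_measure)
  have "bounded (f ` sphere 0 1)"
    using assms by (intro compact_imp_bounded compact_continuous_image) auto
  then obtain B where B: "\<And>\<xi>. \<xi> \<in> sphere 0 1 \<Longrightarrow> norm (f \<xi>) \<le> B"
    unfolding bounded_iff by blast
  show ?thesis
    by (rule integrable_const_bound[of _ B])
       (use B assms in \<open>auto simp: space_sphere_measure borel_measurable_sphere_continuous\<close>)
qed

text \<open>
  An isometry that carries the invariance of Lebesgue measure under orthogonal maps from \<open>real ^ 4\<close>
  over to the quaternions.
\<close>

definition quat_of_vec :: "real ^ 4 \<Rightarrow> quat"
  where "quat_of_vec v = Quat (v $ 1) (v $ 2) (v $ 3) (v $ 4)"

definition vec_of_quat :: "quat \<Rightarrow> real ^ 4"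
  where "vec_of_quat q = (\<chi> i. if i = 1 then qRe q else if i = 2 then qI q else if i = 3 then qJ q else qK q)"

lemma vec_of_quat_nth: "vec_of_quat q $ 1 = qRe q" "vec_of_quat q $ 2 = qI q"
  "vec_of_quat q $ 3 = qJ q" "vec_of_quat q $ 4 = qK q"
  by (simp_all add: vec_of_quat_def)

lemma quat_of_vec_inverse: "quat_of_vec (vec_of_quat q) = q" "vec_of_quat (quat_of_vec v) = v"
  by (simp_all add: quat_of_vec_def vec_of_quat_nth vec_eq_iff forall_4)

lemma inner_quat_of_vec: "inner (quat_of_vec v) (quat_of_vec w) = inner v w"
  by (simp add: quat_of_vec_def inner_quat_def inner_vec_def sum_4)

lemma linear_quat_of_vec: "linear quat_of_vec"
  by unfold_locales (simp_all add: quat_of_vec_def quat_eq_iff)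

lemma linear_vec_of_quat: "linear vec_of_quat"
  by unfold_locales (simp_all add: vec_eq_iff forall_4 vec_of_quat_nth)

lemma borel_measurable_quat_of_vec: "quat_of_vec \<in> borel_measurable borel"
proof (rule borel_measurable_continuous_onI)
  have "bounded_linear quat_of_vec"
    using linear_quat_of_vec linear_conv_bounded_linear by blast
  then show "continuous_on UNIV quat_of_vec"
    by (rule linear_continuous_on)
qed

lemma lborel_quat: "(lborel :: quat measure) = distr lborel borel quat_of_vec"
proof (rule lborel_eqI)
  have m [measurable]: "quat_of_vec \<in> borel_measurable borel"
    by (rule borel_measurable_quat_of_vec)
  fix l u :: quat
  assume le: "\<And>b. b \<in> Basis \<Longrightarrow> l \<bullet> b \<le> u \<bullet> b"
  have pre: "quat_of_vec -` box l u = box (vec_of_quat l) (vec_of_quat u)"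
    by (auto simp: box_def Basis_quat_def inner_quat_def quat_of_vec_def Basis_vec_def inner_axis forall_4 vec_of_quat_nth)
  have le': "\<forall>b\<in>Basis. vec_of_quat l \<bullet> b \<le> vec_of_quat u \<bullet> b"
    using le[of "Quat 1 0 0 0"] le[of "Quat 0 1 0 0"] le[of "Quat 0 0 1 0"] le[of "Quat 0 0 0 1"]
    by (auto simp: Basis_quat_def inner_quat_def Basis_vec_def inner_axis forall_4 vec_of_quat_nth)
  have "(\<Prod>b\<in>Basis. (vec_of_quat u - vec_of_quat l) \<bullet> b) = (\<Prod>i\<in>UNIV. (vec_of_quat u - vec_of_quat l) $ i)"
  proof -
    have B: "Basis = range (\<lambda>i::4. axis i (1::real))" by (auto simp: Basis_vec_def)
    have "inj (\<lambda>i::4. axis i (1::real))" by (auto simp: inj_def axis_eq_axis)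
    then show ?thesis unfolding B by (simp add: prod.reindex inner_axis)
  qed
  also have "\<dots> = (\<Prod>b\<in>Basis. (u - l) \<bullet> b)"
  proof -
    have P4: "(\<Prod>i\<in>UNIV. g i) = g 1 * g 2 * g 3 * (g (4::4)::real)" for g
      unfolding UNIV_4 by simp
    show ?thesis unfolding P4
      by (simp add: Basis_quat_def inner_quat_def vec_of_quat_nth)
  qed
  finally show "emeasure (distr lborel borel quat_of_vec) (box l u) = (\<Prod>b\<in>Basis. (u - l) \<bullet> b)"
    using le' by (simp add: emeasure_distr pre emeasure_lborel_box_eq)
qed simp

lemma inner_mult_unit_left:
  fixes p x y :: quat
  assumes "norm p = 1"
  shows "inner (p * x) (p * y) = inner x y"
proof -
  have "inner (p * x) (p * y) = ((norm (p * x + p * y))\<^sup>2 - (norm (p * x))\<^sup>2 - (norm (p * y))\<^sup>2) / 2"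
    by (simp add: power2_norm_eq_inner inner_simps inner_commute)
  also have "\<dots> = inner x y"
    by (simp only: distrib_left[symmetric] norm_mult assms)
       (simp add: power2_norm_eq_inner inner_simps inner_commute)
  finally show ?thesis .
qed

lemma emeasure_lborel_unit_mult:
  fixes p :: quat
  assumes p: "norm p = 1" and C: "C \<in> sets borel" "bounded C"
  shows "emeasure lborel ((\<lambda>q. p * q) -` C) = emeasure lborel C"
proof -
  have p0: "p \<noteq> 0" using p by auto
  define T where "T = (\<lambda>v. vec_of_quat (p * quat_of_vec v))"
  have T: "orthogonal_transformation T"
    unfolding orthogonal_transformation_def
  proof
    have "linear (\<lambda>v. p * v)" by (simp add: bounded_linear.linear bounded_linear_mult_right)
    then show "linear T"
      unfolding T_def using linear_compose[OF linear_compose[OF linear_quat_of_vec] linear_vec_of_quat]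
      by (simp add: o_def)
    have "T v \<bullet> T w = quat_of_vec (T v) \<bullet> quat_of_vec (T w)" for v w
      by (simp add: inner_quat_of_vec)
    also have "\<dots> v w = quat_of_vec v \<bullet> quat_of_vec w" for v w
      by (simp add: T_def quat_of_vec_inverse inner_mult_unit_left[OF p])
    finally show "\<forall>v w. T v \<bullet> T w = v \<bullet> w" by (simp add: inner_quat_of_vec)
  qed
  have m [measurable]: "quat_of_vec \<in> borel_measurable borel"
    by (rule borel_measurable_quat_of_vec)
  have em: "emeasure lborel A = emeasure lebesgue (quat_of_vec -` A)" if "A \<in> sets borel" for A
    using that measurable_sets[OF m that] by (subst lborel_quat) (simp add: emeasure_distr)
  define S where "S = quat_of_vec -` ((\<lambda>q. p * q) -` C)"
  have mp: "(\<lambda>q. p * q) -` C \<in> sets borel"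
    using measurable_sets[of "\<lambda>q. p * q" borel borel C] C by simp
  have S: "S \<in> sets borel" unfolding S_def using measurable_sets[OF m mp] by simp
  have nq: "norm (quat_of_vec v) = norm v" for v
    by (simp add: norm_eq_sqrt_inner inner_quat_of_vec)
  have "bounded S"
  proof -
    obtain B where "\<And>c. c \<in> C \<Longrightarrow> norm c \<le> B" using C(2) by (auto simp: bounded_iff)
    then show ?thesis
      unfolding bounded_iff S_def
      by (intro exI[of _ B]) (metis (no_types) vimage_eq norm_mult p mult_1 nq)
  qed
  then have lS: "S \<in> lmeasurable" using S by (intro bounded_set_imp_lmeasurable) auto
  have TS: "T ` S = quat_of_vec -` C"
  proof (intro set_eqI iffI)
    fix v assume "v \<in> quat_of_vec -` C"
    then show "v \<in> T ` S"
      by (intro image_eqI[of _ _ "vec_of_quat (inverse p * quat_of_vec v)"])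
         (auto simp: T_def S_def quat_of_vec_inverse mult.assoc[symmetric] p0)
  qed (auto simp: T_def S_def quat_of_vec_inverse)
  have "emeasure lebesgue (T ` S) = emeasure lebesgue S"
    using measure_orthogonal_image[OF T lS] measurable_orthogonal_image[OF T lS] lS
    by (simp add: emeasure_eq_measure2)
  from this[unfolded TS, symmetric] show ?thesis
    unfolding em[OF mp] em[OF C(1)] S_def .
qed

text \<open>
  Left multiplications by unit quaternions act transitively on the sphere; invariance under them
  makes the Poisson integral of a constant a radial function.
\<close>

lemma integral_sphere_unit_mult:
  fixes p :: quat and f :: "quat \<Rightarrow> real"
  assumes p: "norm p = 1" and f: "continuous_on (sphere 0 1) f"
  shows "(LINT \<xi>|sphere_measure. f (p * \<xi>)) = (LINT \<xi>|sphere_measure. f \<xi>)"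
proof -
  have p0: "p \<noteq> 0" using p by auto
  have m [measurable]: "(\<lambda>q. p * q) \<in> sphere_measure \<rightarrow>\<^sub>M sphere_measure"
  proof -
    have "(\<lambda>q. p * q) \<in> restrict_space borel (sphere 0 1) \<rightarrow>\<^sub>M restrict_space borel (sphere 0 1)"
      by (rule measurable_restrict_space2)
         (auto simp: space_restrict_space norm_mult p dist_norm intro!: measurable_restrict_space1)
    then show ?thesis by (simp cong: measurable_cong_sets add: sets_sphere_measure)
  qed
  have eq: "distr sphere_measure sphere_measure (\<lambda>q. p * q) = sphere_measure"
  proof (rule measure_eqI)
    fix A assume "A \<in> sets (distr sphere_measure sphere_measure (\<lambda>q. p * q))"
    then have A: "A \<in> sets sphere_measure" by simp
    have A1: "A \<subseteq> sphere 0 1" "A \<in> sets borel"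
      using A by (auto simp: sets_sphere_measure sets_restrict_space)
    define B where "B = (\<lambda>q. p * q) -` A \<inter> space sphere_measure"
    have B: "B \<in> sets sphere_measure" unfolding B_def by (rule measurable_sets[OF m A])
    define C where "C = {t *\<^sub>R \<xi> | t \<xi>. 0 < t \<and> t < 1 \<and> \<xi> \<in> A}"
    have Ceq: "C = ball 0 1 \<inter> sgn -` A"
    proof (intro set_eqI iffI)
      fix y assume y: "y \<in> ball 0 1 \<inter> sgn -` A"
      then have "y \<noteq> 0" using A1(1) by (auto simp: dist_norm)
      then show "y \<in> C"
        using y by (auto intro!: exI [of _ "norm y"] exI [of _ "sgn y"] simp: sgn_div_norm C_def)
    next
      fix y assume "y \<in> C"
      then obtain t \<xi> where "y = t *\<^sub>R \<xi>" "0 < t" "t < 1" "\<xi> \<in> A" unfolding C_def by blast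
      moreover have "norm \<xi> = 1" using A1(1) \<open>\<xi> \<in> A\<close> by (auto simp: dist_norm)
      ultimately show "y \<in> ball 0 1 \<inter> sgn -` A" by (simp add: sgn_div_norm)
    qed
    have Cb: "C \<in> sets borel" "bounded C"
      unfolding Ceq using measurable_sets [OF borel_measurable_sgn_quat A1(2)]
      by (auto intro: bounded_subset[OF bounded_ball])
    have pre: "(\<lambda>q. p * q) -` C = {t *\<^sub>R \<xi> | t \<xi>. 0 < t \<and> t < 1 \<and> \<xi> \<in> B}"
    proof (intro set_eqI iffI)
      fix q assume "q \<in> (\<lambda>q. p * q) -` C"
      then obtain t \<xi> where t: "p * q = t *\<^sub>R \<xi>" "0 < t" "t < 1" "\<xi> \<in> A" unfolding C_def by blast
      have "q = inverse p * (p * q)" by (simp add: mult.assoc[symmetric] p0)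
      then have "q = t *\<^sub>R (inverse p * \<xi>)" using t(1) by simp
      moreover have "inverse p * \<xi> \<in> B"
        using t A1 by (auto simp: B_def space_sphere_measure mult.assoc[symmetric] p0 norm_mult norm_inverse p dist_norm)
      ultimately show "q \<in> {t *\<^sub>R \<xi> | t \<xi>. 0 < t \<and> t < 1 \<and> \<xi> \<in> B}" using t by blast
    next
      fix q assume "q \<in> {t *\<^sub>R \<xi> | t \<xi>. 0 < t \<and> t < 1 \<and> \<xi> \<in> B}"
      then obtain t \<xi> where "q = t *\<^sub>R \<xi>" "0 < t" "t < 1" "\<xi> \<in> B" by blast
      then have "p * q = t *\<^sub>R (p * \<xi>)" "p * \<xi> \<in> A" by (auto simp: B_def)
      then show "q \<in> (\<lambda>q. p * q) -` C"
        using \<open>0 < t\<close> \<open>t < 1\<close> unfolding C_def by blast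
    qed
    show "emeasure (distr sphere_measure sphere_measure (\<lambda>q. p * q)) A = emeasure sphere_measure A"
      using emeasure_lborel_unit_mult[OF p Cb]
      by (simp add: emeasure_distr A B_def[symmetric] emeasure_sphere_measure[OF A] emeasure_sphere_measure[OF B] pre C_def[symmetric])
  qed simp
  have "(LINT \<xi>|sphere_measure. f \<xi>) = (LINT \<xi>|distr sphere_measure sphere_measure (\<lambda>q. p * q). f \<xi>)"
    by (simp add: eq)
  also have "\<dots> = (LINT \<xi>|sphere_measure. f (p * \<xi>))"
    by (rule integral_distr) (auto intro: borel_measurable_sphere_continuous f)
  finally show ?thesis by simp
qed

section \<open>The Poisson kernel and Poisson integrals\<close>

text \<open>
  On this ball the distance to the sphere is bounded below, which makes the Poisson kernel and its
  derivatives bounded uniformly in \<open>\<xi>\<close>.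
\<close>

lemma cball_half_gap_subset:
  fixes x :: quat
  assumes "x \<in> ball 0 1"
  shows "cball x ((1 - norm x) / 2) \<subseteq> ball 0 1"
proof
  fix y assume "y \<in> cball x ((1 - norm x) / 2)"
  then have "norm (y - x) \<le> (1 - norm x) / 2" by (simp add: dist_norm norm_minus_commute)
  moreover have "norm y \<le> norm x + norm (y - x)" by (metis norm_triangle_sub)
  ultimately show "y \<in> ball 0 1" using assms by simp
qed

lemma continuous_on_Times_bounded:
  fixes f :: "'a::topological_space \<Rightarrow> 'b::topological_space \<Rightarrow> 'c::real_normed_vector"
  assumes "continuous_on (S \<times> T) (\<lambda>(x, y). f x y)" "compact S" "compact T"
  obtains B where "\<And>x y. x \<in> S \<Longrightarrow> y \<in> T \<Longrightarrow> norm (f x y) \<le> B"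
proof -
  have "bounded ((\<lambda>(x, y). f x y) ` (S \<times> T))"
    by (intro compact_imp_bounded compact_continuous_image compact_Times assms)
  then obtain B where "\<forall>z\<in>(\<lambda>(x, y). f x y) ` (S \<times> T). norm z \<le> B"
    unfolding bounded_iff by blast
  then show thesis by (intro that[of B]) auto
qed

lemma DIM_quat: "DIM(quat) = 4"
  by (simp add: Basis_quat_def)

text \<open>
  For \<open>norm \<xi> = 1\<close> the numerator \<open>1 - (norm x)\<^sup>2\<close> equals \<open>- (norm (x - \<xi>))\<^sup>2 - 2 (x - \<xi>) \<bullet> \<xi>\<close>.  The
  kernel becomes a combination of the fundamental solution of the Laplacian with pole \<open>\<xi>\<close> and of one of
  its first derivatives, in a form that is easy to differentiate in \<open>x\<close>.
\<close>

lemma poisson_kernel_pole_expansion: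
  assumes "norm \<xi> = 1"
  shows "poisson_kernel x \<xi> =
    - (1 / inner (x - \<xi>) (x - \<xi>)) - 2 * inner (x - \<xi>) \<xi> / (inner (x - \<xi>) (x - \<xi>))\<^sup>2"
proof (cases "x = \<xi>")
  case True then show ?thesis using assms by (simp add: poisson_kernel_def)
next
  case False
  define N where "N = inner (x - \<xi>) (x - \<xi>)"
  have N: "N > 0" using False by (simp add: N_def)
  have "norm (x - \<xi>) ^ 4 = N\<^sup>2"
    unfolding N_def power2_norm_eq_inner[symmetric] by simp
  moreover have "(norm x)\<^sup>2 = N + 2 * inner (x - \<xi>) \<xi> + (norm \<xi>)\<^sup>2"
    by (simp only: N_def power2_norm_eq_inner inner_simps) (simp add: inner_commute)
  ultimately show ?thesis
    using assms N unfolding poisson_kernel_def N_def[symmetric]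
    by (simp add: field_simps power2_eq_square)
qed

text \<open>
  First and second derivative of \<open>poisson_kernel x \<xi>\<close> in \<open>x\<close> in the unit direction \<open>e\<close>, for a unit
  quaternion \<open>\<xi>\<close>.
\<close>

definition poisson_d1 :: "quat \<Rightarrow> quat \<Rightarrow> quat \<Rightarrow> real"
  where "poisson_d1 e x \<xi> = (let N = inner (x - \<xi>) (x - \<xi>); s = inner (x - \<xi>) e; c = inner (x - \<xi>) \<xi>; k = inner \<xi> e
    in 2 * s / N\<^sup>2 - 2 * k / N\<^sup>2 + 8 * c * s / N ^ 3)"

definition poisson_d2 :: "quat \<Rightarrow> quat \<Rightarrow> quat \<Rightarrow> real"
  where "poisson_d2 e x \<xi> = (let N = inner (x - \<xi>) (x - \<xi>); s = inner (x - \<xi>) e; c = inner (x - \<xi>) \<xi>; k = inner \<xi> e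
    in 2 / N\<^sup>2 - 8 * s\<^sup>2 / N ^ 3 + 16 * k * s / N ^ 3 + 8 * c / N ^ 3 - 48 * c * s\<^sup>2 / N ^ 4)"

lemma poisson_kernel_directional:
  assumes \<xi>: "norm \<xi> = 1" and e: "norm e = 1" and ne: "x + t *\<^sub>R e \<noteq> \<xi>"
  shows "((\<lambda>t. poisson_kernel (x + t *\<^sub>R e) \<xi>) has_real_derivative poisson_d1 e (x + t *\<^sub>R e) \<xi>) (at t)"
    and "((\<lambda>t. poisson_d1 e (x + t *\<^sub>R e) \<xi>) has_real_derivative poisson_d2 e (x + t *\<^sub>R e) \<xi>) (at t)"
proof -
  define N where "N = (\<lambda>t. inner (x + t *\<^sub>R e - \<xi>) (x + t *\<^sub>R e - \<xi>))"
  define s where "s = (\<lambda>t. inner (x + t *\<^sub>R e - \<xi>) e)"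
  define c where "c = (\<lambda>t. inner (x + t *\<^sub>R e - \<xi>) \<xi>)"
  define k where "k = inner \<xi> e"
  have ee: "inner e e = 1" using e by (simp add: power2_norm_eq_inner[symmetric])
  have N0: "N t \<noteq> 0" using ne by (simp add: N_def)
  have "N = (\<lambda>t. inner (x - \<xi>) (x - \<xi>) + 2 * t * inner (x - \<xi>) e + t\<^sup>2)"
    by (rule ext) (simp add: N_def inner_simps inner_commute ee algebra_simps power2_eq_square)
  moreover have seq: "s = (\<lambda>t. inner (x - \<xi>) e + t)"
    by (rule ext) (simp add: s_def inner_simps ee algebra_simps)
  ultimately have dN: "(N has_real_derivative 2 * s t) (at t)"
    by (auto intro!: derivative_eq_intros)
  have ds: "(s has_real_derivative 1) (at t)"
    unfolding seq by (auto intro!: derivative_eq_intros)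
  have ceq: "c = (\<lambda>t. inner (x - \<xi>) \<xi> + t * k)"
    by (rule ext) (simp add: c_def k_def inner_simps inner_commute algebra_simps)
  have dc: "(c has_real_derivative k) (at t)"
    unfolding ceq by (auto intro!: derivative_eq_intros)
  have dNn: "((\<lambda>t. N t ^ n) has_real_derivative real n * N t ^ (n - 1) * (2 * s t)) (at t)" for n
    using DERIV_power[OF dN, of n] by (simp add: mult_ac)
  have P: "(\<lambda>t. poisson_kernel (x + t *\<^sub>R e) \<xi>) = (\<lambda>t. - (1 / N t) - 2 * c t / (N t)\<^sup>2)"
    by (rule ext) (simp only: poisson_kernel_pole_expansion[OF \<xi>] N_def c_def)
  have D1: "poisson_d1 e (x + t *\<^sub>R e) \<xi> = 2 * s t / (N t)\<^sup>2 - 2 * k / (N t)\<^sup>2 + 8 * c t * s t / N t ^ 3" for t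
    by (simp only: poisson_d1_def Let_def N_def s_def c_def k_def)
  have D2: "poisson_d2 e (x + t *\<^sub>R e) \<xi> =
     2 / (N t)\<^sup>2 - 8 * (s t)\<^sup>2 / N t ^ 3 + 16 * k * s t / N t ^ 3 + 8 * c t / N t ^ 3 - 48 * c t * (s t)\<^sup>2 / N t ^ 4" for t
    by (simp only: poisson_d2_def Let_def N_def s_def c_def k_def)
  have "((\<lambda>t. - (1 / N t) - 2 * c t / (N t)\<^sup>2) has_real_derivative
      - ((0 * N t - 1 * (2 * s t)) / (N t * N t))
      - ((2 * k) * (N t)\<^sup>2 - (2 * c t) * (real 2 * N t ^ (2 - 1) * (2 * s t))) / ((N t)\<^sup>2 * (N t)\<^sup>2)) (at t)"
    by (intro DERIV_diff DERIV_minus DERIV_divide DERIV_const dN dNn DERIV_cmult dc) (use N0 in auto)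
  then show "((\<lambda>t. poisson_kernel (x + t *\<^sub>R e) \<xi>) has_real_derivative poisson_d1 e (x + t *\<^sub>R e) \<xi>) (at t)"
    unfolding P D1
    by (rule DERIV_cong) (use N0 in \<open>simp add: field_simps power2_eq_square power3_eq_cube\<close>)
  have "((\<lambda>t. 2 * s t / (N t)\<^sup>2 - 2 * k / (N t)\<^sup>2 + 8 * c t * s t / N t ^ 3) has_real_derivative
      ((2 * 1) * (N t)\<^sup>2 - (2 * s t) * (real 2 * N t ^ (2 - 1) * (2 * s t))) / ((N t)\<^sup>2 * (N t)\<^sup>2)
      - (0 * (N t)\<^sup>2 - (2 * k) * (real 2 * N t ^ (2 - 1) * (2 * s t))) / ((N t)\<^sup>2 * (N t)\<^sup>2)
      + (((8 * k) * s t + 1 * (8 * c t)) * N t ^ 3 - (8 * c t * s t) * (real 3 * N t ^ (3 - 1) * (2 * s t))) / (N t ^ 3 * N t ^ 3)) (at t)"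
    by (intro DERIV_diff DERIV_add DERIV_mult DERIV_divide DERIV_const dN dNn DERIV_cmult dc ds) (use N0 in auto)
  then have "((\<lambda>t. 2 * s t / (N t)\<^sup>2 - 2 * k / (N t)\<^sup>2 + 8 * c t * s t / N t ^ 3) has_real_derivative
     2 / (N t)\<^sup>2 - 8 * (s t)\<^sup>2 / N t ^ 3 + 16 * k * s t / N t ^ 3 + 8 * c t / N t ^ 3 - 48 * c t * (s t)\<^sup>2 / N t ^ 4) (at t)"
    by (rule DERIV_cong) (use N0 in \<open>simp add: field_simps eval_nat_numeral\<close>)
  then show "((\<lambda>t. poisson_d1 e (x + t *\<^sub>R e) \<xi>) has_real_derivative poisson_d2 e (x + t *\<^sub>R e) \<xi>) (at t)"
    unfolding D1 D2 by simp
qed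

text \<open>
  Summation over an orthonormal basis replaces the squares of \<open>(x - \<xi>) \<bullet> e\<close> by \<open>N = (norm (x - \<xi>))\<^sup>2\<close> and
  the products \<open>(\<xi> \<bullet> e) ((x - \<xi>) \<bullet> e)\<close> by \<open>c = (x - \<xi>) \<bullet> \<xi>\<close>.  What is left is
  \<open>8 / N\<^sup>2 - 8 / N\<^sup>2 + 16 c / N\<^sup>3 + 32 c / N\<^sup>3 - 48 c / N\<^sup>3 = 0\<close>.
\<close>

lemma poisson_kernel_laplacian:
  assumes "norm \<xi> = 1" "x \<noteq> \<xi>"
  shows "(\<Sum>e\<in>Basis. poisson_d2 e x \<xi>) = 0"
proof -
  define N where "N = inner (x - \<xi>) (x - \<xi>)"
  define c where "c = inner (x - \<xi>) \<xi>"
  have N0: "N \<noteq> 0" using assms by (simp add: N_def)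
  have S1: "(\<Sum>e\<in>Basis. (inner (x - \<xi>) e)\<^sup>2) = N"
    by (simp add: N_def sum_Basis_quat inner_quat_def power2_eq_square)
  have S2: "(\<Sum>e\<in>Basis. inner \<xi> e * inner (x - \<xi>) e) = c"
    by (simp add: c_def sum_Basis_quat inner_quat_def mult.commute)
  have "(\<Sum>e\<in>Basis. poisson_d2 e x \<xi>) = (\<Sum>e\<in>(Basis::quat set). 2 / N\<^sup>2) - (8 / N ^ 3) * (\<Sum>e\<in>Basis. (inner (x - \<xi>) e)\<^sup>2)
     + (16 / N ^ 3) * (\<Sum>e\<in>Basis. inner \<xi> e * inner (x - \<xi>) e) + (\<Sum>e\<in>(Basis::quat set). 8 * c / N ^ 3)
     - (48 * c / N ^ 4) * (\<Sum>e\<in>Basis. (inner (x - \<xi>) e)\<^sup>2)"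
    unfolding poisson_d2_def Let_def N_def[symmetric] c_def[symmetric]
    by (simp only: sum_distrib_left sum.distrib[symmetric] sum_subtractf[symmetric])
       (intro sum.cong, auto simp: field_simps)
  also have "\<dots> = 0"
    unfolding S1 S2 using N0 by (simp add: DIM_quat field_simps eval_nat_numeral)
  finally show ?thesis .
qed

definition poisson_integral :: "(quat \<Rightarrow> 'b::{banach,second_countable_topology}) \<Rightarrow> quat \<Rightarrow> 'b"
  where "poisson_integral u x = (LINT \<xi>|sphere_measure. poisson_kernel x \<xi> *\<^sub>R u \<xi>)"

lemma continuous_on_poisson_kernel:
  "continuous_on (ball 0 1 \<times> sphere 0 1) (\<lambda>(x, \<xi>). poisson_kernel x \<xi>)"
  unfolding poisson_kernel_def case_prod_unfold
  by (intro continuous_intros) (auto simp: dist_norm)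

lemma continuous_on_poisson_kernel_sphere:
  assumes "x \<in> ball 0 1"
  shows "continuous_on (sphere 0 1) (poisson_kernel x)"
  unfolding poisson_kernel_def[abs_def]
  by (intro continuous_intros) (use assms in \<open>auto simp: dist_norm\<close>)

lemma poisson_kernel_nonneg: "x \<in> ball 0 1 \<Longrightarrow> 0 \<le> poisson_kernel x \<xi>"
  unfolding poisson_kernel_def by (intro divide_nonneg_nonneg) (auto simp: power_le_one)

lemma integrable_poisson:
  fixes u :: "quat \<Rightarrow> 'b::{banach,second_countable_topology}"
  assumes "x \<in> ball 0 1" "continuous_on (sphere 0 1) u"
  shows "integrable sphere_measure (\<lambda>\<xi>. poisson_kernel x \<xi> *\<^sub>R u \<xi>)"
  by (intro integrable_sphere_continuous continuous_intros continuous_on_poisson_kernel_sphere assms)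

lemma continuous_on_poisson_integral:
  fixes u :: "quat \<Rightarrow> real"
  assumes u: "continuous_on (sphere 0 1) u"
  shows "continuous_on (ball 0 1) (poisson_integral u)"
proof (rule continuous_at_imp_continuous_on, rule ballI)
  fix x :: quat assume x: "x \<in> ball 0 1"
  define \<delta> where "\<delta> = (1 - norm x) / 2"
  have \<delta>: "\<delta> > 0" "cball x \<delta> \<subseteq> ball 0 1"
    using x cball_half_gap_subset[OF x] by (auto simp: \<delta>_def)
  have "continuous_on (cball x \<delta> \<times> sphere 0 1) (\<lambda>(y, \<xi>). poisson_kernel y \<xi>)"
    by (rule continuous_on_subset[OF continuous_on_poisson_kernel]) (use \<delta> in auto)
  moreover have "continuous_on (cball x \<delta> \<times> sphere 0 1) (\<lambda>p. u (snd p))"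
    by (rule continuous_on_compose2[OF u]) (auto intro!: continuous_intros)
  ultimately have "continuous_on (cball x \<delta> \<times> sphere 0 1) (\<lambda>(y, \<xi>). poisson_kernel y \<xi> *\<^sub>R u \<xi>)"
    unfolding case_prod_unfold by (rule continuous_on_scaleR)
  then obtain B where B: "\<And>y \<xi>. y \<in> cball x \<delta> \<Longrightarrow> \<xi> \<in> sphere 0 1 \<Longrightarrow> norm (poisson_kernel y \<xi> *\<^sub>R u \<xi>) \<le> B"
    by (rule continuous_on_Times_bounded) auto
  show "isCont (poisson_integral u) x"
    unfolding continuous_at_sequentially
  proof (intro allI impI)
    fix X :: "nat \<Rightarrow> quat" assume X: "X \<longlonglongrightarrow> x"
    interpret finite_measure sphere_measure by (rule finite_measure_sphere_measure)
    have "\<forall>\<^sub>F n in sequentially. X n \<in> ball x \<delta>"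
      using topological_tendstoD[OF X, of "ball x \<delta>"] \<delta> by simp
    then obtain N where N: "\<And>n. n \<ge> N \<Longrightarrow> X n \<in> ball x \<delta>"
      by (auto simp: eventually_sequentially)
    define Y where "Y = (\<lambda>n. X (n + N))"
    have Y: "Y \<longlonglongrightarrow> x" "\<And>n. Y n \<in> cball x \<delta>"
      using LIMSEQ_ignore_initial_segment[OF X, of N] N[of "_ + N"] unfolding Y_def by (auto simp: less_imp_le)
    have "(\<lambda>n. poisson_integral u (Y n)) \<longlonglongrightarrow> poisson_integral u x"
      unfolding poisson_integral_def
    proof (rule integral_dominated_convergence[where w="\<lambda>_. B"])
      show "(\<lambda>\<xi>. poisson_kernel x \<xi> *\<^sub>R u \<xi>) \<in> borel_measurable sphere_measure"
        using integrable_poisson[OF x u] by (rule borel_measurable_integrable)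
      show "(\<lambda>\<xi>. poisson_kernel (Y n) \<xi> *\<^sub>R u \<xi>) \<in> borel_measurable sphere_measure" for n
        using integrable_poisson[OF _ u] Y(2) \<delta>(2) by (blast intro: borel_measurable_integrable)
      show "AE \<xi> in sphere_measure. (\<lambda>n. poisson_kernel (Y n) \<xi> *\<^sub>R u \<xi>) \<longlonglongrightarrow> poisson_kernel x \<xi> *\<^sub>R u \<xi>"
      proof (rule AE_I2)
        fix \<xi> assume "\<xi> \<in> space sphere_measure"
        then have "x \<noteq> \<xi>" using x by (auto simp: space_sphere_measure)
        then show "(\<lambda>n. poisson_kernel (Y n) \<xi> *\<^sub>R u \<xi>) \<longlonglongrightarrow> poisson_kernel x \<xi> *\<^sub>R u \<xi>"
          unfolding poisson_kernel_def by (intro tendsto_intros Y) auto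
      qed
      show "AE \<xi> in sphere_measure. norm (poisson_kernel (Y n) \<xi> *\<^sub>R u \<xi>) \<le> B" for n
        using B[OF Y(2)] by (intro AE_I2) (auto simp: space_sphere_measure)
    qed simp
    then show "(poisson_integral u \<circ> X) \<longlonglongrightarrow> poisson_integral u x"
      unfolding Y_def o_def by (rule LIMSEQ_offset)
  qed
qed

lemma mean_abs_le: "\<bar>u\<bar> \<le> b \<Longrightarrow> \<bar>v\<bar> \<le> b \<Longrightarrow> \<bar>(u + v) / 2\<bar> \<le> (b::real)"
  by (auto simp: abs_le_iff)

text \<open>
  The second difference quotients of the kernel tend to its Laplacian, which is zero.  By Taylor's
  formula they are sums of averages of values of the second derivatives, hence bounded
  uniformly in \<open>\<xi>\<close>, and dominated convergence applies.
\<close>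

lemma symmetric_laplacian_poisson_integral:
  fixes u :: "quat \<Rightarrow> real"
  assumes u: "continuous_on (sphere 0 1) u" and x: "x \<in> ball 0 1"
  shows "symmetric_laplacian (poisson_integral u) x 0"
proof -
  interpret finite_measure sphere_measure by (rule finite_measure_sphere_measure)
  define \<delta> where "\<delta> = (1 - norm x) / 2"
  have \<delta>: "\<delta> > 0" "cball x \<delta> \<subseteq> ball 0 1"
    using x cball_half_gap_subset[OF x] by (auto simp: \<delta>_def)
  define Q where "Q = (\<lambda>t \<xi>. (\<Sum>e\<in>Basis. poisson_kernel (x + t *\<^sub>R e) \<xi> + poisson_kernel (x - t *\<^sub>R e) \<xi> - 2 * poisson_kernel x \<xi>) / t\<^sup>2)"
  have e1: "norm e = 1" if "e \<in> Basis" for e :: quat using that by simp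
  have ball: "x + s *\<^sub>R e \<in> cball x \<delta>" if "\<bar>s\<bar> \<le> \<delta>" "e \<in> Basis" for s e
    using that by (simp add: dist_norm)
  have "\<exists>B. \<forall>y\<in>cball x \<delta>. \<forall>\<xi>\<in>sphere 0 1. \<bar>poisson_d2 e y \<xi>\<bar> \<le> B" for e
  proof -
    have "inner (y - \<xi>) (y - \<xi>) \<noteq> 0" if "y \<in> cball x \<delta>" "\<xi> \<in> sphere 0 1" for y \<xi>
      using that \<delta>(2) by auto
    then have "continuous_on (cball x \<delta> \<times> sphere 0 1) (\<lambda>(y, \<xi>). poisson_d2 e y \<xi>)"
      unfolding poisson_d2_def Let_def case_prod_unfold by (intro continuous_intros) auto
    then obtain B where "\<And>y \<xi>. y \<in> cball x \<delta> \<Longrightarrow> \<xi> \<in> sphere 0 1 \<Longrightarrow> norm (poisson_d2 e y \<xi>) \<le> B"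
      by (rule continuous_on_Times_bounded) auto
    then show ?thesis unfolding real_norm_def by blast
  qed
  then obtain B where B: "\<And>e y \<xi>. y \<in> cball x \<delta> \<Longrightarrow> \<xi> \<in> sphere 0 1 \<Longrightarrow> \<bar>poisson_d2 e y \<xi>\<bar> \<le> B e"
    by metis
  \<comment> \<open>Uniform bound for the quotients: Taylor's formula of second order at \<open>t\<close> and at \<open>- t\<close>, where the first order terms cancel.\<close>
  have Qb: "\<bar>Q t \<xi>\<bar> \<le> (\<Sum>e\<in>Basis. B e)" if t: "t \<noteq> 0" "\<bar>t\<bar> \<le> \<delta>" and \<xi>: "\<xi> \<in> sphere 0 1" for t \<xi>
  proof -
    have n1: "norm \<xi> = 1" using \<xi> by simp
    have ne: "y \<noteq> \<xi>" if "y \<in> cball x \<delta>" for y using that \<xi> \<delta>(2) by auto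
    have one: "\<bar>(poisson_kernel (x + t *\<^sub>R e) \<xi> + poisson_kernel (x - t *\<^sub>R e) \<xi> - 2 * poisson_kernel x \<xi>) / t\<^sup>2\<bar> \<le> B e"
      if e: "e \<in> Basis" for e
    proof -
      define diff where "diff = (\<lambda>m::nat. if m = 0 then (\<lambda>s. poisson_kernel (x + s *\<^sub>R e) \<xi>)
         else if m = 1 then (\<lambda>s. poisson_d1 e (x + s *\<^sub>R e) \<xi>) else (\<lambda>s. poisson_d2 e (x + s *\<^sub>R e) \<xi>))"
      have D: "(diff m has_real_derivative diff (Suc m) s) (at s)" if "m < 2" "\<bar>s\<bar> \<le> \<delta>" for m s
        using that poisson_kernel_directional[OF n1 e1[OF e] ne[OF ball[OF that(2) e]]]
        by (cases "m = 0") (auto simp: diff_def less_2_cases_iff)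
      have d0: "diff 0 = (\<lambda>s. poisson_kernel (x + s *\<^sub>R e) \<xi>)" by (simp add: diff_def)
      have D': "\<forall>m s. m < 2 \<and> - \<delta> \<le> s \<and> s \<le> \<delta> \<longrightarrow> (diff m has_real_derivative diff (Suc m) s) (at s)"
        using D by (simp add: abs_le_iff)
      have T: "\<exists>\<tau>. \<bar>\<tau>\<bar> \<le> \<delta> \<and> poisson_kernel (x + s *\<^sub>R e) \<xi> = poisson_kernel x \<xi> + poisson_d1 e x \<xi> * s + poisson_d2 e (x + \<tau> *\<^sub>R e) \<xi> / 2 * s\<^sup>2"
        if s: "s \<noteq> 0" "\<bar>s\<bar> \<le> \<delta>" for s
      proof -
        have "\<exists>\<tau>. (if s < 0 then s < \<tau> \<and> \<tau> < 0 else 0 < \<tau> \<and> \<tau> < s) \<and>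
          poisson_kernel (x + s *\<^sub>R e) \<xi> = (\<Sum>m<2. diff m 0 / fact m * (s - 0) ^ m) + diff 2 \<tau> / fact 2 * (s - 0) ^ 2"
          by (rule Taylor[where a="-\<delta>" and b=\<delta>, OF _ d0 D']) (use s \<delta>(1) in auto)
        then obtain \<tau> where \<tau>: "if s < 0 then s < \<tau> \<and> \<tau> < 0 else 0 < \<tau> \<and> \<tau> < s"
          "poisson_kernel (x + s *\<^sub>R e) \<xi> = (\<Sum>m<2. diff m 0 / fact m * (s - 0) ^ m) + diff 2 \<tau> / fact 2 * (s - 0) ^ 2"
          by blast
        have "\<bar>\<tau>\<bar> \<le> \<delta>" using \<tau>(1) s by (auto split: if_splits)
        moreover have "poisson_kernel (x + s *\<^sub>R e) \<xi> = poisson_kernel x \<xi> + poisson_d1 e x \<xi> * s + poisson_d2 e (x + \<tau> *\<^sub>R e) \<xi> / 2 * s\<^sup>2"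
          using \<tau>(2) by (simp add: diff_def eval_nat_numeral)
        ultimately show ?thesis by blast
      qed
      from T[of t] t obtain \<tau>1 where t1: "\<bar>\<tau>1\<bar> \<le> \<delta>" "poisson_kernel (x + t *\<^sub>R e) \<xi> = poisson_kernel x \<xi> + poisson_d1 e x \<xi> * t + poisson_d2 e (x + \<tau>1 *\<^sub>R e) \<xi> / 2 * t\<^sup>2" by auto
      from T[of "-t"] t obtain \<tau>2 where t2: "\<bar>\<tau>2\<bar> \<le> \<delta>" "poisson_kernel (x - t *\<^sub>R e) \<xi> = poisson_kernel x \<xi> - poisson_d1 e x \<xi> * t + poisson_d2 e (x + \<tau>2 *\<^sub>R e) \<xi> / 2 * t\<^sup>2" by auto
      have eq: "(poisson_kernel (x + t *\<^sub>R e) \<xi> + poisson_kernel (x - t *\<^sub>R e) \<xi> - 2 * poisson_kernel x \<xi>) / t\<^sup>2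
        = (poisson_d2 e (x + \<tau>1 *\<^sub>R e) \<xi> + poisson_d2 e (x + \<tau>2 *\<^sub>R e) \<xi>) / 2"
        unfolding t1(2) t2(2) using t by (simp add: field_simps)
      show ?thesis
        unfolding eq by (rule mean_abs_le[OF B[OF ball[OF t1(1) e] \<xi>] B[OF ball[OF t2(1) e] \<xi>]])
    qed
    show ?thesis
      unfolding Q_def sum_divide_distrib
      by (rule order_trans[OF sum_abs sum_mono]) (rule one)
  qed
  have Qlim: "((\<lambda>t. Q t \<xi>) \<longlongrightarrow> 0) (at 0)" if \<xi>: "\<xi> \<in> sphere 0 1" for \<xi>
  proof -
    have n1: "norm \<xi> = 1" using \<xi> by simp
    have ne: "y \<noteq> \<xi>" if "y \<in> cball x \<delta>" for y using that \<xi> \<delta>(2) by auto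
    have ev: "\<forall>\<^sub>F t in nhds (0::real). \<bar>t\<bar> \<le> \<delta>"
      using eventually_nhds_in_open[of "{-\<delta><..<\<delta>}" 0] \<delta>(1) by (auto elim!: eventually_mono)
    have "symmetric_laplacian (\<lambda>y. poisson_kernel y \<xi>) x (\<Sum>e\<in>Basis. poisson_d2 e x \<xi>)"
    proof (rule symmetric_laplacianI)
      fix e :: quat assume e: "e \<in> Basis"
      show "\<forall>\<^sub>F t in nhds 0. ((\<lambda>t. poisson_kernel (x + t *\<^sub>R e) \<xi>) has_real_derivative poisson_d1 e (x + t *\<^sub>R e) \<xi>) (at t)"
        using ev by eventually_elim (rule poisson_kernel_directional(1)[OF n1 e1[OF e] ne[OF ball[OF _ e]]])
      show "((\<lambda>t. poisson_d1 e (x + t *\<^sub>R e) \<xi>) has_real_derivative poisson_d2 e x \<xi>) (at 0)"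
        using poisson_kernel_directional(2)[OF n1 e1[OF e] ne[OF ball[OF _ e]], of 0] \<delta>(1) by simp
    qed
    then show ?thesis
      using poisson_kernel_laplacian[OF n1 ne] \<delta>(1) by (simp add: symmetric_laplacian_def Q_def)
  qed
  have quot: "(\<Sum>e\<in>Basis. poisson_integral u (x + t *\<^sub>R e) + poisson_integral u (x - t *\<^sub>R e) - 2 * poisson_integral u x) / t\<^sup>2
      = (LINT \<xi>|sphere_measure. Q t \<xi> * u \<xi>)" 
    and Qm: "(\<lambda>\<xi>. Q t \<xi> * u \<xi>) \<in> borel_measurable sphere_measure" if t: "\<bar>t\<bar> \<le> \<delta>" for t
  proof -
    have I: "integrable sphere_measure (\<lambda>\<xi>. poisson_kernel (x + s *\<^sub>R e) \<xi> * u \<xi>)" if "\<bar>s\<bar> \<le> \<delta>" "e \<in> Basis" for s e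
      using integrable_poisson[OF _ u, of "x + s *\<^sub>R e"] ball[OF that] \<delta>(2) by auto
    have I1: "integrable sphere_measure (\<lambda>\<xi>. poisson_kernel (x + t *\<^sub>R e) \<xi> * u \<xi>)"
      "integrable sphere_measure (\<lambda>\<xi>. poisson_kernel (x - t *\<^sub>R e) \<xi> * u \<xi>)"
      "integrable sphere_measure (\<lambda>\<xi>. poisson_kernel x \<xi> * u \<xi>)" if "e \<in> Basis" for e
      using I[OF t that] I[of "-t", OF _ that] I[of 0, OF _ that] t \<delta>(1) by auto
    have Qeq: "Q t \<xi> * u \<xi> = (\<Sum>e\<in>Basis. poisson_kernel (x + t *\<^sub>R e) \<xi> * u \<xi> + poisson_kernel (x - t *\<^sub>R e) \<xi> * u \<xi> - 2 * (poisson_kernel x \<xi> * u \<xi>)) / t\<^sup>2" for \<xi>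
      by (simp add: Q_def sum_distrib_right left_diff_distrib distrib_right mult.assoc)
    have "integrable sphere_measure (\<lambda>\<xi>. Q t \<xi> * u \<xi>)"
      unfolding Qeq by (intro integrable_divide Bochner_Integration.integrable_sum Bochner_Integration.integrable_add Bochner_Integration.integrable_diff integrable_mult_right I1)
    then show "(\<lambda>\<xi>. Q t \<xi> * u \<xi>) \<in> borel_measurable sphere_measure"
      by (rule borel_measurable_integrable)
    show "(\<Sum>e\<in>Basis. poisson_integral u (x + t *\<^sub>R e) + poisson_integral u (x - t *\<^sub>R e) - 2 * poisson_integral u x) / t\<^sup>2
      = (LINT \<xi>|sphere_measure. Q t \<xi> * u \<xi>)"
      unfolding Qeq poisson_integral_def integral_divide_zero real_scaleR_def
      by (subst Bochner_Integration.integral_sum)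
         (auto intro!: I1 Bochner_Integration.integrable_add Bochner_Integration.integrable_diff integrable_mult_right
            sum.cong arg_cong2[where f="(/)"]
          simp: Bochner_Integration.integral_add Bochner_Integration.integral_diff I1)
  qed
  obtain C where C: "\<And>\<xi>. \<xi> \<in> sphere 0 1 \<Longrightarrow> \<bar>u \<xi>\<bar> \<le> C"
    using compact_imp_bounded[OF compact_continuous_image[OF u compact_sphere]]
    unfolding bounded_iff real_norm_def by blast
  show ?thesis
    unfolding symmetric_laplacian_def tendsto_at_iff_sequentially
  proof (intro allI impI)
    fix X :: "nat \<Rightarrow> real" assume X0: "\<forall>i. X i \<in> UNIV - {0}" and X: "X \<longlonglongrightarrow> 0"
    have "\<forall>\<^sub>F n in sequentially. X n \<in> ball 0 \<delta>"
      using topological_tendstoD[OF X, of "ball 0 \<delta>"] \<delta> by simp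
    then obtain N where N: "\<And>n. n \<ge> N \<Longrightarrow> X n \<in> ball 0 \<delta>"
      by (auto simp: eventually_sequentially)
    define Y where "Y = (\<lambda>n. X (n + N))"
    have Y: "Y \<longlonglongrightarrow> 0" "\<And>n. \<bar>Y n\<bar> \<le> \<delta>" "\<And>n. Y n \<noteq> 0"
      using LIMSEQ_ignore_initial_segment[OF X, of N] N[of "_ + N"] X0 unfolding Y_def by (auto simp: less_imp_le)
    have YF: "filterlim Y (at 0) sequentially"
      using Y by (auto simp: filterlim_at)
    have "(\<lambda>n. LINT \<xi>|sphere_measure. Q (Y n) \<xi> * u \<xi>) \<longlonglongrightarrow> (LINT \<xi>|sphere_measure. 0 * u \<xi>)"
    proof (rule integral_dominated_convergence[where w="\<lambda>_. (\<Sum>e\<in>Basis. B e) * C"])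
      show "(\<lambda>\<xi>. Q (Y n) \<xi> * u \<xi>) \<in> borel_measurable sphere_measure" for n by (rule Qm[OF Y(2)])
      show "AE \<xi> in sphere_measure. (\<lambda>n. Q (Y n) \<xi> * u \<xi>) \<longlonglongrightarrow> 0 * u \<xi>"
        by (intro AE_I2 tendsto_mult_right filterlim_compose[OF Qlim YF]) (simp add: space_sphere_measure)
      show "AE \<xi> in sphere_measure. norm (Q (Y n) \<xi> * u \<xi>) \<le> (\<Sum>e\<in>Basis. B e) * C" for n
      proof (rule AE_I2)
        fix \<xi> assume "\<xi> \<in> space sphere_measure"
        then have \<xi>: "\<xi> \<in> sphere 0 1" by (simp add: space_sphere_measure)
        show "norm (Q (Y n) \<xi> * u \<xi>) \<le> (\<Sum>e\<in>Basis. B e) * C"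
          unfolding real_norm_def abs_mult
          using Qb[OF Y(3) Y(2) \<xi>] C[OF \<xi>] by (intro mult_mono) (auto intro: order_trans[OF abs_ge_zero])
      qed
    qed auto
    then have "(\<lambda>n. (\<Sum>e\<in>Basis. poisson_integral u (x + Y n *\<^sub>R e) + poisson_integral u (x - Y n *\<^sub>R e) - 2 * poisson_integral u x) / (Y n)\<^sup>2) \<longlonglongrightarrow> 0"
      by (simp add: quot[OF Y(2)])
    then show "((\<lambda>t. (\<Sum>e\<in>Basis. poisson_integral u (x + t *\<^sub>R e) + poisson_integral u (x - t *\<^sub>R e) - 2 * poisson_integral u x) / t\<^sup>2) \<circ> X) \<longlonglongrightarrow> 0"
      unfolding Y_def o_def by (rule LIMSEQ_offset)
  qed
qed

section \<open>Maximum principle and Poisson formula in one variable\<close>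

lemma continuous_on_im_norm [continuous_intros]:
  assumes "continuous_on S f" shows "continuous_on S (\<lambda>x. im_norm (f x))"
proof -
  have c: "continuous_on S (\<lambda>x. inner (f x) e)" for e
    by (intro continuous_intros assms)
  have "(\<lambda>x. im_norm (f x)) = (\<lambda>x. sqrt ((inner (f x) (Quat 0 1 0 0))\<^sup>2 + (inner (f x) (Quat 0 0 1 0))\<^sup>2 + (inner (f x) (Quat 0 0 0 1))\<^sup>2))"
    by (simp add: im_norm_def inner_quat_def)
  then show ?thesis by (simp only:) (intro continuous_intros c)
qed

lemma im_norm_nonneg: "im_norm q \<ge> 0"
  by (simp add: im_norm_def)

lemma im_norm_eq_0_iff: "im_norm q = 0 \<longleftrightarrow> qI q = 0 \<and> qJ q = 0 \<and> qK q = 0"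
proof -
  have "(qI q)\<^sup>2 + (qJ q)\<^sup>2 + (qK q)\<^sup>2 = 0 \<longleftrightarrow> qI q = 0 \<and> qJ q = 0 \<and> qK q = 0"
    by (simp add: add_nonneg_eq_0_iff)
  then show ?thesis by (simp add: im_norm_def)
qed

text \<open>
  The spherical value of the constant function \<open>\<i>\<close>; it is the barrier that makes the real axis
  removable.
\<close>

lemma symmetric_laplacian_inverse_im_norm:
  assumes "im_norm p > 0"
  shows "symmetric_laplacian (\<lambda>q. 1 / im_norm q) p 0"
  using spherical_value_symmetric_laplacian[of "\<lambda>_. \<i>" UNIV p] assms by simp

text \<open>
  To \<open>d\<close> one adds \<open>\<delta> (norm p)\<^sup>2\<close>, whose positive Laplacian excludes interior maxima, and
  subtracts \<open>\<eta> / \<rho>\<close>, which keeps the maximum away from the axis \<open>\<rho> = 0\<close> and does not change the Laplacian.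
  Both corrections are small at the given point.  A point of the axis is a limit of points off the
  axis.
\<close>

lemma maximum_principle_off_axis:
  fixes d :: "quat \<Rightarrow> real"
  assumes r: "r > 0" and s: "s > 0"
    and cont: "continuous_on (cball 0 s) d"
    and harm: "\<And>p. p \<in> ball 0 s \<Longrightarrow> im_norm (a + r *\<^sub>R p) > 0 \<Longrightarrow> symmetric_laplacian d p 0"
    and bd: "\<And>p. norm p = s \<Longrightarrow> d p \<le> \<epsilon>"
    and p0: "p0 \<in> ball 0 s"
  shows "d p0 \<le> \<epsilon>"
proof -
  define \<rho> where "\<rho> = (\<lambda>p. im_norm (a + r *\<^sub>R p))"
  have c\<rho>: "continuous_on S \<rho>" for S
    unfolding \<rho>_def by (intro continuous_intros)
  have off: "d p0 \<le> \<epsilon>" if p0: "p0 \<in> ball 0 s" "\<rho> p0 > 0" for p0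
  proof (rule ccontr)
    assume "\<not> d p0 \<le> \<epsilon>"
    define \<kappa> where "\<kappa> = d p0 - \<epsilon>"
    have \<kappa>: "\<kappa> > 0" using \<open>\<not> d p0 \<le> \<epsilon>\<close> by (simp add: \<kappa>_def)
    \<comment> \<open>Both corrections are at most \<open>\<kappa> / 4\<close>: the quadratic one on the ball, the barrier at \<open>p0\<close>.\<close>
    define \<delta> where "\<delta> = \<kappa> / (4 * s\<^sup>2)"
    define \<eta> where "\<eta> = \<kappa> * \<rho> p0 / 4"
    have \<delta>: "\<delta> > 0" and \<eta>: "\<eta> > 0" using \<kappa> s p0 by (auto simp: \<delta>_def \<eta>_def)
    obtain B where B: "\<And>p. p \<in> cball 0 s \<Longrightarrow> d p \<le> B"
      using continuous_attains_sup[OF compact_cball _ cont] s by (metis cball_eq_empty not_less_iff_gr_or_eq)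
    \<comment> \<open>Closer than \<open>\<rho>0\<close> to the axis the barrier pushes \<open>W\<close> below its value at \<open>p0\<close>.\<close>
    define \<rho>0 where "\<rho>0 = min (\<rho> p0) (\<eta> / (\<bar>B\<bar> + \<bar>\<epsilon>\<bar> + \<kappa> + 1))"
    have den: "\<bar>B\<bar> + \<bar>\<epsilon>\<bar> + \<kappa> + 1 > 0" using \<kappa> by linarith
    have \<rho>0: "\<rho>0 > 0" using p0 \<eta> den by (simp add: \<rho>0_def)
    have \<eta>\<rho>: "\<eta> / \<rho>0 \<ge> \<bar>B\<bar> + \<bar>\<epsilon>\<bar> + \<kappa> + 1"
    proof -
      have "\<rho>0 \<le> \<eta> / (\<bar>B\<bar> + \<bar>\<epsilon>\<bar> + \<kappa> + 1)" by (simp add: \<rho>0_def)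
      then have "\<rho>0 * (\<bar>B\<bar> + \<bar>\<epsilon>\<bar> + \<kappa> + 1) \<le> \<eta>" using den by (simp add: pos_le_divide_eq)
      then show ?thesis using \<rho>0 by (simp add: pos_le_divide_eq mult.commute)
    qed
    define W where "W = (\<lambda>p. d p + \<delta> * (norm p)\<^sup>2 - \<eta> * (1 / \<rho> p))"
    have quad: "\<delta> * (norm p)\<^sup>2 \<le> \<kappa> / 4" if "norm p \<le> s" for p :: quat
    proof -
      have "\<delta> * (norm p)\<^sup>2 \<le> \<delta> * s\<^sup>2" using that \<delta> by (intro mult_left_mono power_mono) auto
      also have "\<dots> = \<kappa> / 4" using s by (simp add: \<delta>_def)
      finally show ?thesis .
    qed
    have W0: "W p0 \<ge> \<epsilon> + 3 * \<kappa> / 4"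
    proof -
      have eq: "\<eta> * (1 / \<rho> p0) = \<kappa> / 4" using p0 by (simp add: \<eta>_def)
      have "\<delta> * (norm p0)\<^sup>2 \<ge> 0" using \<delta> by simp
      then show ?thesis unfolding W_def eq using \<kappa>_def by linarith
    qed
    define K where "K = cball 0 s \<inter> {p. \<rho>0 \<le> \<rho> p}"
    have "closed {p. \<rho>0 \<le> \<rho> p}" by (intro closed_Collect_le c\<rho> continuous_on_const)
    then have "compact K" unfolding K_def by (intro compact_Int_closed compact_cball)
    moreover have p0K: "p0 \<in> K" using p0 by (auto simp: K_def \<rho>0_def)
    moreover have "continuous_on K W"
      unfolding W_def by (intro continuous_intros continuous_on_subset[OF cont] c\<rho>) (use \<rho>0 in \<open>auto simp: K_def\<close>)
    ultimately obtain p1 where p1: "p1 \<in> K" "\<And>p. p \<in> K \<Longrightarrow> W p \<le> W p1"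
      using continuous_attains_sup[of K W] by blast
    have W1: "W p1 \<ge> \<epsilon> + 3 * \<kappa> / 4" using p1(2)[OF p0K] W0 by linarith
    have p1s: "norm p1 \<le> s" "\<rho>0 \<le> \<rho> p1" using p1(1) by (auto simp: K_def)
    have pos1: "\<rho> p1 > 0" using p1s \<rho>0 by linarith
    have b1: "\<eta> * (1 / \<rho> p1) \<ge> 0" using \<eta> pos1 by simp
    have lt: "norm p1 < s"
    proof (rule ccontr)
      assume "\<not> norm p1 < s"
      then have "d p1 \<le> \<epsilon>" using bd p1s by simp
      then have "W p1 \<le> \<epsilon> + \<kappa> / 4" using quad[OF p1s(1)] b1 by (simp add: W_def)
      then show False using W1 \<kappa> by linarith
    qed
    have gt: "\<rho>0 < \<rho> p1"
    proof (rule ccontr)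
      assume "\<not> \<rho>0 < \<rho> p1"
      then have eq: "\<rho> p1 = \<rho>0" using p1s by simp
      have "W p1 \<le> B + \<kappa> / 4 - \<eta> / \<rho>0" using quad[OF p1s(1)] B[of p1] p1s(1) eq by (simp add: W_def)
      then show False using W1 \<kappa> \<eta>\<rho> by linarith
    qed
    define V where "V = ball 0 s \<inter> {p. \<rho>0 < \<rho> p}"
    have V: "open V" "p1 \<in> V"
      unfolding V_def using lt gt by (auto intro!: open_Int open_Collect_less c\<rho> continuous_on_const)
    have "symmetric_laplacian (\<lambda>p. 1 / im_norm (a + r *\<^sub>R p)) p1 (r\<^sup>2 * 0)"
      by (rule symmetric_laplacian_affine[OF symmetric_laplacian_inverse_im_norm r]) (use pos1 in \<open>simp add: \<rho>_def\<close>)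
    then have bar: "symmetric_laplacian (\<lambda>p. 1 / \<rho> p) p1 0" by (simp add: \<rho>_def)
    have "symmetric_laplacian W p1 (0 + \<delta> * 8 - \<eta> * 0)"
      unfolding W_def
      by (intro symmetric_laplacian_diff symmetric_laplacian_add symmetric_laplacian_cmult symmetric_laplacian_norm_sq bar harm)
         (use lt pos1 in \<open>auto simp: \<rho>_def\<close>)
    then have "0 + \<delta> * 8 - \<eta> * 0 \<le> 0"
      by (rule symmetric_laplacian_at_local_max[OF _ V]) (auto intro!: p1(2) simp: V_def K_def)
    then show False using \<delta> by simp
  qed
  show ?thesis
  proof (cases "\<rho> p0 > 0")
    case True then show ?thesis using off p0 by blast
  next
    case False
    then have ax: "im_norm (a + r *\<^sub>R p0) = 0"
      using im_norm_nonneg[of "a + r *\<^sub>R p0"] by (simp add: \<rho>_def)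
    define X where "X = (\<lambda>t. p0 + t *\<^sub>R Quat 0 1 0 0)"
    have pos: "\<rho> (X t) > 0" if "t > 0" for t
    proof -
      have "im_norm (a + r *\<^sub>R X t) \<noteq> 0"
      proof -
        have "qI (a + r *\<^sub>R X t) = (qI a + r * qI p0) + r * t" by (simp add: X_def distrib_left)
        moreover have "qI a + r * qI p0 = 0" using ax by (simp add: im_norm_eq_0_iff)
        ultimately have "qI (a + r *\<^sub>R X t) \<noteq> 0" using that r by simp
        then show ?thesis unfolding im_norm_eq_0_iff by blast
      qed
      then show ?thesis using im_norm_nonneg[of "a + r *\<^sub>R X t"] by (simp add: \<rho>_def)
    qed
    \<comment> \<open>\<open>X\<close> leaves the axis in the direction of the first imaginary unit.\<close>
    have X0: "(X \<longlongrightarrow> p0) (at_right 0)"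
      unfolding X_def by (auto intro!: tendsto_eq_intros)
    have ev: "\<forall>\<^sub>F t in at_right 0. X t \<in> ball 0 s"
      using topological_tendstoD[OF X0, of "ball 0 s"] p0 by simp
    have "isCont d p0"
      by (rule continuous_on_interior[OF cont]) (use p0 in \<open>simp add: interior_cball\<close>)
    then have "((\<lambda>t. d (X t)) \<longlongrightarrow> d p0) (at_right 0)"
      using X0 isCont_tendsto_compose by blast
    moreover have "\<forall>\<^sub>F t in at_right 0. d (X t) \<le> \<epsilon>"
      using ev eventually_at_right_less[of 0] by eventually_elim (auto intro: off pos)
    ultimately show ?thesis by (rule tendsto_upperbound) simp
  qed
qed

lemma poisson_integral_rotate:
  assumes "norm x < 1"
  shows "poisson_integral (\<lambda>_. 1::real) x = poisson_integral (\<lambda>_. 1) (of_real (norm x))"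
proof (cases "x = 0")
  case False
  define p where "p = sgn x"
  have p: "norm p = 1" "x = p * of_real (norm x)"
    using False by (simp_all add: p_def norm_sgn sgn_div_norm of_real_def)
  have "(LINT \<xi>|sphere_measure. poisson_kernel x (p * \<xi>)) = (LINT \<xi>|sphere_measure. poisson_kernel x \<xi>)"
    by (rule integral_sphere_unit_mult[OF p(1)]) (use assms in \<open>simp add: continuous_on_poisson_kernel_sphere\<close>)
  moreover have "poisson_kernel x (p * \<xi>) = poisson_kernel (of_real (norm x)) \<xi>" for \<xi>
  proof -
    have "x - p * \<xi> = p * (of_real (norm x) - \<xi>)" using p(2) by (simp add: right_diff_distrib)
    then show ?thesis unfolding poisson_kernel_def by (simp add: norm_mult p(1))
  qed
  ultimately show ?thesis by (simp add: poisson_integral_def)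
qed simp

text \<open>
  As a function of \<open>x\<close> the integral is harmonic, and by rotation invariance it is constant on
  spheres around the origin.  Two applications of the maximum principle show that it has the same value
  on each sphere as at the origin, where the kernel is \<open>1\<close>.
\<close>

lemma poisson_integral_1:
  assumes "x \<in> ball 0 1"
  shows "poisson_integral (\<lambda>_. 1::real) x = 1"
proof -
  define I where "I = poisson_integral (\<lambda>_. 1::real)"
  have cont: "continuous_on (ball 0 1) I" unfolding I_def by (rule continuous_on_poisson_integral) simp
  have harm: "symmetric_laplacian I p 0" if "p \<in> ball 0 1" for p
    unfolding I_def by (rule symmetric_laplacian_poisson_integral) (use that in auto)
  have I0: "I 0 = 1"
  proof -
    have "I 0 = (LINT \<xi>|sphere_measure. 1)"
      unfolding I_def poisson_integral_def
      by (rule Bochner_Integration.integral_cong) (auto simp: poisson_kernel_def space_sphere_measure)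
    also have "\<dots> = measure sphere_measure (space sphere_measure)" by simp
    also have "\<dots> = 1" by (simp add: measure_def emeasure_space_sphere_measure)
    finally show ?thesis .
  qed
  show ?thesis
  proof (cases "x = 0")
    case True then show ?thesis using I0 by (simp add: I_def)
  next
    case False
    define s where "s = norm x"
    have s: "s > 0" "s < 1" using False assms by (auto simp: s_def)
    have cs: "continuous_on (cball 0 s) I" by (rule continuous_on_subset[OF cont]) (use s in auto)
    have bd: "I p = I x" if "norm p = s" for p
      using that poisson_integral_rotate[of p] poisson_integral_rotate[of x] s by (simp add: I_def s_def)
    have "I 0 \<le> I x"
      by (rule maximum_principle_off_axis[of 1 s I 0])
         (use s in \<open>auto intro: harm cs simp: bd\<close>)
    moreover have "- I 0 \<le> - I x"
    proof (rule maximum_principle_off_axis[of 1 s "\<lambda>p. - I p" 0])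
      show "symmetric_laplacian (\<lambda>p. - I p) p 0" if "p \<in> ball 0 s" for p
        using symmetric_laplacian_cmult[OF harm, of p "-1"] that s by simp
    qed (use s in \<open>auto intro!: continuous_intros cs simp: bd\<close>)
    ultimately show ?thesis using I0 by (simp add: I_def)
  qed
qed

text \<open>
  The difference \<open>d\<close> of \<open>u\<close> and its Poisson integral is harmonic off the axis, so it
  remains to see that \<open>d\<close> is small near the unit sphere.  Since the kernel has integral \<open>1\<close>, \<open>d p\<close> is the
  integral of \<open>poisson_kernel p \<xi> * (u p - u \<xi>)\<close>: for \<open>\<xi>\<close> near \<open>p\<close> the last factor is small
  by uniform continuity on the closed ball, for the other \<open>\<xi>\<close> the kernel is at most
  \<open>(1 - (norm p)\<^sup>2) / \<eta> ^ 4\<close>.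
\<close>

lemma poisson_formula_real:
  fixes u :: "quat \<Rightarrow> real"
  assumes r: "r > 0" and u: "continuous_on (cball 0 1) u"
    and harm: "\<And>p. p \<in> ball 0 1 \<Longrightarrow> im_norm (a + r *\<^sub>R p) > 0 \<Longrightarrow> symmetric_laplacian u p 0"
    and x: "x \<in> ball 0 1"
  shows "u x = poisson_integral u x"
proof -
  interpret finite_measure sphere_measure by (rule finite_measure_sphere_measure)
  have us: "continuous_on (sphere 0 1) u" by (rule continuous_on_subset[OF u]) auto
  define d where "d = (\<lambda>p. u p - poisson_integral u p)"
  have dc: "continuous_on (ball 0 1) d"
    unfolding d_def by (intro continuous_intros continuous_on_poisson_integral us continuous_on_subset[OF u]) auto
  have dh: "symmetric_laplacian d p 0" if "p \<in> ball 0 1" "im_norm (a + r *\<^sub>R p) > 0" for p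
    using symmetric_laplacian_diff[OF harm[OF that] symmetric_laplacian_poisson_integral[OF us that(1)]]
    by (simp add: d_def)
  have "bounded (u ` cball 0 1)"
    by (rule compact_imp_bounded[OF compact_continuous_image[OF u compact_cball]])
  then obtain M where M: "\<And>p. p \<in> cball 0 1 \<Longrightarrow> \<bar>u p\<bar> \<le> M"
    unfolding bounded_iff real_norm_def by blast
  have M0: "M \<ge> 0" using M[of 0] by simp
  have small: "\<bar>d x\<bar> \<le> \<epsilon>" if \<epsilon>: "\<epsilon> > 0" for \<epsilon>
  proof -
    have "uniformly_continuous_on (cball 0 1) u" by (rule compact_uniformly_continuous[OF u compact_cball])
    then obtain \<eta> where \<eta>: "\<eta> > 0" "\<And>p q. p \<in> cball 0 1 \<Longrightarrow> q \<in> cball 0 1 \<Longrightarrow> dist p q < \<eta> \<Longrightarrow> dist (u p) (u q) < \<epsilon> / 2"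
      unfolding uniformly_continuous_on_def using \<epsilon> by (meson half_gt_zero)
    \<comment> \<open>At distance at least \<open>\<eta>\<close> from \<open>p\<close> the integrand is at most \<open>C (1 - (norm p)\<^sup>2)\<close>.\<close>
    define C where "C = 2 * M / \<eta> ^ 4"
    have C0: "C \<ge> 0" using M0 \<eta> by (simp add: C_def)
    have "((\<lambda>s. C * (1 - s\<^sup>2)) \<longlongrightarrow> C * (1 - 1\<^sup>2)) (at_left 1)"
      by (intro tendsto_intros)
    then have "((\<lambda>s. C * (1 - s\<^sup>2)) \<longlongrightarrow> 0) (at_left 1)" by simp
    then have "\<forall>\<^sub>F s in at_left 1. C * (1 - s\<^sup>2) < \<epsilon> / 2"
      by (rule order_tendstoD) (use \<epsilon> in simp)
    moreover have "\<forall>\<^sub>F s in at_left 1. s \<in> {norm x<..<1}"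
      by (rule eventually_at_left_real) (use x in simp)
    ultimately have "\<forall>\<^sub>F s in at_left 1. s \<in> {norm x<..<1} \<and> C * (1 - s\<^sup>2) < \<epsilon> / 2"
      by eventually_elim simp
    then obtain s where s: "norm x < s" "s < 1" "C * (1 - s\<^sup>2) < \<epsilon> / 2"
      using eventually_happens'[of "at_left (1::real)"] by auto
    have s0: "s > 0" using s norm_ge_zero[of x] by linarith
    have bd: "\<bar>d p\<bar> \<le> \<epsilon>" if p: "norm p = s" for p
    proof -
      have pb: "p \<in> ball 0 1" using p s by simp
      have I1: "integrable sphere_measure (poisson_kernel p)"
        by (rule integrable_sphere_continuous[OF continuous_on_poisson_kernel_sphere[OF pb]])
      have I2: "integrable sphere_measure (\<lambda>\<xi>. poisson_kernel p \<xi> * u \<xi>)"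
        using integrable_poisson[OF pb us] by simp
      have one: "(LINT \<xi>|sphere_measure. poisson_kernel p \<xi>) = 1"
        using poisson_integral_1[OF pb] by (simp add: poisson_integral_def)
      have I3: "integrable sphere_measure (\<lambda>\<xi>. poisson_kernel p \<xi> * u p - poisson_kernel p \<xi> * u \<xi>)"
        using I1 I2 by simp
      have "d p = (LINT \<xi>|sphere_measure. poisson_kernel p \<xi> * u p - poisson_kernel p \<xi> * u \<xi>)"
        using I1 I2 by (simp add: Bochner_Integration.integral_diff one d_def poisson_integral_def)
      then have "\<bar>d p\<bar> \<le> (LINT \<xi>|sphere_measure. \<bar>poisson_kernel p \<xi> * u p - poisson_kernel p \<xi> * u \<xi>\<bar>)"
        by (simp add: integral_abs_bound)
      also have "\<dots> \<le> (LINT \<xi>|sphere_measure. \<epsilon> / 2 * poisson_kernel p \<xi> + C * (1 - s\<^sup>2))"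
      proof (rule integral_mono)
        show "integrable sphere_measure (\<lambda>\<xi>. \<bar>poisson_kernel p \<xi> * u p - poisson_kernel p \<xi> * u \<xi>\<bar>)"
          using I3 by (rule integrable_abs)
        show "integrable sphere_measure (\<lambda>\<xi>. \<epsilon> / 2 * poisson_kernel p \<xi> + C * (1 - s\<^sup>2))"
          using I1 by simp
        fix \<xi> assume "\<xi> \<in> space sphere_measure"
        then have \<xi>: "norm \<xi> = 1" by (simp add: space_sphere_measure)
        have P0: "poisson_kernel p \<xi> \<ge> 0" by (rule poisson_kernel_nonneg[OF pb])
        have abs: "\<bar>poisson_kernel p \<xi> * u p - poisson_kernel p \<xi> * u \<xi>\<bar> = poisson_kernel p \<xi> * \<bar>u p - u \<xi>\<bar>"
          using P0 by (simp add: right_diff_distrib[symmetric] abs_mult)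
        have Cs: "C * (1 - s\<^sup>2) \<ge> 0" using C0 s s0 by (intro mult_nonneg_nonneg) (auto simp: power_le_one)
        show "\<bar>poisson_kernel p \<xi> * u p - poisson_kernel p \<xi> * u \<xi>\<bar> \<le> \<epsilon> / 2 * poisson_kernel p \<xi> + C * (1 - s\<^sup>2)"
        proof (cases "dist p \<xi> < \<eta>")
          case True
          then have "\<bar>u p - u \<xi>\<bar> \<le> \<epsilon> / 2" using \<eta>(2)[of p \<xi>] pb \<xi> by (simp add: dist_real_def)
          then have "poisson_kernel p \<xi> * \<bar>u p - u \<xi>\<bar> \<le> poisson_kernel p \<xi> * (\<epsilon> / 2)"
            using P0 by (rule mult_left_mono)
          then show ?thesis unfolding abs using Cs by (simp add: mult.commute)
        next
          case False
          then have far: "\<eta> \<le> norm (p - \<xi>)" by (simp add: dist_norm)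
          have "poisson_kernel p \<xi> = (1 - s\<^sup>2) / norm (p - \<xi>) ^ 4"
            by (simp add: poisson_kernel_def p)
          also have "\<dots> \<le> (1 - s\<^sup>2) / \<eta> ^ 4"
            using far \<eta>(1) s s0 by (intro divide_left_mono power_mono mult_pos_pos zero_less_power) (auto simp: power_le_one intro: less_le_trans)
          finally have P1: "poisson_kernel p \<xi> \<le> (1 - s\<^sup>2) / \<eta> ^ 4" .
          have "\<bar>u p - u \<xi>\<bar> \<le> 2 * M" using M[of p] M[of \<xi>] pb \<xi> by simp
          then have "poisson_kernel p \<xi> * \<bar>u p - u \<xi>\<bar> \<le> (1 - s\<^sup>2) / \<eta> ^ 4 * (2 * M)"
            using P1 P0 by (intro mult_mono) auto
          also have "\<dots> = C * (1 - s\<^sup>2)" by (simp add: C_def)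
          finally show ?thesis unfolding abs using P0 \<epsilon> by (smt (verit) mult_nonneg_nonneg divide_nonneg_pos)
        qed
      qed
      also have "\<dots> = \<epsilon> / 2 + C * (1 - s\<^sup>2)"
        using I1 by (simp add: one measure_def emeasure_space_sphere_measure)
      finally show ?thesis using s(3) by linarith
    qed
    have cs: "continuous_on (cball 0 s) d" by (rule continuous_on_subset[OF dc]) (use s in auto)
    have "d x \<le> \<epsilon>"
      by (rule maximum_principle_off_axis[OF r s0 cs, where a=a])
         (use bd s dh in \<open>auto simp: abs_le_iff\<close>)
    moreover have "- d x \<le> \<epsilon>"
    proof (rule maximum_principle_off_axis[OF r s0, of "\<lambda>p. - d p" a])
      show "symmetric_laplacian (\<lambda>p. - d p) p 0" if "p \<in> ball 0 s" "im_norm (a + r *\<^sub>R p) > 0" for p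
        using symmetric_laplacian_cmult[OF dh, of p "-1"] that s by simp
    qed (use bd s in \<open>auto intro!: continuous_intros cs simp: abs_le_iff\<close>)
    ultimately show ?thesis by linarith
  qed
  have "\<bar>d x\<bar> \<le> 0" by (rule field_le_epsilon) (use small in simp)
  then show ?thesis by (simp add: d_def)
qed

text \<open>
  The hypothesis asks for each real coordinate of \<open>g\<close> to be a spherical value off the real axis, and at
  the axis only for continuity.  For \<open>r = 0\<close> the formula is the normalization of the kernel.
\<close>

theorem poisson_formula_spherical:
  fixes g :: "quat \<Rightarrow> quat"
  assumes r: "r \<ge> 0" and g: "continuous_on (cball a r) g"
    and hol: "\<And>b. \<exists>\<phi> U. open U \<and> \<phi> holomorphic_on U \<and>
      (\<forall>q\<in>cball a r. im_norm q > 0 \<longrightarrow> Complex (qRe q) (im_norm q) \<in> U \<and>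
         inner (g q) b = Im (\<phi> (Complex (qRe q) (im_norm q))) / im_norm q)"
    and x: "x \<in> ball 0 1"
  shows "g (a + r *\<^sub>R x) = poisson_integral (\<lambda>\<xi>. g (a + r *\<^sub>R \<xi>)) x"
proof (cases "r = 0")
  case True
  have "poisson_integral (\<lambda>\<xi>. g (a + r *\<^sub>R \<xi>)) x = poisson_integral (\<lambda>_. 1::real) x *\<^sub>R g a"
    unfolding poisson_integral_def True
    using integrable_sphere_continuous[OF continuous_on_poisson_kernel_sphere[OF x]]
    by (simp add: integral_scaleR_left)
  then show ?thesis by (simp add: True poisson_integral_1[OF x])
next
  case False
  then have r0: "r > 0" using r by simp
  have mem: "a + r *\<^sub>R p \<in> cball a r" if "p \<in> cball 0 1" for p
    using that r0 by (auto simp: dist_norm mult_left_le)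
  have gc: "continuous_on (cball 0 1) (\<lambda>p. g (a + r *\<^sub>R p))"
    by (rule continuous_on_compose2[OF g]) (use mem in \<open>auto intro!: continuous_intros\<close>)
  have int: "integrable sphere_measure (\<lambda>\<xi>. poisson_kernel x \<xi> *\<^sub>R g (a + r *\<^sub>R \<xi>))"
    by (rule integrable_poisson[OF x continuous_on_subset[OF gc]]) auto
  show ?thesis
  proof (rule euclidean_eqI)
    fix b :: quat
    obtain \<phi> U where U: "open U" "\<phi> holomorphic_on U"
      and eq: "\<And>q. q \<in> cball a r \<Longrightarrow> im_norm q > 0 \<Longrightarrow> Complex (qRe q) (im_norm q) \<in> U \<and>
         inner (g q) b = Im (\<phi> (Complex (qRe q) (im_norm q))) / im_norm q"
      using hol[of b] by blast
    define u where "u = (\<lambda>p. inner (g (a + r *\<^sub>R p)) b)"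
    have "u x = poisson_integral u x"
    proof (rule poisson_formula_real[OF r0 _ _ x])
      show "continuous_on (cball 0 1) u" unfolding u_def by (intro continuous_intros gc)
      fix p assume p: "p \<in> ball 0 1" "im_norm (a + r *\<^sub>R p) > 0"
      have m: "a + r *\<^sub>R p \<in> cball a r" using mem[of p] p by simp
      have "symmetric_laplacian (\<lambda>q. Im (\<phi> (Complex (qRe q) (im_norm q))) / im_norm q) (a + r *\<^sub>R p) 0"
        by (rule spherical_value_symmetric_laplacian[OF U(2,1)]) (use eq[OF m p(2)] p in auto)
      from symmetric_laplacian_affine[OF this r0]
      have "symmetric_laplacian (\<lambda>p. Im (\<phi> (Complex (qRe (a + r *\<^sub>R p)) (im_norm (a + r *\<^sub>R p)))) / im_norm (a + r *\<^sub>R p)) p 0" by simp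
      then show "symmetric_laplacian u p 0"
      proof (rule symmetric_laplacian_cong)
        show "open (ball 0 1 \<inter> {p. 0 < im_norm (a + r *\<^sub>R p)})"
          by (intro open_Int open_ball open_Collect_less continuous_intros)
        fix q assume q: "q \<in> ball 0 1 \<inter> {p. 0 < im_norm (a + r *\<^sub>R p)}"
        then show "Im (\<phi> (Complex (qRe (a + r *\<^sub>R q)) (im_norm (a + r *\<^sub>R q)))) / im_norm (a + r *\<^sub>R q) = u q"
          using eq[OF mem[of q]] by (simp add: u_def)
      qed (use p in auto)
    qed
    also have "\<dots> = inner (poisson_integral (\<lambda>\<xi>. g (a + r *\<^sub>R \<xi>)) x) b"
      unfolding poisson_integral_def u_def using integral_inner_left[of b, OF int] by simp
    finally show "inner (g (a + r *\<^sub>R x)) b = inner (poisson_integral (\<lambda>\<xi>. g (a + r *\<^sub>R \<xi>)) x) b"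
      by (simp add: u_def)
  qed
qed

section \<open>Stem functions that are holomorphic in some of the variables\<close>

definition replace_at :: "('n::finite) cvec \<Rightarrow> 'n \<Rightarrow> complex \<Rightarrow> 'n cvec"
  where "replace_at z h w = (\<chi> i. if i = h then w else z $ i)"

lemma replace_at_nth: "replace_at z h w $ i = (if i = h then w else z $ i)"
  by (simp add: replace_at_def)

lemma replace_at_same: "replace_at z h (z $ h) = z"
  by (simp add: vec_eq_iff replace_at_nth)

lemma continuous_on_replace_at [continuous_intros]:
  assumes "continuous_on S f" "continuous_on S g"
  shows "continuous_on S (\<lambda>x. replace_at (f x) h (g x))"
  unfolding replace_at_def
proof (rule continuous_on_vec_lambda)
  fix i show "continuous_on S (\<lambda>x. if i = h then g x else f x $ i)"
    using assms by (cases "i = h") (auto intro!: continuous_intros)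
qed

lemma open_replace_at_slice:
  assumes "open D" shows "open {w. replace_at z h w \<in> D}"
  using open_vimage[OF assms, of "replace_at z h"]
  by (simp add: vimage_def continuous_on_replace_at continuous_on_const continuous_on_id)

lemma norm_axis: "norm (axis h x :: ('a::real_normed_vector, 'n::finite) vec) = norm x"
proof -
  have "(\<Sum>i\<in>UNIV. (norm ((axis h x :: ('a, 'n) vec) $ i))\<^sup>2) = (\<Sum>i\<in>UNIV. if i = h then (norm x)\<^sup>2 else 0)"
    by (rule sum.cong) (auto simp: axis_def)
  then show ?thesis by (simp add: norm_vec_def L2_set_def)
qed

lemma dist_replace_at:
  "dist (replace_at z h w) z0 \<le> dist z z0 + dist w (z $ h)"
proof -
  have "replace_at z h w - z = axis h (w - z $ h)"
    by (auto simp: vec_eq_iff replace_at_nth axis_def)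
  then have "dist (replace_at z h w) z = dist w (z $ h)"
    by (simp add: dist_norm norm_axis)
  then show ?thesis using dist_triangle[of "replace_at z h w" z0 z] by (simp add: add.commute)
qed

text \<open>
  For \<open>h \<notin> K\<close> the complex structure \<open>J_op h\<close> preserves the span of \<open>e\<^sub>K\<close> and \<open>e\<^bsub>insert h K\<^esub>\<close>.  After pairing
  with a quaternion \<open>b\<close> a stem function becomes a family of complex functions, and
  holomorphy of the stem function in \<open>z\<^sub>h\<close> is holomorphy of these functions.
\<close>

definition stem_pair :: "('n cvec \<Rightarrow> 'n quat_tensor) \<Rightarrow> ('n::finite) \<Rightarrow> 'n set \<Rightarrow> quat \<Rightarrow> 'n cvec \<Rightarrow> complex"
  where "stem_pair F h K b z = Complex (inner (F z $ K) b) (inner (F z $ insert h K) b)"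

text \<open>
  Continuous stem functions that are holomorphic in each of the variables in \<open>A\<close> separately.  This class
  is stable under the division by an imaginary part, at the price of one variable of \<open>A\<close>: continuity
  across the real axis and holomorphy in the other variables survive.
\<close>

definition regular_in :: "('n::finite) cvec set \<Rightarrow> 'n set \<Rightarrow> ('n cvec \<Rightarrow> 'n quat_tensor) \<Rightarrow> bool"
  where "regular_in D A F \<longleftrightarrow> stem_function D F \<and>
    (\<forall>h\<in>A. \<forall>z K b. h \<notin> K \<longrightarrow>
       (\<lambda>w. stem_pair F h K b (replace_at z h w)) holomorphic_on {w. replace_at z h w \<in> D})"

lemma J_op_nth: "J_op h u $ K = (if h \<in> K then u $ (K - {h}) else - (u $ insert h K))"
proof -
  have "J_op h u $ K = (\<Sum>L\<in>UNIV. if L = sym_diff K {h} then (- 1) ^ card (L \<inter> {h}) * u $ L else 0)"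
    unfolding J_op_def sum_component
    by (rule sum.cong) (auto simp: axis_def)
  also have "\<dots> = (- 1) ^ card (sym_diff K {h} \<inter> {h}) * u $ sym_diff K {h}"
    by (simp add: sum.delta)
  also have "\<dots> = (if h \<in> K then u $ (K - {h}) else - (u $ insert h K))"
  proof (cases "h \<in> K")
    case True
    then have "sym_diff K {h} = K - {h}" by auto
    then show ?thesis using True by simp
  next
    case False
    then have "sym_diff K {h} = insert h K" by auto
    then show ?thesis using False by (simp add: Int_insert_left)
  qed
  finally show ?thesis .
qed

text \<open>
  The equations \<open>dbar h F = 0\<close>, read in the coordinates \<open>K\<close> and \<open>insert h K\<close>, are the
  Cauchy-Riemann equations of \<open>stem_pair F h K b\<close>.
\<close>

lemma holomorphic_stem_regular_in:
  fixes D :: "('n::finite) cvec set" and F :: "'n cvec \<Rightarrow> 'n quat_tensor"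
  assumes D: "open D" and F: "holomorphic_stem D F"
  shows "regular_in D UNIV F"
  unfolding regular_in_def
proof (intro conjI ballI allI impI)
  show "stem_function D F" using F by (simp add: holomorphic_stem_def)
  fix h :: 'n and z :: "'n cvec" and K b assume hK: "h \<notin> K"
  obtain F' where F': "\<And>z. z \<in> D \<Longrightarrow> (F has_derivative blinfun_apply (F' z)) (at z)"
    using F unfolding holomorphic_stem_def C1_on_def by blast
  show "(\<lambda>w. stem_pair F h K b (replace_at z h w)) holomorphic_on {w. replace_at z h w \<in> D}"
    unfolding holomorphic_on_def
  proof
    fix w assume "w \<in> {w. replace_at z h w \<in> D}"
    then have wD: "replace_at z h w \<in> D" by simp
    define p where "p = replace_at z h w"
    define L where "L = blinfun_apply (F' p)"
    have dF: "(F has_derivative L) (at p)" using F' wD by (simp add: p_def L_def)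
    have bL: "bounded_linear L" using dF by (rule has_derivative_bounded_linear)
    have line: "vector_derivative (\<lambda>t. F (p + t *\<^sub>R e)) (at 0) = L e" for e
    proof (rule vector_derivative_at)
      have "((\<lambda>t. p + t *\<^sub>R e) has_derivative (\<lambda>t. t *\<^sub>R e)) (at 0)"
        by (auto intro!: derivative_eq_intros)
      then have "((\<lambda>t. F (p + t *\<^sub>R e)) has_derivative (\<lambda>t. L (t *\<^sub>R e))) (at 0)"
        by (rule has_derivative_compose) (use dF in simp)
      then show "((\<lambda>t. F (p + t *\<^sub>R e)) has_vector_derivative L e) (at 0)"
        by (simp add: has_vector_derivative_def linear_scale[OF bounded_linear.linear[OF bL]])
    qed
    define A B where "A = L (axis h 1)" and "B = L (axis h \<i>)"
    have "dbar h F p = 0" using F wD by (simp add: holomorphic_stem_def p_def)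
    then have CR: "A + J_op h B = 0" by (simp add: dbar_def line A_def B_def)
    have CR1: "A $ K = B $ insert h K"
      using arg_cong[OF CR, of "\<lambda>v. v $ K"] hK by (simp add: J_op_nth)
    have CR2: "A $ insert h K = - B $ K"
    proof -
      have "insert h K - {h} = K" using hK by auto
      then have "A $ insert h K + B $ K = 0"
        using arg_cong[OF CR, of "\<lambda>v. v $ insert h K"] by (simp add: J_op_nth)
      then show ?thesis by (simp add: eq_neg_iff_add_eq_0)
    qed
    have aff: "replace_at z h v = p + axis h (v - w)" for v
      by (auto simp: vec_eq_iff replace_at_nth p_def axis_def)
    have ax0: "p + axis h 0 = p" by (simp add: vec_eq_iff axis_def)
    have bax: "bounded_linear (\<lambda>v. axis h v :: 'n cvec)"
      by (rule bounded_linearI'[where 'a=complex and 'b="'n cvec"])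
         (auto simp: vec_eq_iff axis_def)
    have "((\<lambda>v. p + axis h (v - w)) has_derivative (\<lambda>v. axis h v)) (at w)"
    proof -
      have "((\<lambda>v. v - w) has_derivative (\<lambda>v. v)) (at w)" by (auto intro!: derivative_eq_intros)
      then have "((\<lambda>v. axis h (v - w)) has_derivative (\<lambda>v. axis h v :: 'n cvec)) (at w)"
        by (rule bounded_linear.has_derivative[OF bax])
      from has_derivative_add[OF has_derivative_const[of p] this] show ?thesis by simp
    qed
    then have "((\<lambda>v. F (p + axis h (v - w))) has_derivative (\<lambda>v. L (axis h v))) (at w)"
      by (rule has_derivative_compose) (use dF in \<open>simp only: diff_self ax0\<close>)
    then have dFw: "((\<lambda>v. F (replace_at z h v)) has_derivative (\<lambda>v. L (axis h v))) (at w)"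
      by (simp add: aff)
    have Lax: "L (axis h v) = Re v *\<^sub>R A + Im v *\<^sub>R B" for v
    proof -
      have "axis h v = Re v *\<^sub>R axis h 1 + Im v *\<^sub>R (axis h \<i> :: 'n cvec)"
        by (auto simp: vec_eq_iff axis_def complex_eq_iff)
      then show ?thesis
        by (simp add: A_def B_def linear_add[OF bounded_linear.linear[OF bL]] linear_scale[OF bounded_linear.linear[OF bL]])
    qed
    have comp: "((\<lambda>v. inner (F (replace_at z h v) $ T) b) has_derivative (\<lambda>v. inner (L (axis h v) $ T) b)) (at w)" for T
      using bounded_linear.has_derivative[OF bounded_linear_inner_left bounded_linear.has_derivative[OF bounded_linear_vec_nth dFw]] .
    define c where "c = Complex (inner (A $ K) b) (inner (A $ insert h K) b)"
    have "((\<lambda>v. of_real (inner (F (replace_at z h v) $ K) b) + \<i> * of_real (inner (F (replace_at z h v) $ insert h K) b))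
       has_derivative (\<lambda>v. of_real (inner (L (axis h v) $ K) b) + \<i> * of_real (inner (L (axis h v) $ insert h K) b))) (at w)"
      by (intro has_derivative_add has_derivative_of_real comp has_derivative_mult_right)
    moreover have "of_real (inner (L (axis h v) $ K) b) + \<i> * of_real (inner (L (axis h v) $ insert h K) b) = c * v" for v
      unfolding Lax c_def using CR1 CR2
      by (simp add: complex_eq_iff inner_add_left algebra_simps)
    ultimately have "((\<lambda>v. stem_pair F h K b (replace_at z h v)) has_field_derivative c) (at w)"
      unfolding has_field_derivative_def by (simp add: stem_pair_def Complex_eq)
    then show "(\<lambda>w. stem_pair F h K b (replace_at z h w)) field_differentiable at w within {w. replace_at z h w \<in> D}"
      using field_differentiable_def field_differentiable_at_within by blast
  qed
qed

lemma regular_in_stem: "regular_in D A F \<Longrightarrow> stem_function D F"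
  by (simp add: regular_in_def)

lemma regular_in_subset: "regular_in D A F \<Longrightarrow> B \<subseteq> A \<Longrightarrow> regular_in D B F"
  by (auto simp: regular_in_def)

lemma stem_continuous_nth:
  assumes "stem_function D F" shows "continuous_on D (\<lambda>z. F z $ K)"
  using assms unfolding stem_function_def by (auto intro: continuous_intros)

lemma stem_conj:
  assumes "stem_function D F" "z \<in> D"
  shows "F (conj_at h z) $ K = (if h \<in> K then - (F z $ K) else F z $ K)"
  using assms unfolding stem_function_def by auto

lemma conj_at_Re_Im: "Re (conj_at h z $ j) = Re (z $ j)"
  "Im (conj_at h z $ j) = (if j = h then - Im (z $ j) else Im (z $ j))"
  by (simp_all add: conj_at_def)

text \<open>
  Multiplication of a stem function by the coordinate \<open>\<alpha>\<^sub>j + e\<^sub>j \<beta>\<^sub>j\<close>.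
\<close>

definition coord_mult :: "'n::finite \<Rightarrow> ('n cvec \<Rightarrow> 'n quat_tensor) \<Rightarrow> 'n cvec \<Rightarrow> 'n quat_tensor"
  where "coord_mult j F z = (\<chi> K. Re (z $ j) *\<^sub>R F z $ K +
     (if j \<in> K then Im (z $ j) *\<^sub>R F z $ (K - {j}) else - (Im (z $ j) *\<^sub>R F z $ insert j K)))"

lemma coord_mult_nth: "coord_mult j F z $ K = Re (z $ j) *\<^sub>R F z $ K +
     (if j \<in> K then Im (z $ j) *\<^sub>R F z $ (K - {j}) else - (Im (z $ j) *\<^sub>R F z $ insert j K))"
  by (simp add: coord_mult_def)

lemma stem_functionI:
  assumes "\<And>K. continuous_on D (\<lambda>z. F z $ K)"
    and "\<And>z h K. z \<in> D \<Longrightarrow> F (conj_at h z) $ K = (if h \<in> K then - (F z $ K) else F z $ K)"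
  shows "stem_function D F"
proof -
  have "continuous_on D (\<lambda>z. \<chi> K. F z $ K)" by (intro continuous_on_vec_lambda assms(1))
  then show ?thesis using assms(2) by (simp add: stem_function_def)
qed

text \<open>
  On the complex functions \<open>stem_pair F h K b\<close> the multiplication acts as multiplication by \<open>z\<^sub>j\<close> for
  \<open>h = j\<close>, and as a linear combination with coefficients independent of \<open>z\<^sub>h\<close> for \<open>h \<noteq> j\<close>.
\<close>

lemma regular_in_coord_mult:
  assumes F: "regular_in D A F"
  shows "regular_in D A (coord_mult j F)"
proof -
  note st = regular_in_stem[OF F]
  have cont: "continuous_on D (\<lambda>z. coord_mult j F z $ K)" for K
    unfolding coord_mult_nth
    by (cases "j \<in> K") (auto intro!: continuous_intros stem_continuous_nth[OF st])
  have par: "coord_mult j F (conj_at h z) $ K = (if h \<in> K then - (coord_mult j F z $ K) else coord_mult j F z $ K)"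
    if "z \<in> D" for z h K
    by (cases "h = j"; cases "h \<in> K"; cases "j \<in> K")
       (auto simp: coord_mult_nth stem_conj[OF st that] conj_at_Re_Im)
  have "(\<lambda>w. stem_pair (coord_mult j F) h K b (replace_at z h w)) holomorphic_on {w. replace_at z h w \<in> D}"
    if h: "h \<in> A" "h \<notin> K" for h z K b
  proof -
    have hol: "(\<lambda>w. stem_pair F h L b (replace_at z h w)) holomorphic_on {w. replace_at z h w \<in> D}" if "h \<notin> L" for L
      using F h that by (simp add: regular_in_def)
    show ?thesis
    proof (cases "h = j")
      case True
      have "insert h K - {h} = K" using h by auto
      then have "stem_pair (coord_mult j F) h K b (replace_at z h w) = w * stem_pair F h K b (replace_at z h w)" for w
        using h True
        by (simp add: stem_pair_def coord_mult_nth replace_at_nth complex_eq_iff inner_simps algebra_simps)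
      then show ?thesis using hol[OF h(2)] by (simp add: holomorphic_intros)
    next
      case False
      \<comment> \<open>\<open>\<beta>\<close> and \<open>L\<close> come from \<open>e\<^sub>j e\<^sub>j = - 1\<close>: the sign depends on whether \<open>e\<^sub>j\<close> is added to or removed from \<open>K\<close>.\<close>
      define \<beta> where "\<beta> = complex_of_real (if j \<in> K then Im (z $ j) else - Im (z $ j))"
      define L where "L = (if j \<in> K then K - {j} else insert j K)"
      have L: "h \<notin> L" using h False by (auto simp: L_def)
      have "insert h (K - {j}) = insert h K - {j}" "insert h (insert j K) = insert j (insert h K)"
        using False by auto
      then have "stem_pair (coord_mult j F) h K b (replace_at z h w) =
          of_real (Re (z $ j)) * stem_pair F h K b (replace_at z h w) + \<beta> * stem_pair F h L b (replace_at z h w)" for w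
        using False by (simp add: stem_pair_def coord_mult_nth replace_at_nth complex_eq_iff inner_simps \<beta>_def L_def)
      then show ?thesis using hol[OF h(2)] hol[OF L] by (simp add: holomorphic_intros)
    qed
  qed
  then show ?thesis
    unfolding regular_in_def using stem_functionI[OF cont par] by blast
qed

lemma spherical_stem_nth:
  "spherical_stem H F z $ K = (if K \<inter> H = {} then inverse (\<Prod>h\<in>H. Im (z $ h)) *\<^sub>R F z $ (K \<union> H) else 0)"
proof -
  have "(\<Sum>L\<in>Pow (- H). axis L (F z $ (L \<union> H))) $ K = (\<Sum>L\<in>Pow (- H). if L = K then F z $ (K \<union> H) else 0)"
    unfolding sum_component by (rule sum.cong) (auto simp: axis_def)
  also have "\<dots> = (if K \<inter> H = {} then F z $ (K \<union> H) else 0)"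
    by (auto simp: sum.delta')
  finally show ?thesis by (simp add: spherical_stem_def)
qed

lemma subset_closure_off_real:
  fixes D :: "('n::finite) cvec set"
  assumes "open D" shows "D \<subseteq> closure (off_real D H)"
proof
  fix z assume z: "z \<in> D"
  define X where "X = (\<lambda>n. (\<chi> i. z $ i + (if Im (z $ i) = 0 then of_real (1 / real (Suc n)) * \<i> else 0)) :: 'n cvec)"
  have X: "X \<longlonglongrightarrow> z"
  proof (rule vec_tendstoI)
    fix i
    have "(\<lambda>n. z $ i + of_real (1 / real (Suc n)) * \<i>) \<longlonglongrightarrow> z $ i + of_real 0 * \<i>"
      by (intro tendsto_intros LIMSEQ_Suc[OF lim_1_over_n[where 'a=real]])
    then show "(\<lambda>n. X n $ i) \<longlonglongrightarrow> z $ i"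
      by (cases "Im (z $ i) = 0") (simp_all add: X_def)
  qed
  have im: "Im (X n $ i) \<noteq> 0" for n i by (simp add: X_def)
  have "\<forall>\<^sub>F n in sequentially. X n \<in> D" using topological_tendstoD[OF X assms z] .
  then have "\<forall>\<^sub>F n in sequentially. X n \<in> off_real D H"
    by eventually_elim (use im in \<open>auto simp: off_real_def\<close>)
  then show "z \<in> closure (off_real D H)"
    by (intro Lim_in_closed_set[OF closed_closure _ _ X])
       (auto elim: eventually_mono intro: closure_subset[THEN subsetD])
qed

lemma continuous_eq_on_dense:
  fixes f g :: "'a::metric_space \<Rightarrow> 'b::t2_space"
  assumes f: "continuous_on D f" and g: "continuous_on D g"
    and S: "S \<subseteq> D" "D \<subseteq> closure S" and eq: "\<And>x. x \<in> S \<Longrightarrow> f x = g x" and x: "x \<in> D"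
  shows "f x = g x"
proof -
  obtain X where X: "\<And>n. X n \<in> S" "X \<longlonglongrightarrow> x"
    using S(2) x closure_sequential by blast
  have "(\<lambda>n. f (X n)) \<longlonglongrightarrow> f x" "(\<lambda>n. g (X n)) \<longlonglongrightarrow> g x"
    using continuous_on_tendsto_compose[OF f X(2) x] continuous_on_tendsto_compose[OF g X(2) x] X(1) S(1)
    by (auto simp: subset_iff)
  moreover have "(\<lambda>n. f (X n)) = (\<lambda>n. g (X n))" using eq X(1) by auto
  ultimately show ?thesis using LIMSEQ_unique by metis
qed

text \<open>
  Local extensions agree where they overlap because \<open>S\<close> is dense, so they can be glued.
\<close>

lemma continuous_extension_local:
  fixes f :: "'a::metric_space \<Rightarrow> 'b::t2_space"
  assumes S: "S \<subseteq> D" "D \<subseteq> closure S"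
    and loc: "\<And>p. p \<in> D \<Longrightarrow> \<exists>V g. open V \<and> p \<in> V \<and> V \<subseteq> D \<and> continuous_on V g \<and> (\<forall>x\<in>V \<inter> S. g x = f x)"
  shows "\<exists>G. continuous_on D G \<and> (\<forall>x\<in>S. G x = f x)"
proof -
  obtain V g where Vg: "\<And>p. p \<in> D \<Longrightarrow> open (V p) \<and> p \<in> V p \<and> V p \<subseteq> D \<and> continuous_on (V p) (g p) \<and> (\<forall>x\<in>V p \<inter> S. g p x = f x)"
    using loc by metis
  define G where "G = (\<lambda>p. g p p)"
  have agree: "g p x = g q x" if "p \<in> D" "q \<in> D" "x \<in> V p \<inter> V q" for p q x
  proof (rule continuous_eq_on_dense[of "V p \<inter> V q" _ _ "V p \<inter> V q \<inter> S"])
    show "continuous_on (V p \<inter> V q) (g p)" "continuous_on (V p \<inter> V q) (g q)"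
      using Vg[OF that(1)] Vg[OF that(2)] by (auto intro: continuous_on_subset)
    have "open (V p \<inter> V q)" using Vg that by auto
    moreover have "V p \<inter> V q \<subseteq> closure S" using Vg[OF that(1)] S(2) by blast
    ultimately show "V p \<inter> V q \<subseteq> closure (V p \<inter> V q \<inter> S)"
      using open_Int_closure_subset[of "V p \<inter> V q" S] by blast
    show "g p y = g q y" if y: "y \<in> V p \<inter> V q \<inter> S" for y
      using Vg[OF \<open>p \<in> D\<close>] Vg[OF \<open>q \<in> D\<close>] y by auto
  qed (use that in auto)
  have "continuous_on D G"
  proof (rule continuous_at_imp_continuous_on, rule ballI)
    fix p assume p: "p \<in> D"
    have "continuous_on (V p) G"
      by (rule continuous_on_eq[of _ "g p"]) (use Vg[OF p] agree[OF p] Vg in \<open>auto simp: G_def subset_iff\<close>)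
    then show "isCont G p" using Vg[OF p] continuous_on_eq_continuous_at by blast
  qed
  moreover have "\<forall>x\<in>S. G x = f x" using Vg S(1) by (auto simp: G_def)
  ultimately show ?thesis by blast
qed

section \<open>Dividing a stem function by imaginary parts\<close>

text \<open>
  The Cauchy formula at \<open>p\<close> and \<open>q\<close> together with the partial fractions of \<open>1 / ((u - p) (u - q))\<close>.  On the left
  nothing singular happens when \<open>p\<close> and \<open>q\<close> come together.
\<close>

lemma circle_divided_difference:
  assumes hol: "\<phi> holomorphic_on cball c R" and p: "p \<in> ball c R" "q \<in> ball c R" "p \<noteq> q"
  shows "integral {0..1} (\<lambda>t. \<phi> (circlepath c R t) / ((circlepath c R t - p) * (circlepath c R t - q)) * (of_real R * exp (2 * of_real pi * \<i> * of_real t)))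
     = (\<phi> p - \<phi> q) / (p - q)"
proof -
  have 1: "((\<lambda>u. \<phi> u / (u - v)) has_contour_integral (2 * of_real pi * \<i> * \<phi> v)) (circlepath c R)" if "v \<in> ball c R" for v
    by (rule Cauchy_integral_circlepath_simple[OF hol]) (use that in \<open>simp add: dist_norm norm_minus_commute\<close>)
  have "((\<lambda>u. (\<phi> u / (u - p) - \<phi> u / (u - q)) / (p - q)) has_contour_integral
     ((2 * of_real pi * \<i> * \<phi> p - 2 * of_real pi * \<i> * \<phi> q) / (p - q))) (circlepath c R)"
    by (intro has_contour_integral_div has_contour_integral_diff 1 p)
  then have "((\<lambda>t. ((\<phi> (circlepath c R t) / (circlepath c R t - p) - \<phi> (circlepath c R t) / (circlepath c R t - q)) / (p - q))
       * vector_derivative (circlepath c R) (at t within {0..1})) has_integral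
     ((2 * of_real pi * \<i> * \<phi> p - 2 * of_real pi * \<i> * \<phi> q) / (p - q))) {0..1}"
    by (simp add: has_contour_integral_def)
  moreover have R0: "R > 0" using p(1) by (auto intro: le_less_trans[OF zero_le_dist])
  moreover have "((\<phi> (circlepath c R t) / (circlepath c R t - p) - \<phi> (circlepath c R t) / (circlepath c R t - q)) / (p - q))
       * vector_derivative (circlepath c R) (at t within {0..1})
     = (2 * of_real pi * \<i>) * (\<phi> (circlepath c R t) / ((circlepath c R t - p) * (circlepath c R t - q)) * (of_real R * exp (2 * of_real pi * \<i> * of_real t)))"
    if t: "t \<in> {0..1}" for t
  proof -
    have "dist c (circlepath c R t) = R"
      using R0 by (simp add: circlepath dist_norm norm_mult)
    then have ne: "circlepath c R t - p \<noteq> 0" "circlepath c R t - q \<noteq> 0" using p by auto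
    have "\<phi> (circlepath c R t) / (circlepath c R t - p) - \<phi> (circlepath c R t) / (circlepath c R t - q)
      = \<phi> (circlepath c R t) * (p - q) / ((circlepath c R t - p) * (circlepath c R t - q))"
      using ne by (simp add: field_simps)
    then show ?thesis
      using t p(3) by (simp add: vector_derivative_circlepath01)
  qed
  ultimately have "((\<lambda>t. (2 * of_real pi * \<i>) * (\<phi> (circlepath c R t) / ((circlepath c R t - p) * (circlepath c R t - q)) * (of_real R * exp (2 * of_real pi * \<i> * of_real t))))
       has_integral ((2 * of_real pi * \<i> * \<phi> p - 2 * of_real pi * \<i> * \<phi> q) / (p - q))) {0..1}"
    by (subst has_integral_cong[symmetric]) auto
  from has_integral_mult_right[OF this, of "1 / (2 * of_real pi * \<i>)"]
  show ?thesis
    by (intro integral_unique) (simp add: diff_divide_distrib right_diff_distrib[symmetric])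
qed

text \<open>
  Near a point with \<open>\<beta>\<^sub>h \<noteq> 0\<close> the quotient itself is continuous.  Near a point with real \<open>z\<^sub>h\<close> the parity
  of a stem function makes \<open>\<phi> = stem_pair F h K b\<close> satisfy \<open>\<phi>(cnj w) = cnj (\<phi> w)\<close>, so the quotient is the
  divided difference of \<open>\<phi>\<close> at \<open>z\<^sub>h\<close> and \<open>cnj z\<^sub>h\<close>, given by a circle integral.
\<close>

lemma spherical_stem_local_extension:
  fixes D :: "('n::finite) cvec set"
  assumes D: "open D" "invariant_set D" and F: "regular_in D A F" and h: "h \<in> A" and z0: "z0 \<in> D"
  shows "\<exists>V g. open V \<and> z0 \<in> V \<and> V \<subseteq> D \<and> continuous_on V g \<and>
    (\<forall>z\<in>V \<inter> off_real D {h}. g z = spherical_stem {h} F z)"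
proof (cases "Im (z0 $ h) = 0")
  case False
  define V where "V = D \<inter> {z. Im (z $ h) \<noteq> 0}"
  have "open {z::'n cvec. Im (z $ h) \<noteq> 0}"
    by (intro open_Collect_neq continuous_intros)
  moreover have "continuous_on V (\<lambda>z. \<chi> K. if K \<inter> {h} = {} then inverse (Im (z $ h)) *\<^sub>R F z $ (K \<union> {h}) else 0)"
  proof (rule continuous_on_vec_lambda)
    fix K
    have "continuous_on V (\<lambda>z. F z $ (K \<union> {h}))"
      by (rule continuous_on_subset[OF stem_continuous_nth[OF regular_in_stem[OF F]]]) (auto simp: V_def)
    then show "continuous_on V (\<lambda>z. if K \<inter> {h} = {} then inverse (Im (z $ h)) *\<^sub>R F z $ (K \<union> {h}) else 0)"
      by (cases "K \<inter> {h} = {}") (auto intro!: continuous_intros simp: V_def)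
  qed
  then have "continuous_on V (spherical_stem {h} F)"
    by (rule continuous_on_eq) (simp add: vec_eq_iff spherical_stem_nth)
  ultimately show ?thesis
    using D(1) z0 False by (intro exI[of _ V] exI[of _ "spherical_stem {h} F"]) (auto simp: V_def)
next
  case True
  obtain e where e: "e > 0" "ball z0 e \<subseteq> D" using D(1) z0 open_contains_ball by blast
  \<comment> \<open>Replacing the coordinate \<open>h\<close> of \<open>z \<in> V\<close> by a point at distance at most \<open>e / 2\<close> from \<open>z0 $ h\<close> moves \<open>z\<close> by less than \<open>e / 2 + e / 4\<close>, hence to a point of \<open>ball z0 e\<close>.\<close>
  define V where "V = ball z0 (e / 4)"
  define R where "R = e / 2"
  define c where "c = z0 $ h"
  have R: "R > 0" using e by (simp add: R_def)
  have cc: "cnj c = c" using True by (simp add: c_def complex_eq_iff)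
  have near: "replace_at z h w \<in> D" if "z \<in> V" "w \<in> cball c R" for z w
  proof -
    have "dist w (z $ h) \<le> dist w c + dist (z0 $ h) (z $ h)" by (metis c_def dist_triangle)
    also have "\<dots> \<le> R + dist z0 z" using that(2) dist_vec_nth_le[of z0 h z] by (simp add: dist_commute)
    finally have "dist (replace_at z h w) z0 \<le> dist z z0 + (R + dist z0 z)"
      using dist_replace_at[of z h w z0] by linarith
    also have "\<dots> < e" using that(1) by (simp add: V_def R_def dist_commute)
    finally show ?thesis using e(2) by (auto simp: dist_commute)
  qed
  have inb: "z $ h \<in> ball c R" "cnj (z $ h) \<in> ball c R" if "z \<in> V" for z
  proof -
    have "dist c (z $ h) < R"
      using that dist_vec_nth_le[of z0 h z] e(1) unfolding c_def V_def R_def mem_ball by linarith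
    moreover have "dist c (cnj (z $ h)) = dist c (z $ h)"
      by (metis cc complex_cnj_diff complex_mod_cnj dist_norm)
    ultimately show "z $ h \<in> ball c R" "cnj (z $ h) \<in> ball c R" by auto
  qed
  define \<gamma> where "\<gamma> = circlepath c R"
  have \<gamma>c: "\<gamma> t \<in> cball c R" for t using R by (simp add: \<gamma>_def circlepath dist_norm norm_mult)
  have \<gamma>n: "\<gamma> t - z $ h \<noteq> 0" "\<gamma> t - cnj (z $ h) \<noteq> 0" if "z \<in> V" for t z
  proof -
    have "dist c (\<gamma> t) = R" using R by (simp add: \<gamma>_def circlepath dist_norm norm_mult)
    then show "\<gamma> t - z $ h \<noteq> 0" "\<gamma> t - cnj (z $ h) \<noteq> 0" using inb[OF that] by auto
  qed
  define I where "I = (\<lambda>K b z. integral (cbox 0 1) (\<lambda>t::real. stem_pair F h K b (replace_at z h (\<gamma> t)) / ((\<gamma> t - z $ h) * (\<gamma> t - cnj (z $ h))) * (of_real R * exp (2 * of_real pi * \<i> * of_real t))))"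
  have c\<gamma>: "continuous_on S \<gamma>" for S unfolding \<gamma>_def circlepath_def part_circlepath_def linepath_def by (intro continuous_intros)
  have Ic: "continuous_on V (I K b)" for K b
    unfolding I_def
  proof (rule integral_continuous_on_param)
    have c1: "continuous_on (V \<times> cbox 0 1) (\<lambda>p. F (replace_at (fst p) h (\<gamma> (snd p))) $ L)" for L
    proof (rule continuous_on_compose2[OF stem_continuous_nth[OF regular_in_stem[OF F]]])
      show "continuous_on (V \<times> cbox 0 1) (\<lambda>p. replace_at (fst p) h (\<gamma> (snd p)))"
        by (intro continuous_intros continuous_on_compose2[OF c\<gamma>]) auto
    qed (auto intro!: near \<gamma>c)
    have c2: "continuous_on (V \<times> cbox 0 1) (\<lambda>p. \<gamma> (snd p))"
      by (intro continuous_on_compose2[OF c\<gamma>] continuous_intros) auto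
    show "continuous_on (V \<times> cbox 0 1) (\<lambda>(z, t). stem_pair F h K b (replace_at z h (\<gamma> t)) / ((\<gamma> t - z $ h) * (\<gamma> t - cnj (z $ h))) * (of_real R * exp (2 * of_real pi * \<i> * of_real t)))"
      unfolding case_prod_unfold stem_pair_def Complex_eq
      by (intro continuous_intros c1 c2) (use \<gamma>n in auto)
  qed
  define g where "g = (\<lambda>z. \<chi> K. if h \<in> K then 0 else (\<Sum>b\<in>Basis. Re (I K b z) *\<^sub>R b))"
  have "continuous_on V g"
    unfolding g_def
  proof (rule continuous_on_vec_lambda)
    fix K show "continuous_on V (\<lambda>z. if h \<in> K then 0 else (\<Sum>b\<in>Basis. Re (I K b z) *\<^sub>R b))"
      by (cases "h \<in> K") (auto intro!: continuous_intros Ic)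
  qed
  moreover have "g z = spherical_stem {h} F z" if z: "z \<in> V \<inter> off_real D {h}" for z
    unfolding vec_eq_iff
  proof
    fix K
    have zD: "z \<in> D" and im: "Im (z $ h) \<noteq> 0" and zV: "z \<in> V" using z by (auto simp: off_real_def)
    show "g z $ K = spherical_stem {h} F z $ K"
    proof (cases "h \<in> K")
      case True then show ?thesis by (simp add: g_def spherical_stem_nth)
    next
      case False
      have "I K b z = of_real (inner (F z $ insert h K) b / Im (z $ h))" for b
      proof -
        define \<phi> where "\<phi> = (\<lambda>w. stem_pair F h K b (replace_at z h w))"
        have "\<phi> holomorphic_on {w. replace_at z h w \<in> D}"
          using F h False unfolding regular_in_def \<phi>_def by blast
        then have hol: "\<phi> holomorphic_on cball c R"
          by (rule holomorphic_on_subset) (use near[OF zV] in auto)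
        have "I K b z = (\<phi> (z $ h) - \<phi> (cnj (z $ h))) / (z $ h - cnj (z $ h))"
          unfolding I_def \<gamma>_def \<phi>_def[symmetric] cbox_interval
          using circle_divided_difference[OF hol inb[OF zV]] im by (simp add: \<phi>_def complex_eq_iff)
        also have "\<phi> (cnj (z $ h)) = cnj (\<phi> (z $ h))"
        proof -
          have "replace_at z h (cnj (z $ h)) = conj_at h z"
            by (simp add: vec_eq_iff replace_at_nth conj_at_def)
          then show ?thesis
            using False by (simp add: \<phi>_def replace_at_same stem_pair_def stem_conj[OF regular_in_stem[OF F] zD] complex_eq_iff)
        qed
        finally show ?thesis
          using im by (simp add: complex_diff_cnj \<phi>_def replace_at_same stem_pair_def)
      qed
      then have "g z $ K = (\<Sum>b\<in>Basis. (inner (inverse (Im (z $ h)) *\<^sub>R F z $ insert h K) b) *\<^sub>R b)"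
        using False by (simp add: g_def divide_inverse mult.commute del: of_real_mult of_real_inverse of_real_divide)
      also have "\<dots> = inverse (Im (z $ h)) *\<^sub>R F z $ insert h K"
        by (rule euclidean_representation)
      finally show ?thesis using False by (simp add: spherical_stem_nth)
    qed
  qed
  ultimately show ?thesis
    using e z0 near[of _ "_ $ h"] inb
    by (intro exI[of _ V] exI[of _ g]) (auto simp: V_def subset_iff)
qed

text \<open>
  The parity of the extension follows from that of the quotient by density.  For holomorphy in another
  variable \<open>z\<^sub>k\<close> only real values of \<open>z\<^sub>h\<close> need an argument: there the function is a locally
  uniform limit of the quotients at the nonreal values \<open>z\<^sub>h + \<i> t \<epsilon>\<close>, as \<open>t\<close> tends to \<open>0\<close>.
\<close>

lemma regular_in_divide:
  fixes D :: "('n::finite) cvec set"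
  assumes D: "open D" "invariant_set D" and F: "regular_in D A F" and h: "h \<in> A"
  shows "\<exists>G. regular_in D (A - {h}) G \<and> (\<forall>z\<in>off_real D {h}. G z = spherical_stem {h} F z)"
proof -
  let ?S = "off_real D {h}"
  have S: "?S \<subseteq> D" "D \<subseteq> closure ?S"
    using subset_closure_off_real[OF D(1), of "{h}"] by (simp_all add: off_real_def)
  obtain G where G: "continuous_on D G" "\<And>z. z \<in> ?S \<Longrightarrow> G z = spherical_stem {h} F z"
    using continuous_extension_local[OF S spherical_stem_local_extension[OF D F h]] by blast
  have Gn: "continuous_on D (\<lambda>z. G z $ K)" for K using G(1) by (intro continuous_intros)
  have cD: "conj_at k z \<in> D" if "z \<in> D" for k z using D(2) that by (auto simp: invariant_set_def)
  have cc: "continuous_on D (conj_at k)" for k :: 'n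
    unfolding conj_at_def[abs_def]
  proof (rule continuous_on_vec_lambda)
    fix i show "continuous_on D (\<lambda>z. if i = k then cnj (z $ i) else z $ i)"
      by (cases "i = k") (auto intro!: continuous_intros)
  qed
  note st = regular_in_stem[OF F]
  have par: "G (conj_at k z) $ K = (if k \<in> K then - (G z $ K) else G z $ K)" if z: "z \<in> D" for z k K
  proof (rule continuous_eq_on_dense[OF _ _ S _ z])
    show "continuous_on D (\<lambda>z. G (conj_at k z) $ K)"
      by (rule continuous_on_compose2[OF Gn cc]) (use cD in auto)
    show "continuous_on D (\<lambda>z. if k \<in> K then - (G z $ K) else G z $ K)"
      by (cases "k \<in> K") (auto intro!: continuous_intros Gn)
    fix y assume y: "y \<in> ?S"
    then have yD: "y \<in> D" and cy: "conj_at k y \<in> ?S"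
      using cD by (auto simp: off_real_def conj_at_Re_Im)
    show "G (conj_at k y) $ K = (if k \<in> K then - (G y $ K) else G y $ K)"
      unfolding G(2)[OF y] G(2)[OF cy] spherical_stem_nth stem_conj[OF st yD]
      by (auto simp: conj_at_Re_Im)
  qed
  \<comment> \<open>The coordinates containing \<open>h\<close> were discarded by the division.\<close>
  have zero: "G z $ K = 0" if "z \<in> D" "h \<in> K" for z K
    by (rule continuous_eq_on_dense[OF Gn continuous_on_const S _ that(1)])
       (use that in \<open>auto simp: G(2) spherical_stem_nth\<close>)
  have "(\<lambda>w. stem_pair G k K b (replace_at z k w)) holomorphic_on {w. replace_at z k w \<in> D}"
    if k: "k \<in> A" "k \<noteq> h" "k \<notin> K" for k z K b
  proof (cases "h \<in> K")
    case True
    have "(\<lambda>w. 0) holomorphic_on {w. replace_at z k w \<in> D}" by simp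
    then show ?thesis
      by (rule holomorphic_transform) (use zero True in \<open>auto simp: stem_pair_def complex_eq_iff\<close>)
  next
    case False
    have nonreal: "(\<lambda>w. stem_pair G k K b (replace_at z k w)) holomorphic_on {w. replace_at z k w \<in> D}"
      if im: "Im (z $ h) \<noteq> 0" for z
    proof -
      define s where "s = inverse (Im (z $ h))"
      have "(\<lambda>w. stem_pair F k (insert h K) b (replace_at z k w)) holomorphic_on {w. replace_at z k w \<in> D}"
        using F k unfolding regular_in_def by blast
      then have "(\<lambda>w. of_real s * stem_pair F k (insert h K) b (replace_at z k w)) holomorphic_on {w. replace_at z k w \<in> D}"
        by (intro holomorphic_intros)
      then show ?thesis
      proof (rule holomorphic_transform)
        fix w assume "w \<in> {w. replace_at z k w \<in> D}"
        then have w: "replace_at z k w \<in> ?S" using im k(2) by (auto simp: off_real_def replace_at_nth)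
        have "insert h (insert k K) = insert k (insert h K)" by auto
        then show "of_real s * stem_pair F k (insert h K) b (replace_at z k w) = stem_pair G k K b (replace_at z k w)"
          using False k by (simp add: stem_pair_def G(2)[OF w] spherical_stem_nth replace_at_nth s_def[symmetric] complex_eq_iff)
      qed
    qed
    show ?thesis
    proof (cases "Im (z $ h) = 0")
      case False then show ?thesis by (rule nonreal)
    next
      case True
      show ?thesis
      proof (rule analytic_imp_holomorphic, unfold analytic_on_def, intro ballI)
        fix w0 assume "w0 \<in> {w. replace_at z k w \<in> D}"
        then obtain e where e: "e > 0" "ball (replace_at z k w0) e \<subseteq> D"
          using D(1) open_contains_ball by blast
        \<comment> \<open>Changes by at most \<open>\<epsilon>\<close> in the coordinate \<open>k\<close> and in the coordinate \<open>h\<close> add up to less than \<open>e\<close>.\<close>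
        define \<epsilon> where "\<epsilon> = e / 3"
        have \<epsilon>: "\<epsilon> > 0" using e by (simp add: \<epsilon>_def)
        define Z where "Z = (\<lambda>t::real. replace_at z h (z $ h + of_real t * (of_real \<epsilon> * \<i>)))"
        define \<Phi> where "\<Phi> = (\<lambda>t w. stem_pair G k K b (replace_at (Z t) k w))"
        have inD: "replace_at (Z t) k w \<in> D" if t: "t \<in> {0..1}" and w: "w \<in> cball w0 \<epsilon>" for t w
        proof -
          have "replace_at (Z t) k w = replace_at (replace_at (replace_at z k w0) k w) h (z $ h + of_real t * (of_real \<epsilon> * \<i>))"
            using k(2) by (auto simp: vec_eq_iff replace_at_nth Z_def)
          then have "dist (replace_at (Z t) k w) (replace_at z k w0) \<le>
             dist (replace_at (replace_at z k w0) k w) (replace_at z k w0) + dist (z $ h + of_real t * (of_real \<epsilon> * \<i>)) (z $ h)"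
            using dist_replace_at[of "replace_at (replace_at z k w0) k w" h "z $ h + of_real t * (of_real \<epsilon> * \<i>)" "replace_at z k w0"] k(2)
            by (simp add: replace_at_nth)
          also have "dist (replace_at (replace_at z k w0) k w) (replace_at z k w0) \<le> dist w w0"
            using dist_replace_at[of "replace_at z k w0" k w "replace_at z k w0"] by (simp add: replace_at_nth)
          also have "dist w w0 \<le> \<epsilon>" using w by (simp add: dist_commute)
          also have "dist (z $ h + of_real t * (of_real \<epsilon> * \<i>)) (z $ h) \<le> \<epsilon>"
            using t \<epsilon> by (simp add: dist_norm norm_mult mult_left_le_one_le)
          finally have "dist (replace_at (Z t) k w) (replace_at z k w0) < e"
            using e(1) by (simp add: \<epsilon>_def)
          then show ?thesis using e(2) by (auto simp: dist_commute)
        qed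
        have cZ: "continuous_on S Z" for S unfolding Z_def by (intro continuous_intros)
        have cG: "continuous_on ({0..1} \<times> cball w0 \<epsilon>) (\<lambda>p. G (replace_at (Z (fst p)) k (snd p)) $ L)" for L
          by (rule continuous_on_compose2[OF Gn])
             (use inD in \<open>auto intro!: continuous_intros continuous_on_compose2[OF cZ]\<close>)
        have "continuous_on ({0..1} \<times> cball w0 \<epsilon>) (\<lambda>p. \<Phi> (fst p) (snd p))"
          unfolding \<Phi>_def stem_pair_def Complex_eq
          by (intro continuous_on_add continuous_on_mult continuous_on_of_real continuous_on_const continuous_on_inner cG)
        then have uc: "uniformly_continuous_on ({0..1} \<times> cball w0 \<epsilon>) (\<lambda>p. \<Phi> (fst p) (snd p))"
          by (rule compact_uniformly_continuous) (intro compact_Times compact_Icc compact_cball)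
        have ul: "uniform_limit (cball w0 \<epsilon>) \<Phi> (\<Phi> 0) (at_right 0)"
          unfolding uniform_limit_iff
        proof (intro allI impI)
          fix \<kappa> :: real assume "\<kappa> > 0"
          then obtain d where d: "d > 0" "\<And>p q. p \<in> {0..1} \<times> cball w0 \<epsilon> \<Longrightarrow> q \<in> {0..1} \<times> cball w0 \<epsilon> \<Longrightarrow> dist q p < d \<Longrightarrow> dist (\<Phi> (fst q) (snd q)) (\<Phi> (fst p) (snd p)) < \<kappa>"
            using uc unfolding uniformly_continuous_on_def by metis
          have "\<forall>\<^sub>F t in at_right 0. t \<in> {0<..<min 1 d}"
            by (rule eventually_at_right_real) (use d in simp)
          then show "\<forall>\<^sub>F t in at_right 0. \<forall>w\<in>cball w0 \<epsilon>. dist (\<Phi> t w) (\<Phi> 0 w) < \<kappa>"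
          proof eventually_elim
            case (elim t)
            then show ?case using d(2)[of "(0, _)" "(t, _)"] by (auto simp: dist_Pair_Pair)
          qed
        qed
        have ev: "\<forall>\<^sub>F t in at_right 0. continuous_on (cball w0 \<epsilon>) (\<Phi> t) \<and> \<Phi> t holomorphic_on ball w0 \<epsilon>"
        proof -
          have "\<forall>\<^sub>F t in at_right (0::real). t \<in> {0<..<1}"
            by (rule eventually_at_right_real) simp
          then show ?thesis
          proof eventually_elim
            case (elim t)
            have "Im (Z t $ h) \<noteq> 0" using elim True \<epsilon> by (simp add: Z_def replace_at_nth)
            then have "\<Phi> t holomorphic_on cball w0 \<epsilon>"
              unfolding \<Phi>_def
              by (rule holomorphic_on_subset[OF nonreal]) (use inD elim in auto)
            then show ?case
              using holomorphic_on_imp_continuous_on holomorphic_on_subset ball_subset_cball by blast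
          qed
        qed
        have "\<Phi> 0 holomorphic_on ball w0 \<epsilon>"
          by (rule holomorphic_uniform_limit[OF ev ul]) auto
        moreover have "Z 0 = z" by (simp add: Z_def replace_at_same)
        ultimately show "\<exists>\<epsilon>>0. (\<lambda>w. stem_pair G k K b (replace_at z k w)) holomorphic_on ball w0 \<epsilon>"
          using \<epsilon> by (auto simp: \<Phi>_def)
      qed
    qed
  qed
  then have "regular_in D (A - {h}) G"
    unfolding regular_in_def using stem_functionI[OF Gn par] by blast
  then show ?thesis using G(2) by blast
qed

lemma off_real_insert: "off_real D (insert h H) = off_real D {h} \<inter> off_real D H"
  by (auto simp: off_real_def)

lemma spherical_stem_insert:
  assumes "h \<notin> H" "finite H" "G z = spherical_stem H F z"
  shows "spherical_stem {h} G z = spherical_stem (insert h H) F z"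
  unfolding vec_eq_iff spherical_stem_nth assms(3)
proof
  fix K
  have "insert h K \<inter> H = K \<inter> H" "insert h K \<union> H = K \<union> insert h H" using assms(1) by auto
  then show "(if K \<inter> {h} = {} then inverse (\<Prod>h\<in>{h}. Im (z $ h)) *\<^sub>R (if (K \<union> {h}) \<inter> H = {} then inverse (\<Prod>h\<in>H. Im (z $ h)) *\<^sub>R F z $ (K \<union> {h} \<union> H) else 0) else 0)
    = (if K \<inter> insert h H = {} then inverse (\<Prod>h\<in>insert h H. Im (z $ h)) *\<^sub>R F z $ (K \<union> insert h H) else 0)"
    using assms(1,2) by auto
qed

lemma regular_in_divide_all:
  fixes D :: "('n::finite) cvec set"
  assumes D: "open D" "invariant_set D" and F: "regular_in D A F" and H: "H \<subseteq> A"
  shows "\<exists>G. regular_in D (A - H) G \<and> (\<forall>z\<in>off_real D H. G z = spherical_stem H F z)"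
proof -
  have "finite H" by simp
  then show ?thesis using H
  proof (induction H)
    case empty
    have "spherical_stem {} F z = F z" for z by (simp add: vec_eq_iff spherical_stem_nth)
    then show ?case using F by auto
  next
    case (insert h H)
    then obtain G where G: "regular_in D (A - H) G" "\<And>z. z \<in> off_real D H \<Longrightarrow> G z = spherical_stem H F z" by auto
    obtain G' where G': "regular_in D (A - H - {h}) G'" "\<And>z. z \<in> off_real D {h} \<Longrightarrow> G' z = spherical_stem {h} G z"
      using regular_in_divide[OF D G(1), of h] insert by auto
    have "G' z = spherical_stem (insert h H) F z" if "z \<in> off_real D (insert h H)" for z
      using that G'(2) G(2) spherical_stem_insert[OF insert.hyps(2,1)] unfolding off_real_insert[of D h H] by auto
    moreover have "A - H - {h} = A - insert h H" by auto
    ultimately show ?case using G'(1) by auto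
  qed
qed

text \<open>
  Divide by the other imaginary parts first and by that of \<open>z\<^sub>j\<close> at the end: by density the result is the
  same \<open>G\<close>, and before the last step the function is still holomorphic in \<open>z\<^sub>j\<close>.
\<close>

lemma divided_stem_regular_in_each:
  fixes D :: "('n::finite) cvec set"
  assumes D: "open D" "invariant_set D" and F: "regular_in D H F" and j: "j \<in> H"
    and G: "continuous_on D G" "\<And>z. z \<in> off_real D H \<Longrightarrow> G z = spherical_stem H F z"
  shows "\<exists>G1. regular_in D {j} G1 \<and> (\<forall>z\<in>off_real D {j}. G z = spherical_stem {j} G1 z)"
proof -
  obtain G1 where G1: "regular_in D (H - (H - {j})) G1" "\<And>z. z \<in> off_real D (H - {j}) \<Longrightarrow> G1 z = spherical_stem (H - {j}) F z"
    using regular_in_divide_all[OF D F, of "H - {j}"] by auto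
  have H1: "H - (H - {j}) = {j}" using j by auto
  obtain G2 where G2: "regular_in D ({j} - {j}) G2" "\<And>z. z \<in> off_real D {j} \<Longrightarrow> G2 z = spherical_stem {j} G1 z"
    using regular_in_divide[OF D G1(1)[unfolded H1], of j] by auto
  have "G z = G2 z" if "z \<in> D" for z
  proof (rule continuous_eq_on_dense[OF G(1) _ _ subset_closure_off_real[OF D(1), of H] _ that])
    show "continuous_on D G2" using regular_in_stem[OF G2(1)] by (simp add: stem_function_def)
    show "off_real D H \<subseteq> D" by (auto simp: off_real_def)
    fix y assume y: "y \<in> off_real D H"
    have Hj: "insert j (H - {j}) = H" using j by auto
    have y2: "y \<in> off_real D {j}" "y \<in> off_real D (H - {j})" using y off_real_insert[of D j "H - {j}"] Hj by auto
    show "G y = G2 y"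
      unfolding G(2)[OF y] G2(2)[OF y2(1)]
      using spherical_stem_insert[of j "H - {j}" G1 y F] G1(2)[OF y2(2)] Hj by simp
  qed
  then show ?thesis using G1(1)[unfolded H1] G2(2) by (intro exI[of _ G1]) (auto simp: off_real_def)
qed

section \<open>Ordered products, uniqueness of stem functions, continuity of slice functions\<close>

lemma ord_prod_empty: "ord_prod q {} = 1"
  by (simp add: ord_prod_def)

text \<open>
  The recursion at the least index puts its factor on the left; inductions on ordered products of
  noncommuting factors therefore add elements from above to below.
\<close>

lemma ord_prod_insert_min:
  fixes K :: "'n::{finite,linorder} set"
  assumes "\<And>k. k \<in> K \<Longrightarrow> h < k"
  shows "ord_prod q (insert h K) = q h * ord_prod q K"
proof -
  have "h \<notin> K" using assms by blast
  then have "sorted_list_of_set (insert h K) = insort h (sorted_list_of_set K)"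
    by (simp add: sorted_list_of_set_insert_remove)
  also have "\<dots> = h # sorted_list_of_set K"
    by (rule insort_is_Cons) (use assms in \<open>auto intro: less_imp_le\<close>)
  finally show ?thesis by (simp add: ord_prod_def)
qed

lemma finite_min_induct [consumes 0, case_names empty insert]:
  fixes K :: "'n::{finite,linorder} set"
  assumes "P {}" and "\<And>h K. (\<And>k. k \<in> K \<Longrightarrow> h < k) \<Longrightarrow> P K \<Longrightarrow> P (insert h K)"
  shows "P K"
proof -
  have "finite K" by simp
  then show ?thesis
    by (induction rule: finite_linorder_min_induct) (use assms in auto)
qed

lemma ord_prod_append:
  fixes A B :: "'n::{finite,linorder} set"
  assumes "\<And>a b. a \<in> A \<Longrightarrow> b \<in> B \<Longrightarrow> a < b"
  shows "ord_prod q (A \<union> B) = ord_prod q A * ord_prod q B"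
  using assms
proof (induction A rule: finite_min_induct)
  case (insert h K)
  have "ord_prod q (insert h (K \<union> B)) = q h * ord_prod q (K \<union> B)"
    by (rule ord_prod_insert_min) (use insert in auto)
  then show ?case using insert by (simp add: ord_prod_insert_min mult.assoc)
qed (simp add: ord_prod_empty)

lemma ord_prod_scaleR:
  fixes K :: "'n::{finite,linorder} set"
  shows "ord_prod (\<lambda>k. c k *\<^sub>R q k) K = (\<Prod>k\<in>K. c k) *\<^sub>R ord_prod q K"
proof (induction K rule: finite_min_induct)
  case (insert h K)
  have "h \<notin> K" using insert(1) by blast
  then show ?case using insert by (simp add: ord_prod_insert_min)
qed (simp add: ord_prod_empty)

lemma ord_prod_add_real:
  fixes K :: "'n::{finite,linorder} set"
  shows "ord_prod (\<lambda>k. of_real (c k) + q k) K = (\<Sum>N\<in>Pow K. (\<Prod>k\<in>K - N. c k) *\<^sub>R ord_prod q N)"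
proof (induction K rule: finite_min_induct)
  case (insert h K)
  have hK: "h \<notin> K" using insert(1) by blast
  have P: "Pow (insert h K) = Pow K \<union> insert h ` Pow K" by (rule Pow_insert)
  have inj: "inj_on (insert h) (Pow K)" using hK by (auto simp: inj_on_def insert_ident)
  have disj: "Pow K \<inter> insert h ` Pow K = {}" using hK by auto
  have "(\<Sum>N\<in>Pow (insert h K). (\<Prod>k\<in>insert h K - N. c k) *\<^sub>R ord_prod q N)
     = (\<Sum>N\<in>Pow K. (\<Prod>k\<in>insert h K - N. c k) *\<^sub>R ord_prod q N)
     + (\<Sum>N\<in>Pow K. (\<Prod>k\<in>insert h K - insert h N. c k) *\<^sub>R ord_prod q (insert h N))"
    unfolding P by (subst sum.union_disjoint) (auto simp: disj sum.reindex[OF inj])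
  also have "(\<Sum>N\<in>Pow K. (\<Prod>k\<in>insert h K - N. c k) *\<^sub>R ord_prod q N)
     = (\<Sum>N\<in>Pow K. of_real (c h) * ((\<Prod>k\<in>K - N. c k) *\<^sub>R ord_prod q N))"
  proof (rule sum.cong)
    fix N assume "N \<in> Pow K"
    then have "insert h K - N = insert h (K - N)" "h \<notin> K - N" using hK by auto
    then show "(\<Prod>k\<in>insert h K - N. c k) *\<^sub>R ord_prod q N = of_real (c h) * ((\<Prod>k\<in>K - N. c k) *\<^sub>R ord_prod q N)"
      by (simp add: of_real_def)
  qed simp
  also have "(\<Sum>N\<in>Pow K. (\<Prod>k\<in>insert h K - insert h N. c k) *\<^sub>R ord_prod q (insert h N))
     = (\<Sum>N\<in>Pow K. q h * ((\<Prod>k\<in>K - N. c k) *\<^sub>R ord_prod q N))"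
  proof (rule sum.cong)
    fix N assume "N \<in> Pow K"
    then have "insert h K - insert h N = K - N" "ord_prod q (insert h N) = q h * ord_prod q N"
      using hK insert(1) by (auto intro!: ord_prod_insert_min)
    then show "(\<Prod>k\<in>insert h K - insert h N. c k) *\<^sub>R ord_prod q (insert h N) = q h * ((\<Prod>k\<in>K - N. c k) *\<^sub>R ord_prod q N)"
      by simp
  qed simp
  finally show ?case using insert
    by (simp add: ord_prod_insert_min sum_distrib_left distrib_right scaleR_add_right sum.distrib)
qed (simp add: ord_prod_empty)

lemma norm_ord_prod_units:
  fixes K :: "'n::{finite,linorder} set"
  assumes "\<And>h. J h \<in> imag_units"
  shows "norm (ord_prod J K) = 1"
  by (induction K rule: finite_min_induct)
     (auto simp: ord_prod_empty ord_prod_insert_min norm_mult imag_unitsD(2)[OF assms])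

lemma imag_units_iff: "J \<in> imag_units \<longleftrightarrow> qRe J = 0 \<and> norm J = 1"
proof
  assume J: "qRe J = 0 \<and> norm J = 1"
  then have "sqrt ((qI J)\<^sup>2 + (qJ J)\<^sup>2 + (qK J)\<^sup>2) = 1"
    unfolding norm_quat_def inner_quat_def power2_eq_square by (metis add_0 mult_zero_left)
  then have "(qI J)\<^sup>2 + (qJ J)\<^sup>2 + (qK J)\<^sup>2 = 1" by simp
  then show "J \<in> imag_units"
    using J by (simp add: imag_units_def quat_eq_iff power2_eq_square)
qed (use imag_unitsD in auto)

lemma uminus_imag_units: "J \<in> imag_units \<Longrightarrow> - J \<in> imag_units"
  by (simp add: imag_units_def)

text \<open>
  Replacing \<open>J\<^sub>h\<close> by \<open>- J\<^sub>h\<close> changes the sign of exactly the terms with \<open>h \<in> K\<close>, so the terms with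
  \<open>h \<in> K\<close> and those with \<open>h \<notin> K\<close> have sum zero separately.  Doing this for all \<open>h\<close> isolates each term.
\<close>

lemma slice_sum_zero_imp_zero:
  fixes d :: "'n::{finite,linorder} set \<Rightarrow> quat"
  assumes z: "\<And>J. (\<And>h. J h \<in> imag_units) \<Longrightarrow> (\<Sum>K\<in>UNIV. ord_prod J K * d K) = 0"
  shows "d K = 0"
proof -
  have main: "\<forall>B J. (\<forall>h. J h \<in> imag_units) \<longrightarrow> (\<Sum>K | K \<inter> A = B \<inter> A. ord_prod J K * d K) = 0" for A :: "'n set"
  proof -
    have "finite A" by simp
    then show ?thesis
    proof (induction A)
      case empty then show ?case using z by simp
    next
      case (insert h A)
      show ?case
      proof (intro allI impI)
        fix B and J :: "'n \<Rightarrow> quat" assume J: "\<forall>h. J h \<in> imag_units"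
        define S where "S = {K. K \<inter> A = B \<inter> A}"
        have J': "\<forall>k. (J(h := - J h)) k \<in> imag_units" using J uminus_imag_units by auto
        have s1: "(\<Sum>K\<in>S. ord_prod J K * d K) = 0" using insert.IH J by (simp add: S_def)
        have s2: "(\<Sum>K\<in>S. ord_prod (J(h := - J h)) K * d K) = 0" using insert.IH J' unfolding S_def by blast
        have split: "sum g S = sum g {K\<in>S. h \<in> K} + sum g {K\<in>S. h \<notin> K}" for g :: "'n set \<Rightarrow> quat"
          by (subst sum.union_disjoint[symmetric]) (auto intro: sum.cong)
        define P N where "P = (\<Sum>K\<in>{K\<in>S. h \<in> K}. ord_prod J K * d K)" and "N = (\<Sum>K\<in>{K\<in>S. h \<notin> K}. ord_prod J K * d K)"
        have "P + N = 0" using s1 split[of "\<lambda>K. ord_prod J K * d K"] by (simp add: P_def N_def)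
        moreover have "- P + N = 0"
        proof -
          have "(\<Sum>K\<in>{K\<in>S. h \<in> K}. ord_prod (J(h := - J h)) K * d K) = - P"
            unfolding P_def sum_negf[symmetric] ord_prod_flip by (rule sum.cong) auto
          moreover have "(\<Sum>K\<in>{K\<in>S. h \<notin> K}. ord_prod (J(h := - J h)) K * d K) = N"
            unfolding N_def ord_prod_flip by (rule sum.cong) auto
          ultimately show ?thesis using s2 split[of "\<lambda>K. ord_prod (J(h := - J h)) K * d K"] by simp
        qed
        ultimately have PN: "P = N" "P + N = 0" by (simp_all add: algebra_simps)
        then have "(2::real) *\<^sub>R P = 0" by (simp add: scaleR_2)
        then have "P = 0" "N = 0" using PN by simp_all
        moreover have "{K. K \<inter> insert h A = B \<inter> insert h A} = (if h \<in> B then {K\<in>S. h \<in> K} else {K\<in>S. h \<notin> K})"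
          by (auto simp: S_def)
        ultimately show "(\<Sum>K | K \<inter> insert h A = B \<inter> insert h A. ord_prod J K * d K) = 0"
          unfolding P_def N_def by simp
      qed
    qed
  qed
  \<comment> \<open>Any choice of units serves to cancel the product of units in the single remaining term.\<close>
  define J :: "'n \<Rightarrow> quat" where "J = (\<lambda>_. Quat 0 1 0 0)"
  have J: "\<And>h. J h \<in> imag_units" by (simp add: J_def imag_units_def quat_eq_iff)
  have "(\<Sum>L | L \<inter> UNIV = K \<inter> UNIV. ord_prod J L * d L) = 0" using main[of UNIV] J by blast
  then have "ord_prod J K * d K = 0" by simp
  moreover have "ord_prod J K \<noteq> 0" using norm_ord_prod_units[of J K] J by auto
  ultimately show ?thesis by simp
qed

lemma stem_function_unique:
  fixes D :: "('n::{finite,linorder}) cvec set"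
  assumes D: "invariant_set D" and F: "stem_function D F" "stem_function D G"
    and f: "induces D F f" "induces D G f" and z: "z \<in> D"
  shows "F z = G z"
proof -
  have "F z $ K - G z $ K = 0" for K
  proof (rule slice_sum_zero_imp_zero)
    fix J :: "'n \<Rightarrow> quat" assume J: "\<And>h. J h \<in> imag_units"
    have "slice_point z J \<in> circ D" using z J by (auto simp: circ_def)
    then have "induced D F (slice_point z J) = induced D G (slice_point z J)"
      using f by (simp add: induces_def)
    then show "(\<Sum>K\<in>UNIV. ord_prod J K * (F z $ K - G z $ K)) = 0"
      by (simp add: induced_slice_point[OF D F(1) z J] induced_slice_point[OF D F(2) z J]
          right_diff_distrib sum_subtractf)
  qed
  then show ?thesis by (simp add: vec_eq_iff)
qed

lemma stem_of_eq:
  fixes D :: "('n::{finite,linorder}) cvec set"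
  assumes D: "invariant_set D" and F: "stem_function D F" "induces D F f"
  shows "stem_function D (stem_of D f)" "\<And>z. z \<in> D \<Longrightarrow> stem_of D f z = F z"
proof -
  have "stem_function D (stem_of D f) \<and> induces D (stem_of D f) f"
    unfolding stem_of_def by (rule someI[of _ F]) (use F in simp)
  then show "stem_function D (stem_of D f)" "\<And>z. z \<in> D \<Longrightarrow> stem_of D f z = F z"
    using stem_function_unique[OF D _ F(1) _ F(2)] by auto
qed

text \<open>
  A quaternion \<open>q\<close> is written as \<open>\<alpha> + J \<beta>\<close> with \<open>\<beta> = im_norm q \<ge> 0\<close>.  For real \<open>q\<close> the unit \<open>J\<close> is
  arbitrary, and the first imaginary unit is taken.
\<close>

definition slice_coord :: "quat \<Rightarrow> complex"
  where "slice_coord q = Complex (qRe q) (im_norm q)"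

definition slice_unit :: "quat \<Rightarrow> quat"
  where "slice_unit q = (if im_norm q = 0 then Quat 0 1 0 0 else (q - of_real (qRe q)) /\<^sub>R im_norm q)"

lemma im_norm_eq_norm: "im_norm q = norm (q - of_real (qRe q))"
  by (simp add: im_norm_def norm_quat_def inner_quat_def power2_eq_square)

lemma slice_unit_imag_units: "slice_unit q \<in> imag_units"
proof (cases "im_norm q = 0")
  case True
  then show ?thesis by (simp add: slice_unit_def imag_units_def quat_eq_iff)
next
  case False
  then have "norm (q - of_real (qRe q)) \<noteq> 0" by (simp add: im_norm_eq_norm)
  then show ?thesis by (simp add: slice_unit_def imag_units_iff im_norm_eq_norm)
qed

lemma slice_unit_coord: "of_real (Re (slice_coord q)) + slice_unit q * of_real (Im (slice_coord q)) = q"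
proof (cases "im_norm q = 0")
  case True
  then have "q - of_real (qRe q) = 0" by (simp add: im_norm_eq_norm)
  then show ?thesis using True by (simp add: slice_coord_def)
next
  case False
  then show ?thesis by (simp add: slice_coord_def slice_unit_def of_real_def)
qed

definition slice_coords :: "('n::finite) qvec \<Rightarrow> 'n cvec"
  where "slice_coords x = (\<chi> i. slice_coord (x $ i))"

lemma slice_point_coords: "slice_point (slice_coords x) (\<lambda>i. slice_unit (x $ i)) = x"
  by (simp add: slice_point_def slice_coords_def slice_unit_coord vec_eq_iff)

lemma invariant_set_conj_on:
  fixes D :: "('n::finite) cvec set"
  assumes D: "invariant_set D" and z: "z \<in> D"
    and w: "\<And>i. w $ i = z $ i \<or> w $ i = cnj (z $ i)"
  shows "w \<in> D"
proof -
  have "finite S \<Longrightarrow> (\<chi> i. if i \<in> S then w $ i else z $ i) \<in> D" for S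
  proof (induction S rule: finite_induct)
    case empty then show ?case using z by (simp add: vec_lambda_eta)
  next
    case (insert h S)
    let ?v = "(\<chi> i. if i \<in> S then w $ i else z $ i)"
    have "(\<chi> i. if i \<in> insert h S then w $ i else z $ i) = (if w $ h = z $ h then ?v else conj_at h ?v)"
      using w[of h] insert(2) by (auto simp: vec_eq_iff conj_at_def)
    then show ?case using insert(3) D by (auto simp: invariant_set_def)
  qed
  from this[of UNIV] show ?thesis by (simp add: vec_lambda_eta)
qed

lemma slice_coord_point:
  assumes "J \<in> imag_units"
  shows "slice_coord (of_real \<alpha> + J * of_real \<beta>) = Complex \<alpha> \<bar>\<beta>\<bar>"
proof -
  have re: "qRe (of_real \<alpha> + J * of_real \<beta>) = \<alpha>" using imag_unitsD(1)[OF assms] by simp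
  show ?thesis
    unfolding slice_coord_def im_norm_eq_norm re
    using imag_unitsD(2)[OF assms] by (simp add: norm_mult)
qed

lemma slice_coords_mem:
  fixes D :: "('n::{finite,linorder}) cvec set"
  assumes D: "invariant_set D" and x: "x \<in> circ D"
  shows "slice_coords x \<in> D"
proof -
  obtain z J where z: "z \<in> D" "\<And>h. J h \<in> imag_units" "x = slice_point z J"
    using x by (auto simp: circ_def)
  show ?thesis
  proof (rule invariant_set_conj_on[OF D z(1)])
    fix i
    have "slice_coords x $ i = Complex (Re (z $ i)) \<bar>Im (z $ i)\<bar>"
      using slice_coord_point[OF z(2)[of i]] by (simp add: slice_coords_def z(3) slice_point_def)
    then show "slice_coords x $ i = z $ i \<or> slice_coords x $ i = cnj (z $ i)"
      by (auto simp: complex_eq_iff abs_if)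
  qed
qed

lemma induced_eq:
  fixes D :: "('n::{finite,linorder}) cvec set"
  assumes D: "invariant_set D" and F: "stem_function D F" and x: "x \<in> circ D"
  shows "induced D F x = (\<Sum>K\<in>UNIV. ord_prod (\<lambda>i. slice_unit (x $ i)) K * F (slice_coords x) $ K)"
  using induced_slice_point[OF D F slice_coords_mem[OF D x], of "\<lambda>i. slice_unit (x $ i)"]
  by (simp add: slice_point_coords slice_unit_imag_units)

lemma continuous_on_qRe [continuous_intros]:
  assumes "continuous_on S f" shows "continuous_on S (\<lambda>x. qRe (f x))"
proof -
  have "(\<lambda>x. qRe (f x)) = (\<lambda>x. inner (f x) (Quat 1 0 0 0))" by (simp add: inner_quat_def)
  then show ?thesis using assms by (simp only:) (intro continuous_intros)
qed

lemma continuous_on_slice_coords: "continuous_on S slice_coords"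
  unfolding slice_coords_def[abs_def] slice_coord_def Complex_eq
  by (intro continuous_on_vec_lambda continuous_intros)

lemma stem_function_zero_on_axis:
  fixes D :: "('n::finite) cvec set"
  assumes F: "stem_function D F" and z: "z \<in> D" and k: "k \<in> K" "Im (z $ k) = 0"
  shows "F z $ K = 0"
proof -
  have "conj_at k z = z" using k(2) by (auto simp: conj_at_def vec_eq_iff complex_eq_iff)
  then have "F z $ K = - (F z $ K)" using stem_conj[OF F z, of k K] k(1) by simp
  then have "(2::real) *\<^sub>R (F z $ K) = 0" by (metis add.right_inverse scaleR_2)
  then show ?thesis by simp
qed

text \<open>
  The unit \<open>J\<^sub>k\<close> is discontinuous where \<open>x\<^sub>k\<close> is real, but there the coordinates \<open>F\<^sub>K\<close> with \<open>k \<in> K\<close>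
  vanish, and the products of units have norm \<open>1\<close>.
\<close>

lemma continuous_on_induced:
  fixes D :: "('n::{finite,linorder}) cvec set"
  assumes D: "invariant_set D" and F: "stem_function D F"
  shows "continuous_on (circ D) (induced D F)"
proof -
  have "continuous_on (circ D) (\<lambda>x. ord_prod (\<lambda>i. slice_unit (x $ i)) K * F (slice_coords x) $ K)" for K
    unfolding continuous_on_def
  proof
    fix x assume x: "x \<in> circ D"
    have cF: "continuous_on (circ D) (\<lambda>x. F (slice_coords x) $ K)"
      by (rule continuous_on_compose2[OF stem_continuous_nth[OF F] continuous_on_slice_coords])
         (use slice_coords_mem[OF D] in auto)
    then have tF: "((\<lambda>x. F (slice_coords x) $ K) \<longlongrightarrow> F (slice_coords x) $ K) (at x within circ D)"
      using x by (simp add: continuous_on_def)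
    show "((\<lambda>x. ord_prod (\<lambda>i. slice_unit (x $ i)) K * F (slice_coords x) $ K) \<longlongrightarrow>
       ord_prod (\<lambda>i. slice_unit (x $ i)) K * F (slice_coords x) $ K) (at x within circ D)"
    proof (cases "\<exists>k\<in>K. im_norm (x $ k) = 0")
      case True
      then obtain k where "k \<in> K" "im_norm (x $ k) = 0" by blast
      then have F0: "F (slice_coords x) $ K = 0"
        by (intro stem_function_zero_on_axis[OF F slice_coords_mem[OF D x]]) (auto simp: slice_coords_def slice_coord_def)
      have "((\<lambda>x. norm (F (slice_coords x) $ K)) \<longlongrightarrow> 0) (at x within circ D)"
        using tendsto_norm[OF tF] F0 by simp
      then have "((\<lambda>x. norm (ord_prod (\<lambda>i. slice_unit (x $ i)) K * F (slice_coords x) $ K)) \<longlongrightarrow> 0) (at x within circ D)"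
        by (simp add: norm_mult norm_ord_prod_units slice_unit_imag_units)
      then show ?thesis using F0 by (simp add: tendsto_norm_zero_iff)
    next
      case False
      have "((\<lambda>y. ord_prod (\<lambda>i. slice_unit (y $ i)) L) \<longlongrightarrow> ord_prod (\<lambda>i. slice_unit (x $ i)) L) (at x within circ D)"
        if "L \<subseteq> K" for L
        using that
      proof (induction L rule: finite_min_induct)
        case (insert h L)
        have ne: "im_norm (x $ h) \<noteq> 0" using False insert(3) by auto
        have "((\<lambda>y. slice_unit (y $ h)) \<longlongrightarrow> slice_unit (x $ h)) (at x within circ D)"
        proof -
          have cU: "continuous_on {y. im_norm (y $ h) \<noteq> 0} (\<lambda>y. (y $ h - of_real (qRe (y $ h))) /\<^sub>R im_norm (y $ h))"
            by (intro continuous_intros) auto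
          have "continuous_on {y. im_norm (y $ h) \<noteq> 0} (\<lambda>y. slice_unit (y $ h))"
            by (rule continuous_on_eq[OF cU]) (simp add: slice_unit_def)
          moreover have "open {y::'n qvec. im_norm (y $ h) \<noteq> 0}"
            by (intro open_Collect_neq continuous_intros)
          ultimately have "isCont (\<lambda>y. slice_unit (y $ h)) x"
            using ne by (simp add: continuous_on_eq_continuous_at)
          then show ?thesis
            by (auto simp: isCont_def intro: tendsto_within_subset)
        qed
        then show ?case using insert by (simp add: ord_prod_insert_min tendsto_mult)
      qed (simp add: ord_prod_empty)
      from this[of K] show ?thesis by (intro tendsto_mult tF) simp
    qed
  qed
  then have "continuous_on (circ D) (\<lambda>x. \<Sum>K\<in>UNIV. ord_prod (\<lambda>i. slice_unit (x $ i)) K * F (slice_coords x) $ K)"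
    by (rule continuous_on_sum)
  then show ?thesis
    by (rule continuous_on_eq) (simp add: induced_eq[OF D F])
qed

lemma invariant_off_real:
  assumes "invariant_set D" shows "invariant_set (off_real D H)"
  using assms by (auto simp: invariant_set_def off_real_def conj_at_Re_Im)

lemma circ_off_real_subset: "circ (off_real D H) \<subseteq> circ D"
  by (auto simp: circ_def off_real_def)

lemma circ_subset_closure_off_real:
  fixes D :: "('n::{finite,linorder}) cvec set"
  assumes D: "open D"
  shows "circ D \<subseteq> closure (circ (off_real D H))"
proof
  fix x assume "x \<in> circ D"
  then obtain z J where z: "z \<in> D" "\<And>h. J h \<in> imag_units" "x = slice_point z J"
    by (auto simp: circ_def)
  obtain Z where Z: "\<And>n. Z n \<in> off_real D H" "Z \<longlonglongrightarrow> z"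
    using subset_closure_off_real[OF D, of H] z(1) closure_sequential by (metis subsetD)
  have "(\<lambda>n. slice_point (Z n) J) \<longlonglongrightarrow> slice_point z J"
    unfolding slice_point_def by (intro tendsto_vec_lambda tendsto_intros Z)
  moreover have "slice_point (Z n) J \<in> circ (off_real D H)" for n
    using Z(1) z(2) by (auto simp: circ_def)
  ultimately show "x \<in> closure (circ (off_real D H))"
    unfolding closure_sequential z(3) by (intro exI[of _ "\<lambda>n. slice_point (Z n) J"]) auto
qed

section \<open>The components of a slice regular function\<close>

lemma stem_prod_nth:
  "stem_prod F G z $ T = (\<Sum>K\<in>UNIV. (- 1) ^ card (sym_diff T K \<inter> K) * (F z $ K * G z $ sym_diff T K))"
proof -
  have iff: "sym_diff K H = T \<longleftrightarrow> H = sym_diff T K" for H K :: "'a set" by blast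
  have "stem_prod F G z $ T = (\<Sum>H\<in>UNIV. \<Sum>K\<in>UNIV. if H = sym_diff T K then (- 1) ^ card (H \<inter> K) * (F z $ K * G z $ H) else 0)"
    unfolding stem_prod_def sum_component by (intro sum.cong refl) (auto simp: axis_def iff)
  also have "\<dots> = (\<Sum>K\<in>UNIV. \<Sum>H\<in>UNIV. if H = sym_diff T K then (- 1) ^ card (H \<inter> K) * (F z $ K * G z $ H) else 0)"
    by (rule sum.swap)
  finally show ?thesis by (simp add: sum.delta)
qed

lemma stem_function_stem_prod:
  fixes D :: "('n::finite) cvec set"
  assumes F: "stem_function D F" and G: "stem_function D G"
  shows "stem_function D (stem_prod F G)"
proof (rule stem_functionI)
  show "continuous_on D (\<lambda>z. stem_prod F G z $ K)" for K
    unfolding stem_prod_nth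
    by (intro continuous_intros stem_continuous_nth[OF F] stem_continuous_nth[OF G])
  fix z h and T :: "'n set" assume z: "z \<in> D"
  have "F (conj_at h z) $ K * G (conj_at h z) $ sym_diff T K
    = (if h \<in> T then - (F z $ K * G z $ sym_diff T K) else F z $ K * G z $ sym_diff T K)" for K
    unfolding stem_conj[OF F z] stem_conj[OF G z] by auto
  then show "stem_prod F G (conj_at h z) $ T = (if h \<in> T then - (stem_prod F G z $ T) else stem_prod F G z $ T)"
    unfolding stem_prod_nth by (simp add: sum_negf)
qed

text \<open>
  The stem function of \<open>x\<^sub>K\<close>, obtained by expanding the product of the \<open>\<alpha>\<^sub>k + e\<^sub>k \<beta>\<^sub>k\<close>, \<open>k \<in> K\<close>.
\<close>

definition coord_prod_stem :: "'n set \<Rightarrow> ('n::finite) cvec \<Rightarrow> 'n quat_tensor"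
  where "coord_prod_stem K z = (\<chi> L. if L \<subseteq> K then of_real ((\<Prod>k\<in>K - L. Re (z $ k)) * (\<Prod>k\<in>L. Im (z $ k))) else 0)"

lemma stem_function_coord_prod_stem: "stem_function (D :: ('n::finite) cvec set) (coord_prod_stem K)"
proof (rule stem_functionI)
  fix L :: "'n set"
  show "continuous_on D (\<lambda>z. coord_prod_stem K z $ L)"
    by (cases "L \<subseteq> K") (auto simp: coord_prod_stem_def intro!: continuous_intros)
  fix z :: "'n cvec" and h
  have "(\<Prod>k\<in>L. Im (conj_at h z $ k)) = (if h \<in> L then - (\<Prod>k\<in>L. Im (z $ k)) else (\<Prod>k\<in>L. Im (z $ k)))"
  proof (cases "h \<in> L")
    case True
    have "(\<Prod>k\<in>L - {h}. Im (conj_at h z $ k)) = (\<Prod>k\<in>L - {h}. Im (z $ k))"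
      by (rule prod.cong) (auto simp: conj_at_Re_Im)
    then show ?thesis using True by (simp add: prod.remove[of L h] conj_at_Re_Im)
  next
    case False
    then show ?thesis by (auto intro!: prod.cong simp: conj_at_Re_Im)
  qed
  then show "coord_prod_stem K (conj_at h z) $ L = (if h \<in> L then - (coord_prod_stem K z $ L) else coord_prod_stem K z $ L)"
    by (auto simp: coord_prod_stem_def conj_at_Re_Im)
qed

lemma ord_prod_slice_point:
  fixes K :: "'n::{finite,linorder} set"
  shows "ord_prod (\<lambda>k. of_real (Re (z $ k)) + J k * of_real (Im (z $ k))) K = (\<Sum>L\<in>UNIV. ord_prod J L * coord_prod_stem K z $ L)"
proof -
  have c: "J k * of_real c = c *\<^sub>R J k" for k c by (simp add: of_real_def)
  have "ord_prod (\<lambda>k. of_real (Re (z $ k)) + Im (z $ k) *\<^sub>R J k) K = (\<Sum>L\<in>Pow K. ord_prod J L * coord_prod_stem K z $ L)"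
    unfolding ord_prod_add_real ord_prod_scaleR
    by (rule sum.cong) (auto simp: coord_prod_stem_def of_real_def)
  also have "\<dots> = (\<Sum>L\<in>UNIV. ord_prod J L * coord_prod_stem K z $ L)"
    by (rule sum.mono_neutral_left) (auto simp: coord_prod_stem_def)
  finally show ?thesis unfolding c .
qed

lemma induces_coord_prod:
  fixes D :: "('n::{finite,linorder}) cvec set"
  assumes D: "invariant_set D"
  shows "induces D (coord_prod_stem K) (coord_prod D K)"
  unfolding induces_def
proof
  fix x assume x: "x \<in> circ D"
  have "coord_prod D K x = ord_prod (\<lambda>k. x $ k) K"
    unfolding coord_prod_def using coord_eq[OF D x] by simp
  also have "\<dots> = ord_prod (\<lambda>k. of_real (Re (slice_coords x $ k)) + slice_unit (x $ k) * of_real (Im (slice_coords x $ k))) K"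
    by (simp add: slice_coords_def slice_unit_coord)
  also have "\<dots> = induced D (coord_prod_stem K) x"
    unfolding ord_prod_slice_point induced_eq[OF D stem_function_coord_prod_stem x] ..
  finally show "coord_prod D K x = induced D (coord_prod_stem K) x" .
qed

definition coord_prod_coeff :: "'n set \<Rightarrow> 'n set \<Rightarrow> ('n::finite) cvec \<Rightarrow> real"
  where "coord_prod_coeff K L z = (\<Prod>k\<in>K - L. Re (z $ k)) * (\<Prod>k\<in>L. Im (z $ k))"

lemma stem_prod_coord_prod_stem_nth:
  assumes "K \<subseteq> T"
  shows "stem_prod (coord_prod_stem K) F z $ T = (\<Sum>L\<in>Pow K. coord_prod_coeff K L z *\<^sub>R F z $ (T - L))"
proof -
  have "stem_prod (coord_prod_stem K) F z $ T
    = (\<Sum>L\<in>Pow K. (- 1) ^ card (sym_diff T L \<inter> L) * (coord_prod_stem K z $ L * F z $ sym_diff T L))"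
    unfolding stem_prod_nth by (rule sum.mono_neutral_right) (auto simp: coord_prod_stem_def)
  also have "\<dots> = (\<Sum>L\<in>Pow K. coord_prod_coeff K L z *\<^sub>R F z $ (T - L))"
  proof (rule sum.cong)
    fix L assume L: "L \<in> Pow K"
    then have "sym_diff T L = T - L" "sym_diff T L \<inter> L = {}" using assms by auto
    then show "(- 1) ^ card (sym_diff T L \<inter> L) * (coord_prod_stem K z $ L * F z $ sym_diff T L) = coord_prod_coeff K L z *\<^sub>R F z $ (T - L)"
      using L by (simp add: coord_prod_stem_def coord_prod_coeff_def of_real_def)
  qed simp
  finally show ?thesis .
qed

text \<open>
  Multiplication by one coordinate after the other keeps the function holomorphic.  On the
  coordinates \<open>T \<supseteq> K\<close>, the only ones that enter a component, the result coincides with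
  \<open>stem_prod_coord_prod_stem_nth\<close>.
\<close>

lemma regular_in_mult_coords:
  fixes D :: "('n::finite) cvec set"
  assumes F: "regular_in D A F"
  shows "\<exists>P. regular_in D A P \<and> (\<forall>z T. K \<subseteq> T \<longrightarrow> P z $ T = (\<Sum>L\<in>Pow K. coord_prod_coeff K L z *\<^sub>R F z $ (T - L)))"
proof -
  have "finite K" by simp
  then show ?thesis
  proof (induction K)
    case empty
    then show ?case using F by (auto simp: coord_prod_coeff_def)
  next
    case (insert j K)
    then obtain P where P: "regular_in D A P" "\<And>z T. K \<subseteq> T \<Longrightarrow> P z $ T = (\<Sum>L\<in>Pow K. coord_prod_coeff K L z *\<^sub>R F z $ (T - L))" by auto
    have "coord_mult j P z $ T = (\<Sum>L\<in>Pow (insert j K). coord_prod_coeff (insert j K) L z *\<^sub>R F z $ (T - L))"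
      if T: "insert j K \<subseteq> T" for z T
    proof -
      have inj: "inj_on (insert j) (Pow K)" using insert(2) by (auto simp: inj_on_def insert_ident)
      have disj: "Pow K \<inter> insert j ` Pow K = {}" using insert(2) by auto
      have "(\<Sum>L\<in>Pow (insert j K). coord_prod_coeff (insert j K) L z *\<^sub>R F z $ (T - L))
        = (\<Sum>L\<in>Pow K. coord_prod_coeff (insert j K) L z *\<^sub>R F z $ (T - L))
        + (\<Sum>L\<in>Pow K. coord_prod_coeff (insert j K) (insert j L) z *\<^sub>R F z $ (T - insert j L))"
        unfolding Pow_insert by (subst sum.union_disjoint) (auto simp: disj sum.reindex[OF inj])
      also have "(\<Sum>L\<in>Pow K. coord_prod_coeff (insert j K) L z *\<^sub>R F z $ (T - L)) = Re (z $ j) *\<^sub>R P z $ T"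
      proof -
        have "coord_prod_coeff (insert j K) L z = Re (z $ j) * coord_prod_coeff K L z" if "L \<in> Pow K" for L
        proof -
          have "insert j K - L = insert j (K - L)" "j \<notin> K - L" using that insert(2) by auto
          then show ?thesis by (simp add: coord_prod_coeff_def)
        qed
        then show ?thesis using P(2)[of T z] T by (simp add: scaleR_sum_right)
      qed
      also have "(\<Sum>L\<in>Pow K. coord_prod_coeff (insert j K) (insert j L) z *\<^sub>R F z $ (T - insert j L)) = Im (z $ j) *\<^sub>R P z $ (T - {j})"
      proof -
        have c: "coord_prod_coeff (insert j K) (insert j L) z = Im (z $ j) * coord_prod_coeff K L z" if "L \<in> Pow K" for L
        proof -
          have "insert j K - insert j L = K - L" "j \<notin> L" using that insert(2) by auto
          then show ?thesis by (simp add: coord_prod_coeff_def)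
        qed
        have d: "T - insert j L = T - {j} - L" for L by auto
        have "K \<subseteq> T - {j}" using T insert(2) by auto
        moreover have "coord_prod_coeff (insert j K) (insert j L) z *\<^sub>R F z $ (T - insert j L)
           = Im (z $ j) *\<^sub>R (coord_prod_coeff K L z *\<^sub>R F z $ (T - {j} - L))" if "L \<in> Pow K" for L
          unfolding c[OF that] d[of L] by simp
        ultimately show ?thesis using P(2)[of "T - {j}" z] by (simp only: scaleR_sum_right cong: sum.cong)
      qed
      finally show ?thesis using T by (simp add: coord_mult_nth)
    qed
    then show ?case using regular_in_coord_mult[OF P(1), of j] by blast
  qed
qed

lemma induced_cong:
  assumes "\<And>z. z \<in> D \<Longrightarrow> F z = G z"
  shows "induced D F x = induced D G x"
proof -
  have "(\<exists>z\<in>D. \<exists>J. (\<forall>h. J h \<in> imag_units) \<and> x = slice_point z J \<and> y = (\<Sum>K\<in>UNIV. ord_prod J K * F z $ K))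
    \<longleftrightarrow> (\<exists>z\<in>D. \<exists>J. (\<forall>h. J h \<in> imag_units) \<and> x = slice_point z J \<and> y = (\<Sum>K\<in>UNIV. ord_prod J K * G z $ K))" for y
    using assms by (intro bex_cong) auto
  then show ?thesis by (simp only: induced_def)
qed

text \<open>
  All that is used about a component: it is a slice function on all of \<open>circ D\<close>, with an
  explicit stem function off the real axes, which in each variable \<open>z\<^sub>j\<close>, \<open>j \<in> M\<close>, is the quotient by
  \<open>\<beta>\<^sub>j\<close> of a function holomorphic in \<open>z\<^sub>j\<close>.  The continuous extension that defines the component
  is this slice function because \<open>circ (off_real D M)\<close> is dense in \<open>circ D\<close>.
\<close>

lemma slice_component_stem:
  fixes D :: "('n::{finite,linorder}) cvec set"
  assumes D: "open D" "invariant_set D" and F: "holomorphic_stem D F" "induces D F f" and KM: "K \<subseteq> M"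
  shows "\<exists>G. stem_function D G \<and>
    (\<forall>z\<in>off_real D M. \<forall>T. G z $ T = (if T \<inter> M = {} then inverse (\<Prod>h\<in>M. Im (z $ h)) *\<^sub>R
        (\<Sum>L\<in>Pow K. coord_prod_coeff K L z *\<^sub>R F z $ ((T \<union> M) - L)) else 0)) \<and>
    (\<forall>j\<in>M. \<exists>G1. regular_in D {j} G1 \<and> (\<forall>z\<in>off_real D {j}. G z = spherical_stem {j} G1 z)) \<and>
    (\<forall>x\<in>circ D. slice_component D M K f x = induced D G x)"
proof -
  have stF: "stem_function D F" using F(1) by (simp add: holomorphic_stem_def)
  obtain P where P: "regular_in D UNIV P"
    "\<And>z T. K \<subseteq> T \<Longrightarrow> P z $ T = (\<Sum>L\<in>Pow K. coord_prod_coeff K L z *\<^sub>R F z $ (T - L))"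
    using regular_in_mult_coords[OF holomorphic_stem_regular_in[OF D(1) F(1)], of K] by blast
  have PM: "regular_in D M P" using P(1) by (rule regular_in_subset) simp
  obtain G where G: "regular_in D (M - M) G" "\<And>z. z \<in> off_real D M \<Longrightarrow> G z = spherical_stem M P z"
    using regular_in_divide_all[OF D PM, of M] by auto
  have stG: "stem_function D G" by (rule regular_in_stem[OF G(1)])
  have cG: "continuous_on D G" using stG by (simp add: stem_function_def)
  have Gn: "G z $ T = (if T \<inter> M = {} then inverse (\<Prod>h\<in>M. Im (z $ h)) *\<^sub>R
        (\<Sum>L\<in>Pow K. coord_prod_coeff K L z *\<^sub>R F z $ ((T \<union> M) - L)) else 0)" if "z \<in> off_real D M" for z T
    unfolding G(2)[OF that] spherical_stem_nth using P(2)[of "T \<union> M" z] KM by (auto simp: le_supI2)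
  define X where "X = stem_of D (coord_prod D K)"
  define Y where "Y = stem_of D f"
  define Q where "Q = stem_of D (slice_prod D (coord_prod D K) f)"
  note X = stem_of_eq[OF D(2) stem_function_coord_prod_stem induces_coord_prod[OF D(2), of K], folded X_def]
  note Y = stem_of_eq[OF D(2) stF F(2), folded Y_def]
  have "induces D (stem_prod X Y) (slice_prod D (coord_prod D K) f)"
    by (simp add: induces_def slice_prod_def X_def Y_def)
  note Q = stem_of_eq[OF D(2) stem_function_stem_prod[OF X(1) Y(1)] this, folded Q_def]
  have QP: "Q z $ T = P z $ T" if "z \<in> D" "K \<subseteq> T" for z T
  proof -
    have "Q z $ T = stem_prod X Y z $ T" using Q(2)[OF that(1)] by simp
    also have "\<dots> = stem_prod (coord_prod_stem K) F z $ T"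
      by (simp add: stem_prod_nth X(2)[OF that(1)] Y(2)[OF that(1)])
    also have "\<dots> = P z $ T"
      unfolding stem_prod_coord_prod_stem_nth[OF that(2)] P(2)[OF that(2)] ..
    finally show ?thesis .
  qed
  let ?S = "off_real D M"
  have invS: "invariant_set ?S" by (rule invariant_off_real[OF D(2)])
  have SD: "?S \<subseteq> D" by (auto simp: off_real_def)
  have "spherical_stem M Q z = G z" if z: "z \<in> ?S" for z
    unfolding G(2)[OF z] vec_eq_iff spherical_stem_nth using QP[of z] z SD KM by (auto simp: le_supI2)
  then have comp: "component_off_real D M K f x = induced ?S G x" for x
    unfolding component_off_real_def spherical_derivative_def Q_def[symmetric] by (rule induced_cong)
  have stGS: "stem_function ?S G"
    using stG SD unfolding stem_function_def by (auto intro: continuous_on_subset)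
  have compD: "component_off_real D M K f x = induced D G x" if x: "x \<in> circ ?S" for x
    unfolding comp using induced_eq[OF invS stGS x] induced_eq[OF D(2) stG] x circ_off_real_subset[of D M] by (simp add: subset_iff)
  have cI: "continuous_on (circ D) (induced D G)" by (rule continuous_on_induced[OF D(2) stG])
  have "continuous_on (circ D) (slice_component D M K f) \<and> (\<forall>x\<in>circ ?S. slice_component D M K f x = component_off_real D M K f x)"
    unfolding slice_component_def
    by (rule someI[of _ "induced D G"]) (use cI compD in auto)
  then have sc: "continuous_on (circ D) (slice_component D M K f)"
    "\<And>x. x \<in> circ ?S \<Longrightarrow> slice_component D M K f x = induced D G x"
    using compD by auto
  show ?thesis
  proof (rule exI[of _ G], intro conjI ballI allI)
    show "stem_function D G" by (rule stG)
    show "G z $ T = (if T \<inter> M = {} then inverse (\<Prod>h\<in>M. Im (z $ h)) *\<^sub>R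
        (\<Sum>L\<in>Pow K. coord_prod_coeff K L z *\<^sub>R F z $ ((T \<union> M) - L)) else 0)" if "z \<in> ?S" for z T
      by (rule Gn[OF that])
    show "\<exists>G1. regular_in D {j} G1 \<and> (\<forall>z\<in>off_real D {j}. G z = spherical_stem {j} G1 z)" if "j \<in> M" for j
      by (rule divided_stem_regular_in_each[OF D PM that cG G(2)])
    show "slice_component D M K f x = induced D G x" if "x \<in> circ D" for x
      by (rule continuous_eq_on_dense[OF sc(1) cI circ_off_real_subset circ_subset_closure_off_real[OF D(1)] sc(2) that])
  qed
qed

definition qreplace_at :: "('n::finite) qvec \<Rightarrow> 'n \<Rightarrow> quat \<Rightarrow> 'n qvec"
  where "qreplace_at y j q = (\<chi> i. if i = j then q else y $ i)"

lemma qreplace_at_nth: "qreplace_at y j q $ i = (if i = j then q else y $ i)"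
  by (simp add: qreplace_at_def)

lemma inner_quat_mult_left: "inner (p * v) b = inner v (qcnj p * b)"
  by (simp add: inner_quat_def qcnj_def algebra_simps)

text \<open>
  When \<open>y\<^sub>j\<close> varies off the real axis, the units of the other coordinates and the products \<open>J\<^sub>T\<close>
  with \<open>j \<notin> T\<close> are fixed, and the coordinates \<open>T\<close> of \<open>G\<close> with \<open>j \<in> T\<close> vanish.  Hence each real coordinate of the
  slice function is the spherical value of a sum of functions \<open>stem_pair G1 j T\<close>; moving \<open>J\<^sub>T\<close>
  across the inner product accounts for its action from the left.
\<close>

lemma poisson_formula_in_variable:
  fixes D :: "('n::{finite,linorder}) cvec set"
  assumes D: "open D" "invariant_set D" and G: "stem_function D G"
    and G1: "regular_in D {j} G1" "\<And>z. z \<in> off_real D {j} \<Longrightarrow> G z = spherical_stem {j} G1 z"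
    and r: "r \<ge> 0" and sub: "\<And>q. q \<in> cball c r \<Longrightarrow> qreplace_at y j q \<in> circ D"
    and x: "x \<in> ball 0 1"
  shows "induced D G (qreplace_at y j (c + r *\<^sub>R x)) = poisson_integral (\<lambda>\<xi>. induced D G (qreplace_at y j (c + r *\<^sub>R \<xi>))) x"
proof (rule poisson_formula_spherical[where g="\<lambda>q. induced D G (qreplace_at y j q)", OF r _ _ x])
  have cont: "continuous_on S (qreplace_at y j)" for S
    unfolding qreplace_at_def[abs_def]
  proof (rule continuous_on_vec_lambda)
    fix i show "continuous_on S (\<lambda>q. if i = j then q else y $ i)" by (cases "i = j") (auto intro!: continuous_intros)
  qed
  show "continuous_on (cball c r) (\<lambda>q. induced D G (qreplace_at y j q))"
    by (rule continuous_on_compose2[OF continuous_on_induced[OF D(2) G] cont]) (use sub in auto)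
  fix b :: quat
  define J where "J = (\<lambda>i. slice_unit (y $ i))"
  define zy where "zy = slice_coords y"
  define U where "U = {w. replace_at zy j w \<in> D}"
  \<comment> \<open>\<open>zy\<close> supplies the other coordinates; its coordinate \<open>j\<close> is overwritten by \<open>w\<close>.\<close>
  define \<phi> where "\<phi> = (\<lambda>w. \<Sum>T\<in>{T. j \<notin> T}. stem_pair G1 j T (qcnj (ord_prod J T) * b) (replace_at zy j w))"
  have "\<phi> holomorphic_on U"
    unfolding \<phi>_def
  proof (rule holomorphic_on_sum)
    fix T assume "T \<in> {T. j \<notin> T}"
    then show "(\<lambda>w. stem_pair G1 j T (qcnj (ord_prod J T) * b) (replace_at zy j w)) holomorphic_on U"
      using G1(1) unfolding regular_in_def U_def by blast
  qed
  moreover have "open U" unfolding U_def by (rule open_replace_at_slice[OF D(1)])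
  moreover have "Complex (qRe q) (im_norm q) \<in> U \<and>
     inner (induced D G (qreplace_at y j q)) b = Im (\<phi> (Complex (qRe q) (im_norm q))) / im_norm q"
    if q: "q \<in> cball c r" "im_norm q > 0" for q
  proof -
    define x where "x = qreplace_at y j q"
    define w where "w = Complex (qRe q) (im_norm q)"
    have xD: "x \<in> circ D" using sub[OF q(1)] by (simp add: x_def)
    have zx: "slice_coords x = replace_at zy j w"
      by (simp add: vec_eq_iff slice_coords_def x_def qreplace_at_nth replace_at_nth zy_def w_def slice_coord_def)
    have zD: "replace_at zy j w \<in> D" using slice_coords_mem[OF D(2) xD] zx by simp
    have zo: "replace_at zy j w \<in> off_real D {j}" using zD q(2) by (simp add: off_real_def replace_at_nth w_def)
    have "induced D G x = (\<Sum>T\<in>UNIV. ord_prod (\<lambda>i. slice_unit (x $ i)) T * G (replace_at zy j w) $ T)"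
      using induced_eq[OF D(2) G xD] zx by simp
    also have "\<dots> = (\<Sum>T\<in>{T. j \<notin> T}. ord_prod (\<lambda>i. slice_unit (x $ i)) T * G (replace_at zy j w) $ T)"
      by (rule sum.mono_neutral_right) (auto simp: G1(2)[OF zo] spherical_stem_nth)
    also have "\<dots> = (\<Sum>T\<in>{T. j \<notin> T}. inverse (im_norm q) *\<^sub>R (ord_prod J T * G1 (replace_at zy j w) $ insert j T))"
    proof (rule sum.cong)
      fix T assume T: "T \<in> {T. j \<notin> T}"
      have "ord_prod (\<lambda>i. slice_unit (x $ i)) T = ord_prod J T"
        by (rule ord_prod_cong) (use T in \<open>auto simp: x_def qreplace_at_nth J_def\<close>)
      moreover have "G (replace_at zy j w) $ T = inverse (im_norm q) *\<^sub>R G1 (replace_at zy j w) $ insert j T"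
        using T by (simp only: G1(2)[OF zo] spherical_stem_nth) (simp add: replace_at_nth w_def)
      ultimately show "ord_prod (\<lambda>i. slice_unit (x $ i)) T * G (replace_at zy j w) $ T = inverse (im_norm q) *\<^sub>R (ord_prod J T * G1 (replace_at zy j w) $ insert j T)"
        by simp
    qed simp
    finally have "inner (induced D G x) b = (\<Sum>T\<in>{T. j \<notin> T}. inverse (im_norm q) * inner (ord_prod J T * G1 (replace_at zy j w) $ insert j T) b)"
      by (simp add: inner_sum_left)
    also have "\<dots> = Im (\<phi> w) / im_norm q"
      unfolding inner_quat_mult_left by (simp add: \<phi>_def stem_pair_def sum_distrib_left[symmetric] divide_inverse mult.commute)
    finally show ?thesis using zD by (simp add: x_def w_def U_def)
  qed
  ultimately show "\<exists>\<phi> U. open U \<and> \<phi> holomorphic_on U \<and>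
      (\<forall>q\<in>cball c r. im_norm q > 0 \<longrightarrow> Complex (qRe q) (im_norm q) \<in> U \<and>
         inner (induced D G (qreplace_at y j q)) b = Im (\<phi> (Complex (qRe q) (im_norm q))) / im_norm q)"
    by blast
qed

section \<open>Recovering a slice regular function from its components\<close>

lemma sum_Pow_complement:
  fixes M :: "'a::finite set" and f :: "'a set \<Rightarrow> 'b::comm_monoid_add"
  assumes "N \<subseteq> M"
  shows "(\<Sum>L\<in>Pow (M - N). f L) = (\<Sum>A\<in>{A \<in> Pow M. N \<subseteq> A}. f (M - A))"
  by (rule sum.reindex_bij_witness[of _ "\<lambda>A. M - A" "\<lambda>L. M - L"]) (use assms in \<open>auto simp: Diff_Diff_Int Int_absorb1 subset_iff intro!: arg_cong[of _ _ f]\<close>)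

lemma sum_Pow_split:
  fixes M :: "'a::finite set" and f :: "'a set \<Rightarrow> 'b::comm_monoid_add"
  shows "(\<Sum>S\<in>UNIV. f S) = (\<Sum>A\<in>Pow M. \<Sum>T\<in>Pow (- M). f (A \<union> T))"
proof -
  have "(\<Sum>A\<in>Pow M. \<Sum>T\<in>Pow (- M). f (A \<union> T)) = (\<Sum>(A, T)\<in>Pow M \<times> Pow (- M). f (A \<union> T))"
    by (rule sum.cartesian_product)
  also have "\<dots> = (\<Sum>S\<in>UNIV. f S)"
    by (rule sum.reindex_bij_witness[of _ "\<lambda>S. (S \<inter> M, S - M)" "\<lambda>(A, T). A \<union> T"]) (auto simp: Un_Diff_Int Un_commute)
  finally show ?thesis ..
qed

lemma qcnj_slice:
  assumes "J \<in> imag_units"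
  shows "of_real \<alpha> - qcnj (of_real \<alpha> + J * of_real \<beta>) = \<beta> *\<^sub>R J"
  using imag_unitsD(1)[OF assms] by (simp add: quat_eq_iff qcnj_def)

text \<open>
  With \<open>E A = \<Sum>T. J\<^sub>T F\<^bsub>A \<union> T\<^esub>\<close>, the sum over \<open>T\<close> disjoint from \<open>M\<close>, one has \<open>f = \<Sum>A. J\<^sub>A E A\<close>, because the
  indices in \<open>M = {..m}\<close> precede the others, and the component \<open>K\<close> is a sum over \<open>L \<subseteq> K\<close> of
  \<open>\<alpha>\<^bsub>K - L\<^esub> \<beta>\<^bsub>M - L\<^esub>\<^sup>-\<^sup>1 E (M - L)\<close>.  Pass to \<open>N = M - K\<close> and \<open>A = M - L\<close> and exchange the sums.  Then \<open>E A\<close> has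
  the coefficient \<open>\<beta>\<^sub>A\<^sup>-\<^sup>1\<close> times the expansion over \<open>N \<subseteq> A\<close> of the ordered product of the
  \<open>\<alpha>\<^sub>k - cnj x\<^sub>k = J\<^sub>k \<beta>\<^sub>k\<close>, \<open>k \<in> A\<close>, that is, \<open>J\<^sub>A\<close>.
\<close>

lemma slice_component_expansion_off_real:
  fixes D :: "('n::{finite,linorder}) cvec set" and m :: 'n
  assumes D: "open D" "invariant_set D" and F: "holomorphic_stem D F" "induces D F f"
    and x: "x \<in> circ (off_real D {..m})"
  shows "f x = (\<Sum>K\<in>Pow {..m}. (- 1) ^ card ({..m} - K) * ord_prod (\<lambda>k. qcnj (x $ k)) ({..m} - K) * slice_component D {..m} K f x)"
proof -
  define M where "M = {..m}"
  define z where "z = slice_coords x"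
  define J where "J = (\<lambda>i. slice_unit (x $ i))"
  have stF: "stem_function D F" using F(1) by (simp add: holomorphic_stem_def)
  have xD: "x \<in> circ D" using x circ_off_real_subset by blast
  have zo: "z \<in> off_real D M"
    using slice_coords_mem[OF invariant_off_real[OF D(2)] x] by (simp add: z_def M_def)
  have nz: "Im (z $ h) \<noteq> 0" if "h \<in> M" for h using zo that by (simp add: off_real_def)
  have xJ: "x $ k = of_real (Re (z $ k)) + J k * of_real (Im (z $ k))" for k
    by (simp add: z_def J_def slice_coords_def slice_unit_coord)
  have J: "J k \<in> imag_units" for k by (simp add: J_def slice_unit_imag_units)
  define \<beta> where "\<beta> = (\<lambda>A. \<Prod>k\<in>A. Im (z $ k))"
  define E where "E = (\<lambda>A. \<Sum>T\<in>Pow (- M). ord_prod J T * F z $ (A \<union> T))"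
  have \<beta>0: "\<beta> A \<noteq> 0" if "A \<subseteq> M" for A using that nz by (auto simp: \<beta>_def)
  have \<beta>M: "inverse (\<beta> M) * \<beta> (M - A) = inverse (\<beta> A)" if "A \<subseteq> M" for A
  proof -
    have "\<beta> M = \<beta> A * \<beta> (M - A)"
      unfolding \<beta>_def using that by (subst prod.union_disjoint[symmetric]) (auto intro: prod.cong)
    then show ?thesis using \<beta>0[OF that] \<beta>0[of "M - A"] by (simp add: field_simps)
  qed
  have fx: "f x = (\<Sum>A\<in>Pow M. ord_prod J A * E A)"
  proof -
    have "f x = (\<Sum>S\<in>UNIV. ord_prod J S * F z $ S)"
      using F(2) induced_eq[OF D(2) stF xD] xD by (simp add: induces_def J_def z_def)
    also have "\<dots> = (\<Sum>A\<in>Pow M. \<Sum>T\<in>Pow (- M). ord_prod J (A \<union> T) * F z $ (A \<union> T))"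
      by (rule sum_Pow_split)
    also have "\<dots> = (\<Sum>A\<in>Pow M. ord_prod J A * E A)"
    proof (rule sum.cong)
      fix A assume A: "A \<in> Pow M"
      have "ord_prod J (A \<union> T) = ord_prod J A * ord_prod J T" if "T \<in> Pow (- M)" for T
        by (rule ord_prod_append) (use A that in \<open>fastforce simp: M_def\<close>)
      then show "(\<Sum>T\<in>Pow (- M). ord_prod J (A \<union> T) * F z $ (A \<union> T)) = ord_prod J A * E A"
        by (simp add: E_def sum_distrib_left mult.assoc)
    qed simp
    finally show ?thesis .
  qed
  have comp: "slice_component D M K f x = inverse (\<beta> M) *\<^sub>R (\<Sum>L\<in>Pow K. coord_prod_coeff K L z *\<^sub>R E (M - L))"
    if K: "K \<subseteq> M" for K
  proof -
    obtain G where G: "stem_function D G"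
      "\<And>z T. z \<in> off_real D M \<Longrightarrow> G z $ T = (if T \<inter> M = {} then inverse (\<Prod>h\<in>M. Im (z $ h)) *\<^sub>R
        (\<Sum>L\<in>Pow K. coord_prod_coeff K L z *\<^sub>R F z $ ((T \<union> M) - L)) else 0)"
      "\<And>x. x \<in> circ D \<Longrightarrow> slice_component D M K f x = induced D G x"
      using slice_component_stem[OF D F K] by blast
    have "slice_component D M K f x = (\<Sum>T\<in>UNIV. ord_prod J T * G z $ T)"
      unfolding G(3)[OF xD] induced_eq[OF D(2) G(1) xD] J_def z_def ..
    also have "\<dots> = (\<Sum>T\<in>Pow (- M). ord_prod J T * (inverse (\<beta> M) *\<^sub>R (\<Sum>L\<in>Pow K. coord_prod_coeff K L z *\<^sub>R F z $ ((T \<union> M) - L))))"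
      by (rule sum.mono_neutral_cong_right) (auto simp: G(2)[OF zo] \<beta>_def)
    also have "\<dots> = (\<Sum>T\<in>Pow (- M). \<Sum>L\<in>Pow K. inverse (\<beta> M) *\<^sub>R (coord_prod_coeff K L z *\<^sub>R (ord_prod J T * F z $ ((M - L) \<union> T))))"
    proof (rule sum.cong)
      fix T assume T: "T \<in> Pow (- M)"
      have "(T \<union> M) - L = (M - L) \<union> T" if "L \<in> Pow K" for L using T that K by auto
      then have "(\<Sum>L\<in>Pow K. coord_prod_coeff K L z *\<^sub>R F z $ ((T \<union> M) - L)) = (\<Sum>L\<in>Pow K. coord_prod_coeff K L z *\<^sub>R F z $ ((M - L) \<union> T))"
        by (intro sum.cong) auto
      then show "ord_prod J T * (inverse (\<beta> M) *\<^sub>R (\<Sum>L\<in>Pow K. coord_prod_coeff K L z *\<^sub>R F z $ ((T \<union> M) - L)))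
         = (\<Sum>L\<in>Pow K. inverse (\<beta> M) *\<^sub>R (coord_prod_coeff K L z *\<^sub>R (ord_prod J T * F z $ ((M - L) \<union> T))))"
        by (simp only: mult_scaleR_right sum_distrib_left scaleR_sum_right)
    qed simp
    also have "\<dots> = (\<Sum>L\<in>Pow K. \<Sum>T\<in>Pow (- M). inverse (\<beta> M) *\<^sub>R (coord_prod_coeff K L z *\<^sub>R (ord_prod J T * F z $ ((M - L) \<union> T))))"
      by (rule sum.swap)
    also have "\<dots> = inverse (\<beta> M) *\<^sub>R (\<Sum>L\<in>Pow K. coord_prod_coeff K L z *\<^sub>R E (M - L))"
      by (simp only: E_def scaleR_sum_right)
    finally show ?thesis .
  qed
  define X where "X = (\<lambda>N. (- 1) ^ card N * ord_prod (\<lambda>k. qcnj (x $ k)) N)"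
  \<comment> \<open>The signs are absorbed into the factors, so that the \<open>\<alpha>\<^sub>k - qcnj (x $ k)\<close> appear.\<close>
  have X: "X N = ord_prod (\<lambda>k. - qcnj (x $ k)) N" for N
    using ord_prod_scaleR[of "\<lambda>_. -1" "\<lambda>k. qcnj (x $ k)" N]
    by (cases "even (card N)") (simp_all add: X_def)
  have "(\<Sum>K\<in>Pow M. (- 1) ^ card (M - K) * ord_prod (\<lambda>k. qcnj (x $ k)) (M - K) * slice_component D M K f x)
    = (\<Sum>K\<in>Pow M. X (M - K) * (inverse (\<beta> M) *\<^sub>R (\<Sum>L\<in>Pow K. coord_prod_coeff K L z *\<^sub>R E (M - L))))"
    by (rule sum.cong) (simp_all add: X_def comp)
  also have "\<dots> = (\<Sum>N\<in>Pow M. X N * (inverse (\<beta> M) *\<^sub>R (\<Sum>L\<in>Pow (M - N). coord_prod_coeff (M - N) L z *\<^sub>R E (M - L))))"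
    by (rule sum.reindex_bij_witness[of _ "\<lambda>K. M - K" "\<lambda>K. M - K"]) (auto simp: double_diff)
  also have "\<dots> = (\<Sum>N\<in>Pow M. \<Sum>A\<in>{A \<in> Pow M. N \<subseteq> A}. ((\<Prod>k\<in>A - N. Re (z $ k)) *\<^sub>R X N) * (inverse (\<beta> A) *\<^sub>R E A))"
  proof (rule sum.cong)
    fix N assume N: "N \<in> Pow M"
    have "X N * (inverse (\<beta> M) *\<^sub>R (\<Sum>L\<in>Pow (M - N). coord_prod_coeff (M - N) L z *\<^sub>R E (M - L)))
      = (\<Sum>A\<in>{A \<in> Pow M. N \<subseteq> A}. X N * (inverse (\<beta> M) *\<^sub>R (coord_prod_coeff (M - N) (M - A) z *\<^sub>R E (M - (M - A)))))"
      using N by (subst sum_Pow_complement) (auto simp: scaleR_sum_right sum_distrib_left)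
    also have "\<dots> = (\<Sum>A\<in>{A \<in> Pow M. N \<subseteq> A}. ((\<Prod>k\<in>A - N. Re (z $ k)) *\<^sub>R X N) * (inverse (\<beta> A) *\<^sub>R E A))"
    proof (rule sum.cong)
      fix A assume A: "A \<in> {A \<in> Pow M. N \<subseteq> A}"
      have e: "M - (M - A) = A" "M - N - (M - A) = A - N" using A by auto
      have "inverse (\<beta> M) * coord_prod_coeff (M - N) (M - A) z = (\<Prod>k\<in>A - N. Re (z $ k)) * inverse (\<beta> A)"
        using \<beta>M[of A] A unfolding coord_prod_coeff_def e \<beta>_def[symmetric] by (metis (no_types, lifting) CollectD PowD mult.left_commute)
      then show "X N * (inverse (\<beta> M) *\<^sub>R (coord_prod_coeff (M - N) (M - A) z *\<^sub>R E (M - (M - A))))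
         = ((\<Prod>k\<in>A - N. Re (z $ k)) *\<^sub>R X N) * (inverse (\<beta> A) *\<^sub>R E A)"
        by (simp only: e scaleR_scaleR mult_scaleR_left mult_scaleR_right mult.commute[of "inverse (\<beta> A)"])
    qed simp
    finally show "X N * (inverse (\<beta> M) *\<^sub>R (\<Sum>L\<in>Pow (M - N). coord_prod_coeff (M - N) L z *\<^sub>R E (M - L)))
      = (\<Sum>A\<in>{A \<in> Pow M. N \<subseteq> A}. ((\<Prod>k\<in>A - N. Re (z $ k)) *\<^sub>R X N) * (inverse (\<beta> A) *\<^sub>R E A))" .
  qed simp
  also have "\<dots> = (\<Sum>A\<in>Pow M. \<Sum>N\<in>{N \<in> Pow M. N \<subseteq> A}. ((\<Prod>k\<in>A - N. Re (z $ k)) *\<^sub>R X N) * (inverse (\<beta> A) *\<^sub>R E A))"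
    by (rule sum.swap_restrict) auto
  also have "\<dots> = (\<Sum>A\<in>Pow M. ord_prod J A * E A)"
  proof (rule sum.cong)
    fix A assume A: "A \<in> Pow M"
    have P: "{N \<in> Pow M. N \<subseteq> A} = Pow A" using A by auto
    have "(\<Sum>N\<in>Pow A. (\<Prod>k\<in>A - N. Re (z $ k)) *\<^sub>R X N) = ord_prod (\<lambda>k. of_real (Re (z $ k)) + - qcnj (x $ k)) A"
      unfolding X ord_prod_add_real ..
    also have "\<dots> = ord_prod (\<lambda>k. Im (z $ k) *\<^sub>R J k) A"
      using qcnj_slice[OF J] by (simp add: xJ)
    also have "\<dots> = \<beta> A *\<^sub>R ord_prod J A" unfolding ord_prod_scaleR \<beta>_def ..
    finally have S: "(\<Sum>N\<in>Pow A. (\<Prod>k\<in>A - N. Re (z $ k)) *\<^sub>R X N) = \<beta> A *\<^sub>R ord_prod J A" .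
    show "(\<Sum>N\<in>{N \<in> Pow M. N \<subseteq> A}. ((\<Prod>k\<in>A - N. Re (z $ k)) *\<^sub>R X N) * (inverse (\<beta> A) *\<^sub>R E A)) = ord_prod J A * E A"
      unfolding P sum_distrib_right[symmetric] S using \<beta>0[of A] A by simp
  qed simp
  finally show ?thesis unfolding fx M_def by simp
qed

lemma continuous_on_ord_prod:
  fixes K :: "'n::{finite,linorder} set"
  assumes "\<And>k. continuous_on S (\<lambda>x. q x k)"
  shows "continuous_on S (\<lambda>x. ord_prod (q x) K)"
  by (induction K rule: finite_min_induct)
     (auto simp: ord_prod_empty ord_prod_insert_min intro!: continuous_intros assms)

lemma continuous_on_qcnj: "continuous_on S qcnj"
proof -
  have "qcnj q = 2 *\<^sub>R of_real (qRe q) - q" for q by (simp add: quat_eq_iff qcnj_def)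
  then have eq: "qcnj = (\<lambda>q. 2 *\<^sub>R of_real (qRe q) - q)" by auto
  show ?thesis unfolding eq by (intro continuous_intros)
qed

lemma slice_component_expansion:
  fixes D :: "('n::{finite,linorder}) cvec set" and m :: 'n
  assumes D: "open D" "invariant_set D" and F: "holomorphic_stem D F" "induces D F f"
    and x: "x \<in> circ D"
  shows "f x = (\<Sum>K\<in>Pow {..m}. (- 1) ^ card ({..m} - K) * ord_prod (\<lambda>k. qcnj (x $ k)) ({..m} - K) * slice_component D {..m} K f x)"
proof (rule continuous_eq_on_dense[OF _ _ circ_off_real_subset circ_subset_closure_off_real[OF D(1)] _ x])
  have stF: "stem_function D F" using F(1) by (simp add: holomorphic_stem_def)
  show "continuous_on (circ D) f"
    by (rule continuous_on_eq[OF continuous_on_induced[OF D(2) stF]]) (use F(2) in \<open>simp add: induces_def\<close>)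
  have cS: "continuous_on (circ D) (slice_component D {..m} K f)" if K: "K \<in> Pow {..m}" for K
  proof -
    obtain G where G: "stem_function D G" "\<And>x. x \<in> circ D \<Longrightarrow> slice_component D {..m} K f x = induced D G x"
      using slice_component_stem[OF D F PowD[OF K]] by blast
    show ?thesis
      by (rule continuous_on_eq[OF continuous_on_induced[OF D(2) G(1)]]) (use G(2) in simp)
  qed
  show "continuous_on (circ D) (\<lambda>x. \<Sum>K\<in>Pow {..m}. (- 1) ^ card ({..m} - K) * ord_prod (\<lambda>k. qcnj (x $ k)) ({..m} - K) * slice_component D {..m} K f x)"
    by (intro continuous_on_sum continuous_on_mult continuous_on_const continuous_on_ord_prod cS
        continuous_on_compose2[OF continuous_on_qcnj[of UNIV]] continuous_intros) auto
qed (rule slice_component_expansion_off_real[OF D F])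

section \<open>The Poisson formula in several variables\<close>

lemma finite_measure_PiM_sphere:
  assumes "finite I"
  shows "finite_measure (PiM I (\<lambda>_. sphere_measure))"
proof -
  interpret finite_measure sphere_measure by (rule finite_measure_sphere_measure)
  interpret product_sigma_finite "\<lambda>_. sphere_measure"
    by (simp add: product_sigma_finite_def sigma_finite_measure_axioms)
  have "emeasure (PiM I (\<lambda>_. sphere_measure)) (PiE I (\<lambda>_. space sphere_measure)) = (\<Prod>i\<in>I. emeasure sphere_measure (space sphere_measure))"
    by (rule emeasure_PiM[OF assms]) simp
  then show ?thesis
    by (intro finite_measureI) (simp add: space_PiM emeasure_space_sphere_measure)
qed

definition polyball :: "('n::finite) qvec \<Rightarrow> ('n \<Rightarrow> real) \<Rightarrow> 'n qvec set"
  where "polyball a r = {y. \<forall>i. y $ i \<in> cball (a $ i) (r i)}"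

lemma compact_polyball: "compact (polyball a r)"
proof -
  have "closed (polyball a r)"
  proof -
    have "polyball a r = (\<Inter>i. {y. dist (a $ i) (y $ i) \<le> r i})" by (auto simp: polyball_def)
    then show ?thesis by (simp only:) (intro closed_INT ballI closed_Collect_le continuous_intros)
  qed
  moreover have "bounded (polyball a r)"
    unfolding bounded_iff
  proof (intro exI ballI)
    fix y assume y: "y \<in> polyball a r"
    have "norm y \<le> (\<Sum>i\<in>UNIV. norm (y $ i))" by (simp add: norm_vec_def L2_set_le_sum)
    also have "\<dots> \<le> (\<Sum>i\<in>UNIV. norm (a $ i) + r i)"
    proof (rule sum_mono)
      fix i
      have "norm (y $ i - a $ i) \<le> r i" using y by (simp add: polyball_def dist_norm norm_minus_commute)
      then show "norm (y $ i) \<le> norm (a $ i) + r i"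
        using norm_triangle_sub[of "y $ i" "a $ i"] by linarith
    qed
    finally show "norm y \<le> (\<Sum>i\<in>UNIV. norm (a $ i) + r i)" .
  qed
  ultimately show ?thesis by (simp add: compact_eq_bounded_closed)
qed

text \<open>
  Fubini's theorem, one variable at a time: after integration over the variables in \<open>I\<close> the point
  has coordinates \<open>a\<^sub>i + r\<^sub>i \<xi>\<^sub>i\<close> for \<open>i \<in> I\<close> and still \<open>a\<^sub>i + r\<^sub>i x\<^sub>i\<close> for the other \<open>i \<in> M\<close>; all these points
  lie in the compact polyball, on which \<open>g\<close> is bounded.
\<close>

lemma iterated_poisson_formula:
  fixes g :: "('n::{finite,linorder}) qvec \<Rightarrow> quat"
  assumes r: "\<And>i. r i \<ge> 0" and g: "continuous_on (polyball a r) g"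
    and P: "\<And>j y q. j \<in> M \<Longrightarrow> y \<in> polyball a r \<Longrightarrow> q \<in> ball 0 1 \<Longrightarrow>
        g (qreplace_at y j (a $ j + r j *\<^sub>R q)) = poisson_integral (\<lambda>\<xi>. g (qreplace_at y j (a $ j + r j *\<^sub>R \<xi>))) q"
    and x: "\<And>i. i \<in> M \<Longrightarrow> x i \<in> ball 0 1"
  shows "g (shift_on M a (\<lambda>i. r i *\<^sub>R x i)) = (LINT \<xi>|PiM M (\<lambda>_. sphere_measure).
      (\<Prod>j\<in>M. poisson_kernel (x j) (\<xi> j)) *\<^sub>R g (shift_on M a (\<lambda>i. r i *\<^sub>R \<xi> i)))"
proof -
  interpret finite_measure sphere_measure by (rule finite_measure_sphere_measure)
  interpret product_sigma_finite "\<lambda>_::'n. sphere_measure"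
    by (simp add: product_sigma_finite_def sigma_finite_measure_axioms)
  define sh where "sh = (\<lambda>I \<xi>. shift_on M a (\<lambda>i. r i *\<^sub>R (if i \<in> I then \<xi> i else x i)))"
  define k where "k = (\<lambda>I \<xi>. \<Prod>j\<in>I. poisson_kernel (x j) (\<xi> j))"
  have sh_mem: "sh I \<xi> \<in> polyball a r" if "I \<subseteq> M" "\<And>i. i \<in> I \<Longrightarrow> norm (\<xi> i) = 1" for I \<xi>
    unfolding polyball_def
  proof (intro CollectI allI)
    fix i
    have "norm (if i \<in> I then \<xi> i else x i) \<le> 1" if "i \<in> M"
      using that x[OF that] \<open>\<And>i. i \<in> I \<Longrightarrow> norm (\<xi> i) = 1\<close> by auto
    then show "sh I \<xi> $ i \<in> cball (a $ i) (r i)"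
      using r[of i] by (auto simp: sh_def shift_on_def dist_norm mult_left_le)
  qed
  obtain B where B: "\<And>y. y \<in> polyball a r \<Longrightarrow> norm (g y) \<le> B"
    using compact_imp_bounded[OF compact_continuous_image[OF g compact_polyball]] unfolding bounded_iff by blast
  have "\<exists>C. \<forall>\<xi>\<in>sphere 0 1. norm (poisson_kernel (x j) \<xi>) \<le> C" if "j \<in> M" for j
    using compact_imp_bounded[OF compact_continuous_image[OF continuous_on_poisson_kernel_sphere[OF x[OF that]] compact_sphere]]
    unfolding bounded_iff by blast
  then obtain C where C: "\<And>j \<xi>. j \<in> M \<Longrightarrow> \<xi> \<in> sphere 0 1 \<Longrightarrow> norm (poisson_kernel (x j) \<xi>) \<le> C j" by metis
  have sp: "norm (\<xi> i) = 1" if "\<xi> \<in> space (PiM I (\<lambda>_. sphere_measure))" "i \<in> I" for I \<xi> i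
    using that by (auto simp: space_PiM space_sphere_measure PiE_def Pi_def)
  have int: "integrable (PiM I (\<lambda>_. sphere_measure)) (\<lambda>\<xi>. k I \<xi> *\<^sub>R g (sh I \<xi>))" if I: "I \<subseteq> M" for I
  proof -
    interpret PI: finite_measure "PiM I (\<lambda>_. sphere_measure)" by (rule finite_measure_PiM_sphere) simp
    have id_m: "(\<lambda>\<xi>. \<xi>) \<in> borel_measurable sphere_measure"
      by (rule borel_measurable_sphere_continuous) (rule continuous_on_id)
    have comp_m: "(\<lambda>\<xi>. \<xi> i) \<in> borel_measurable (PiM I (\<lambda>_. sphere_measure))" if "i \<in> I" for i
      using measurable_compose[OF measurable_component_singleton[OF that, of "\<lambda>_. sphere_measure"] id_m] .
    have k_m: "k I \<in> borel_measurable (PiM I (\<lambda>_. sphere_measure))"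
      unfolding k_def
    proof (rule borel_measurable_prod)
      fix j assume j: "j \<in> I"
      then have "poisson_kernel (x j) \<in> borel_measurable sphere_measure"
        using I x by (intro borel_measurable_sphere_continuous continuous_on_poisson_kernel_sphere) auto
      then show "(\<lambda>\<xi>. poisson_kernel (x j) (\<xi> j)) \<in> borel_measurable (PiM I (\<lambda>_. sphere_measure))"
        using measurable_compose[OF measurable_component_singleton[OF j, of "\<lambda>_. sphere_measure"]] by blast
    qed
    have sh_m: "sh I \<in> borel_measurable (PiM I (\<lambda>_. sphere_measure))"
    proof (rule borel_measurable_euclidean_space[THEN iffD2], rule ballI)
      fix e :: "'n qvec" assume "e \<in> Basis"
      then obtain i b where e: "e = axis i b" by (auto simp: Basis_vec_def)
      have "(\<lambda>\<xi>. sh I \<xi> $ i) \<in> borel_measurable (PiM I (\<lambda>_. sphere_measure))"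
        unfolding sh_def shift_on_def
        by (cases "i \<in> M"; cases "i \<in> I")
           (auto intro!: borel_measurable_add borel_measurable_scaleR comp_m)
      then show "(\<lambda>\<xi>. sh I \<xi> \<bullet> e) \<in> borel_measurable (PiM I (\<lambda>_. sphere_measure))"
        unfolding e inner_axis by (intro borel_measurable_inner) auto
    qed
    have "(\<lambda>y. indicator (polyball a r) y *\<^sub>R g y) \<in> borel_measurable borel"
      by (rule borel_measurable_continuous_on_indicator[OF _ g]) (simp add: compact_polyball borel_compact)
    from measurable_compose[OF sh_m this]
    have "(\<lambda>\<xi>. indicator (polyball a r) (sh I \<xi>) *\<^sub>R g (sh I \<xi>)) \<in> borel_measurable (PiM I (\<lambda>_. sphere_measure))" .
    moreover have "indicator (polyball a r) (sh I \<xi>) *\<^sub>R g (sh I \<xi>) = g (sh I \<xi>)" if "\<xi> \<in> space (PiM I (\<lambda>_. sphere_measure))" for \<xi>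
      using sh_mem[OF I sp[OF that]] by simp
    ultimately have g_m: "(\<lambda>\<xi>. g (sh I \<xi>)) \<in> borel_measurable (PiM I (\<lambda>_. sphere_measure))"
      by (simp cong: measurable_cong)
    show ?thesis
    proof (rule PI.integrable_const_bound[of _ "(\<Prod>j\<in>I. C j) * B"])
      show "AE \<xi> in PiM I (\<lambda>_. sphere_measure). norm (k I \<xi> *\<^sub>R g (sh I \<xi>)) \<le> (\<Prod>j\<in>I. C j) * B"
      proof (rule AE_I2)
        fix \<xi> assume \<xi>: "\<xi> \<in> space (PiM I (\<lambda>_. sphere_measure))"
        have "\<bar>k I \<xi>\<bar> \<le> (\<Prod>j\<in>I. C j)"
          unfolding k_def abs_prod using C sp[OF \<xi>] I by (intro prod_mono) auto
        moreover have "norm (g (sh I \<xi>)) \<le> B" by (rule B[OF sh_mem[OF I sp[OF \<xi>]]])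
        ultimately show "norm (k I \<xi> *\<^sub>R g (sh I \<xi>)) \<le> (\<Prod>j\<in>I. C j) * B"
          unfolding norm_scaleR by (intro mult_mono) (auto intro: order_trans[OF abs_ge_zero])
      qed
    qed (intro borel_measurable_scaleR k_m g_m)
  qed
  have main: "g (shift_on M a (\<lambda>i. r i *\<^sub>R x i)) = (LINT \<xi>|PiM I (\<lambda>_. sphere_measure). k I \<xi> *\<^sub>R g (sh I \<xi>))"
    if "I \<subseteq> M" for I
  proof -
    have "finite I" by simp
    then show ?thesis using that
    proof (induction I)
      case empty
      then show ?case by (simp add: PiM_empty lebesgue_integral_count_space_finite k_def sh_def)
    next
      case (insert i I)
      have iM: "i \<in> M" and IM: "I \<subseteq> M" using insert.prems by auto
      have "(LINT \<xi>|PiM (insert i I) (\<lambda>_. sphere_measure). k (insert i I) \<xi> *\<^sub>R g (sh (insert i I) \<xi>))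
        = (LINT \<xi>|PiM I (\<lambda>_. sphere_measure). LINT \<eta>|sphere_measure. k (insert i I) (\<xi>(i := \<eta>)) *\<^sub>R g (sh (insert i I) (\<xi>(i := \<eta>))))"
        by (rule product_integral_insert[OF insert.hyps int[OF insert.prems]])
      also have "\<dots> = (LINT \<xi>|PiM I (\<lambda>_. sphere_measure). k I \<xi> *\<^sub>R g (sh I \<xi>))"
      proof (rule Bochner_Integration.integral_cong[OF refl])
        fix \<xi> assume \<xi>: "\<xi> \<in> space (PiM I (\<lambda>_. sphere_measure))"
        define y where "y = sh I \<xi>"
        have y: "y \<in> polyball a r" unfolding y_def by (rule sh_mem[OF IM sp[OF \<xi>]])
        have kk: "k (insert i I) (\<xi>(i := \<eta>)) = k I \<xi> * poisson_kernel (x i) \<eta>" for \<eta>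
        proof -
          have "(\<Prod>j\<in>I. poisson_kernel (x j) ((\<xi>(i := \<eta>)) j)) = (\<Prod>j\<in>I. poisson_kernel (x j) (\<xi> j))"
            using insert.hyps(2) by (intro prod.cong) auto
          then show ?thesis using insert.hyps by (simp add: k_def mult.commute)
        qed
        have ss: "sh (insert i I) (\<xi>(i := \<eta>)) = qreplace_at y i (a $ i + r i *\<^sub>R \<eta>)" for \<eta>
          using iM by (auto simp: vec_eq_iff sh_def shift_on_def qreplace_at_nth y_def)
        have yy: "qreplace_at y i (a $ i + r i *\<^sub>R x i) = y"
          using iM insert.hyps(2) by (auto simp: vec_eq_iff sh_def shift_on_def qreplace_at_nth y_def)
        have "(LINT \<eta>|sphere_measure. k (insert i I) (\<xi>(i := \<eta>)) *\<^sub>R g (sh (insert i I) (\<xi>(i := \<eta>))))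
          = (LINT \<eta>|sphere_measure. k I \<xi> *\<^sub>R (poisson_kernel (x i) \<eta> *\<^sub>R g (qreplace_at y i (a $ i + r i *\<^sub>R \<eta>))))"
          unfolding kk ss scaleR_scaleR ..
        also have "\<dots> = k I \<xi> *\<^sub>R poisson_integral (\<lambda>\<eta>. g (qreplace_at y i (a $ i + r i *\<^sub>R \<eta>))) (x i)"
          unfolding poisson_integral_def by (rule integral_scaleR_right)
        also have "\<dots> = k I \<xi> *\<^sub>R g y"
          using P[OF iM y x[OF iM]] yy by simp
        finally show "(LINT \<eta>|sphere_measure. k (insert i I) (\<xi>(i := \<eta>)) *\<^sub>R g (sh (insert i I) (\<xi>(i := \<eta>)))) = k I \<xi> *\<^sub>R g (sh I \<xi>)"
          by (simp add: y_def)
      qed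
      finally show ?case using insert.IH[OF IM] by simp
    qed
  qed
  have "sh M \<xi> = shift_on M a (\<lambda>i. r i *\<^sub>R \<xi> i)" for \<xi>
    by (auto simp: vec_eq_iff sh_def shift_on_def)
  then show ?thesis using main[of M] by (simp add: k_def)
qed

theorem proposition4p13:
  fixes D :: "('n::{finite,linorder}) cvec set"
    and f :: "'n qvec \<Rightarrow> quat"
    and a :: "'n qvec"
    and r :: "'n \<Rightarrow> real"
    and m :: 'n
    and x :: "'n \<Rightarrow> quat"
  assumes "open D" and "invariant_set D"
    and "slice_regular D f"
    and "a \<in> circ D"
    and "\<And>i. r i \<ge> 0"
    and "{y. \<forall>i. y $ i \<in> cball (a $ i) (r i)} \<subseteq> circ D"
    and "\<And>i. i \<le> m \<Longrightarrow> x i \<in> ball 0 1"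
  shows "f (shift_on {..m} a (\<lambda>i. r i *\<^sub>R x i)) =
    (\<Sum>K\<in>Pow {..m}. (- 1) ^ card ({..m} - K)
      * ord_prod (\<lambda>k. qcnj (a $ k) + r k *\<^sub>R qcnj (x k)) ({..m} - K)
      * (LINT \<xi>|PiM {..m} (\<lambda>_. sphere_measure).
          (\<Prod>j\<in>{..m}. poisson_kernel (x j) (\<xi> j))
            *\<^sub>R slice_component D {..m} K f (shift_on {..m} a (\<lambda>i. r i *\<^sub>R \<xi> i))))"
proof -
  note D = assms(1,2) and r = assms(5)
  obtain F where F: "holomorphic_stem D F" "induces D F f"
    using assms(3) unfolding slice_regular_def by blast
  have sub: "polyball a r \<subseteq> circ D" using assms(6) by (simp add: polyball_def)
  define y where "y = shift_on {..m} a (\<lambda>i. r i *\<^sub>R x i)"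
  have x: "norm (x i) < 1" if "i \<in> {..m}" for i using assms(7) that by auto
  have "r i * norm (x i) \<le> r i" if "i \<in> {..m}" for i
    by (rule mult_left_le) (use r x[OF that] in auto)
  then have "y \<in> polyball a r"
    unfolding polyball_def y_def shift_on_def using r by (auto simp: dist_norm)
  then have yD: "y \<in> circ D" using sub by blast
  have integral: "slice_component D {..m} K f y = (LINT \<xi>|PiM {..m} (\<lambda>_. sphere_measure).
      (\<Prod>j\<in>{..m}. poisson_kernel (x j) (\<xi> j)) *\<^sub>R slice_component D {..m} K f (shift_on {..m} a (\<lambda>i. r i *\<^sub>R \<xi> i)))"
    if K: "K \<in> Pow {..m}" for K
    unfolding y_def
  proof (rule iterated_poisson_formula[OF r])
    obtain G where G: "stem_function D G"
        "\<forall>j\<in>{..m}. \<exists>G1. regular_in D {j} G1 \<and> (\<forall>z\<in>off_real D {j}. G z = spherical_stem {j} G1 z)"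
        "\<forall>x\<in>circ D. slice_component D {..m} K f x = induced D G x"
      using slice_component_stem[OF D F PowD[OF K]] by blast
    show "continuous_on (polyball a r) (slice_component D {..m} K f)"
      by (rule continuous_on_eq[OF continuous_on_subset[OF continuous_on_induced[OF D(2) G(1)] sub]])
         (use G(3) sub in auto)
    fix j p q assume j: "j \<in> {..m}" and p: "p \<in> polyball a r" and q: "q \<in> ball (0::quat) 1"
    have mem: "qreplace_at p j c \<in> circ D" if "c \<in> cball (a $ j) (r j)" for c
      using p that sub by (auto simp: polyball_def qreplace_at_nth)
    have ball: "a $ j + r j *\<^sub>R \<xi> \<in> cball (a $ j) (r j)" if "norm \<xi> \<le> 1" for \<xi>
      using r[of j] that by (auto simp: dist_norm mult_left_le)
    obtain G1 where G1: "regular_in D {j} G1" "\<And>z. z \<in> off_real D {j} \<Longrightarrow> G z = spherical_stem {j} G1 z"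
      using G(2) j by blast
    have "slice_component D {..m} K f (qreplace_at p j (a $ j + r j *\<^sub>R q)) = induced D G (qreplace_at p j (a $ j + r j *\<^sub>R q))"
      using G(3) mem[OF ball] q by simp
    also have "\<dots> = poisson_integral (\<lambda>\<xi>. induced D G (qreplace_at p j (a $ j + r j *\<^sub>R \<xi>))) q"
      by (rule poisson_formula_in_variable[OF D G(1) G1 r mem q])
    also have "\<dots> = poisson_integral (\<lambda>\<xi>. slice_component D {..m} K f (qreplace_at p j (a $ j + r j *\<^sub>R \<xi>))) q"
      unfolding poisson_integral_def
      by (rule Bochner_Integration.integral_cong) (use G(3) mem[OF ball] in \<open>auto simp: space_sphere_measure\<close>)
    finally show "slice_component D {..m} K f (qreplace_at p j (a $ j + r j *\<^sub>R q)) =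
      poisson_integral (\<lambda>\<xi>. slice_component D {..m} K f (qreplace_at p j (a $ j + r j *\<^sub>R \<xi>))) q" .
  qed (use assms(7) in auto)
  have conj: "ord_prod (\<lambda>k. qcnj (y $ k)) ({..m} - K) = ord_prod (\<lambda>k. qcnj (a $ k) + r k *\<^sub>R qcnj (x k)) ({..m} - K)" for K
    by (rule ord_prod_cong) (auto simp: y_def shift_on_def qcnj_def quat_eq_iff)
  show ?thesis
    unfolding y_def[symmetric]
    using slice_component_expansion[OF D F yD, of m] by (simp add: conj integral)
qed

end
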